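(* (Selection adequacy) For any program $M:\sigma$ we have $\mathcal S[\![M]\!](0)=[\![\mathrm{Op}_s(M)]\!]_T$, where $0$ is the constantly $0$ reward function on $\mathcal S[\![\sigma]\!]$.
   Context: **Language.** Fix base types $b$, including $\mathtt{Bool}$ and $\mathtt{Rew}$; for each $b$ a set of constants $c:b$ (including $\mathtt{tt},\mathtt{ff}:\mathtt{Bool}$, $0:\mathtt{Rew}$); and function symbols $f:b_1\ldots b_m\to b$, including $=_b\,:b\,b\to\mathtt{Bool}$ for each $b$, $+:\mathtt{Rew}\,\mathtt{Rew}\to\mathtt{Rew}$, $\oplus_p:\mathtt{Rew}\,\mathtt{Rew}\to\mathtt{Rew}$ ($p\in[0,1]$) and $\le\,:\mathtt{Rew}\,\mathtt{Rew}\to\mathtt{Bool}$. Types: $\sigma::=b\mid\mathtt{Unit}\mid\sigma\times\sigma\mid\sigma\to\sigma$. Terms: $M::=x\mid c\mid f(M_1,\dots,M_m)\mid\mathtt{if}\,L\,\mathtt{then}\,M\,\mathtt{else}\,N\mid M\,\mathtt{or}\,N\mid N\cdot M\mid M+_pN\ (p\in[0,1])\mid *\mid\langle M,N\rangle\mid\mathtt{fst}(M)\mid\mathtt{snd}(M)\mid\lambda x{:}\sigma.M\mid MN$, up to $\alpha$-equivalence, with standard simple typing; $M\,\mathtt{or}\,N$ and $M+_pN$ have type $\sigma$ when $M,N:\sigma$, and $N\cdot M:\sigma$ when $N:\mathtt{Rew}$, $M:\sigma$. Programs are closed well-typed terms. Values (closed): $V::=c\mid *\mid\langle V,W\rangle\mid\lambda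 x{:}\sigma.M$; $\mathrm{Val}_\sigma$ is the set of values of type $\sigma$. Effect values: $E::=V\mid E_1\,\mathtt{or}\,E_2\mid c\cdot E\mid E_1+_pE_2$ ($c:\mathtt{Rew}$). **Ordinary operational semantics.** Evaluation contexts (closed): $\mathcal E::=[\,]\mid f(c_1,\dots,c_{k-1},\mathcal E,M_{k+1},\dots,M_m)\mid\mathtt{if}\,\mathcal E\,\mathtt{then}\,M\,\mathtt{else}\,N\mid\mathcal E\cdot M\mid\langle\mathcal E,N\rangle\mid\langle V,\mathcal E\rangle\mid\mathtt{fst}(\mathcal E)\mid\mathtt{snd}(\mathcal E)\mid\mathcal EN\mid(\lambda x{:}\sigma.M)\mathcal E$. Constants $\mathrm{val}_f(c_1,\dots,c_m):b$ are given for all $f$ and $c_i:b_i$, with $\mathrm{val}_{=_b}(c,c')=\mathtt{tt}$ if $c=c'$, else $\mathtt{ff}$. Steps $\mathcal E[Q]\to\mathcal E[Q']$ arise from: $f(c_1,\dots,c_m)\to\mathrm{val}_f(c_1,\dots,c_m)$; $\mathtt{if}\,\mathtt{tt}\,\mathtt{then}\,M\,\mathtt{else}\,N\to M$; $\mathtt{if}\,\mathtt{ff}\,\mathtt{then}\,M\,\mathtt{else}\,N\to N$; $\mathtt{fst}\langle V,W\rangle\to V$; $\mathtt{snd}\langle V,W\rangle\to W$; $(\lambda x{:}\sigma.M)V\to M[V/x]$. Evaluation is deterministic and terminating, and each program $M:\sigma$ has an effect value $\mathrm{Op}(M):\sigma$ determined by $\mathrm{Op}(V)=V$; $\mathrm{Op}(M)=\mathrm{Op}(M')$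 if $M\to M'$; $\mathrm{Op}(\mathcal E[M_1\,\mathtt{or}\,M_2])=\mathrm{Op}(\mathcal E[M_1])\,\mathtt{or}\,\mathrm{Op}(\mathcal E[M_2])$; $\mathrm{Op}(\mathcal E[M_1+_pM_2])=\mathrm{Op}(\mathcal E[M_1])+_p\mathrm{Op}(\mathcal E[M_2])$; $\mathrm{Op}(\mathcal E[c\cdot M_1])=c\cdot\mathrm{Op}(\mathcal E[M_1])$. **Rewards and interpretation.** A barycentric algebra is a set with binary operations $+_p$ ($p\in[0,1]$) such that $x+_1y=x$, $x+_px=x$, $x+_py=y+_{1-p}x$ and $(x+_py)+_qz=x+_{pq}(y+_{(1-p)q/(1-pq)}z)$ for $p,q<1$; finite convex combinations $\sum_ip_ix_i$ are then defined as usual. $R$ is a set with a barycentric algebra structure $+_p$, a commutative monoid structure $(+,0)$ with $r+(s+_ps')=(r+s)+_p(r+s')$, and a total order $\le$ such that for all $r,s,t$: $r\le s\iff r+t\le s+t$, and $r\le s\iff r+_pt\le s+_pt$ for $p\in(0,1)$. Given are nonempty sets $[\![b]\!]$ with $[\![\mathtt{Bool}]\!]=\{0,1\}$, $[\![\mathtt{Rew}]\!]=R$; elements $[\![c]\!]\in[\![b]\!]$ for $c:b$ with $[\![\mathtt{tt}]\!]=1$, $[\![\mathtt{ff}]\!]=0$, $[\![0]\!]=0$, distinct constants of the same type having distinct denotations, and $[\![c]\!]\ne0$ for some $c:\mathtt{Rew}$; and functions $[\![f]\!]:[\![b_1]\!]\times\cdots\times[\![b_m]\!]\to[\![b]\!]$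 with $[\![+]\!],[\![\oplus_p]\!],[\![\le]\!]$ the addition, the operation $+_p$ and the (characteristic function of the) order of $R$, and $[\![f]\!]([\![c_1]\!],\dots,[\![c_m]\!])=[\![\mathrm{val}_f(c_1,\dots,c_m)]\!]$. A barycentric $R$-module is a barycentric algebra with an action of $R$ ($0\cdot x=x$, $r\cdot(s\cdot x)=(r+s)\cdot x$) such that $r\cdot(x+_py)=r\cdot x+_pr\cdot y$; $R$ is one via $r\cdot s=r+s$. $DW(X)$ is the set of finitely supported probability distributions $\sum_ip_i\langle r_i,x_i\rangle$ on $R\times X$; it is the free barycentric $R$-module on $X$, with $r\cdot\sum_ip_i\langle r_i,x_i\rangle=\sum_ip_i\langle r+r_i,x_i\rangle$ and the usual $+_p$. The expected reward is $\mathbf E(\sum_ip_i\langle r_i,x_i\rangle)=\sum_ip_ir_i$. **Selection operational semantics.** Strategies: a value has the single strategy $*$; those of $E_1\,\mathtt{or}\,E_2$ are $1s$ ($s\in\mathrm{Str}(E_1)$) and $2s$ ($s\in\mathrm{Str}(E_2)$); those of $c\cdot E$ are those of $E$; those of $E_1+_pE_2$ are pairs $(s_1,s_2)$, $s_i\in\mathrm{Str}(E_i)$. Outcomes: $\mathrm{Out}( *,V)=\langle0,V\rangle$ (Dirac); $\mathrm{Out}(is,E_1\,\mathtt{or}\,E_2)=\mathrm{Out}(s,E_i)$; $\mathrm{Out}(s,c\cdot E)=[\![c]\!]\cdot\mathrm{Out}(s,E)$; $\mathrm{Out}((s_1,s_2),E_1+_pE_2)=p\,\mathrm{Out}(s_1,E_1)+(1-p)\,\mathrm{Out}(s_2,E_2)$.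 $\mathrm{Rew}(s,E)=\mathbf E(\mathrm{Out}(s,E))$. Strategies are totally ordered: on $E_1\,\mathtt{or}\,E_2$ all $1s$ precede all $2s'$, each group ordered as in $E_1$, resp. $E_2$; on $c\cdot E$ as in $E$; on $E_1+_pE_2$ lexicographically. $\mathrm{Op}_s(M)=\mathrm{Out}(s_{\rm opt},\mathrm{Op}(M))\in DW(\mathrm{Val}_\sigma)$, where $s_{\rm opt}$ is the least strategy of $\mathrm{Op}(M)$ maximizing $\mathrm{Rew}(s,\mathrm{Op}(M))$. **Auxiliary monad.** $T$ is a monad on sets (unit $\eta_T$, Kleisli extension $(-)^{\dagger_T}$), with operations $\cdot_T:R\times T(X)\to T(X)$ and $+_p:T(X)^2\to T(X)$ for all sets $X$ commuting with all Kleisli extensions (i.e. $T$-algebraic operations, induced by generic effects $R\to T(\{0\})$ and elements of $T(\{0,1\})$), and a $T$-algebra $\alpha_T:T(R)\to R$, such that (A1) each $T(X)$ is a barycentric $R$-module, and (A2) $\alpha_T(r\cdot u)=r+\alpha_T(u)$, $\alpha_T(u+_pv)=\alpha_T(u)+_p\alpha_T(v)$. **Denotational semantics.** $S(X)=(X\to R)\to T(X)$. For $F\in S(X)$, $\gamma:X\to R$ put $\mathbf R(F|\gamma)=\alpha_T(T(\gamma)(F(\gamma)))$. $S$ is a monad with $\eta(x)(\gamma)=\eta_T(x)$ and, for $f:X\to S(Y)$, $f^\dagger(F)(\gamma)=(\lambda x.\,f(x)(\gamma))^{\dagger_T}\big(F(\lambda x.\,\mathbf R(f(x)|\gamma))\big)$.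 Operations: $(G_0\,\mathtt{or}\,G_1)(\gamma)=G_0(\gamma)$ if $\mathbf R(G_0|\gamma)\ge\mathbf R(G_1|\gamma)$, else $G_1(\gamma)$; $(r\cdot G)(\gamma)=r\cdot_TG(\gamma)$; $(F+_pG)(\gamma)=F(\gamma)+_pG(\gamma)$. Types: $\mathcal S[\![b]\!]=[\![b]\!]$, $\mathcal S[\![\mathtt{Unit}]\!]=\{*\}$, $\mathcal S[\![\sigma\times\tau]\!]=\mathcal S[\![\sigma]\!]\times\mathcal S[\![\tau]\!]$, $\mathcal S[\![\sigma\to\tau]\!]=\mathcal S[\![\sigma]\!]\to S(\mathcal S[\![\tau]\!])$. A term $\Gamma\vdash M:\sigma$ denotes $\mathcal S[\![M]\!]:\mathcal S[\![\Gamma]\!]\to S(\mathcal S[\![\sigma]\!])$ by the standard left-to-right call-by-value monadic semantics: variables, constants, $*$ and abstractions via $\eta$ ($\mathcal S[\![\lambda x{:}\sigma.M]\!](\rho)=\eta(a\mapsto\mathcal S[\![M]\!](\rho,a))$); pairs, projections, applications, function symbols and conditions of conditionals by sequencing arguments left to right with Kleisli extension; $\mathtt{or}$ and $+_p$ by applying the corresponding operation of $S$ to the denotations of the arguments; $\mathcal S[\![N\cdot M]\!](\rho)=(r\mapsto r\cdot\mathcal S[\![M]\!](\rho))^\dagger(\mathcal S[\![N]\!](\rho))$. For programs $\mathcal S[\![M]\!]$ is regarded as an element of $S(\mathcal S[\![\sigma]\!])$. Values $V:\sigma$ have a pure semantics $\mathcal S_p[\![V]\!]\in\mathcal S[\![\sigma]\!]$: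 $\mathcal S_p[\![c]\!]=[\![c]\!]$, $\mathcal S_p[\![*]\!]=*$, $\mathcal S_p[\![\langle V,V'\rangle]\!]=\langle\mathcal S_p[\![V]\!],\mathcal S_p[\![V']\!]\rangle$, $\mathcal S_p[\![\lambda x{:}\tau.N]\!]=\mathcal S[\![x{:}\tau\vdash N]\!]$. For $\mu=\sum_{i=1}^np_i\langle r_i,V_i\rangle\in DW(\mathrm{Val}_\sigma)$ put $[\![\mu]\!]_T=\sum_{i=1}^np_i\,\big(r_i\cdot_T\eta_T(\mathcal S_p[\![V_i]\!])\big)\in T(\mathcal S[\![\sigma]\!])$. *)

theory Defs
  imports "HOL-Probability.Probability_Mass_Function"
begin

text \<open>
  ``Sets'' are subsets of a type \<open>'u\<close> of semantic values. HOL has no type that is closed under the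
  formation of function spaces, so two parameters make explicit which sets are available:
  \<^item> \<open>Types L\<close> is the set of simple types that are given a semantics. It contains the base types
    and \<open>UnitT\<close> and is closed under components, and terms are typed using these types only. With
    \<open>Types L = UNIV\<close> one has the language of all simple types, which needs a type \<open>'u\<close> of
    set-theoretic universe size. Each single program uses finitely many product and function types,
    and for a finite number of those no large \<open>'u\<close> is needed.
  \<^item> \<open>Obj K\<close> is the collection of sets on which the monad is defined; the monad is a monad on the
    full subcategory of the category of sets with these objects. It contains \<open>R\<close> and the
    denotations of all types in \<open>Types L\<close>. (Any monad on sets restricts to such a collection.)

  Pairs and functions are coded in \<open>'u\<close> by arbitrary injections \<open>pair_v\<close> and \<open>fun_v\<close>.
\<close>

section \<open>Language\<close>

datatype 'b ty = Base 'b | UnitT | Prod "'b ty" "'b ty" | Fun "'b ty" "'b ty"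

text \<open>Terms up to \<open>\<alpha>\<close>-equivalence, by de Bruijn indices. \<open>Act N M\<close> is \<open>N \<cdot> M\<close> and
  \<open>Mix p M N\<close> is \<open>M +\<^sub>p N\<close>.\<close>

datatype ('b, 'c, 'f) trm =
    Var nat
  | Const 'c
  | FApp 'f "('b, 'c, 'f) trm list"
  | If "('b, 'c, 'f) trm" "('b, 'c, 'f) trm" "('b, 'c, 'f) trm"
  | Or "('b, 'c, 'f) trm" "('b, 'c, 'f) trm"
  | Act "('b, 'c, 'f) trm" "('b, 'c, 'f) trm"
  | Mix real "('b, 'c, 'f) trm" "('b, 'c, 'f) trm"
  | Star
  | Pair "('b, 'c, 'f) trm" "('b, 'c, 'f) trm"
  | Fst "('b, 'c, 'f) trm"
  | Snd "('b, 'c, 'f) trm"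
  | Lam "'b ty" "('b, 'c, 'f) trm"
  | App "('b, 'c, 'f) trm" "('b, 'c, 'f) trm"

text \<open>Every \<open>c :: 'c\<close> is a constant of base type \<open>ctyp L c\<close> and every \<open>f :: 'f\<close> a function symbol;
  \<open>val_f L f cs\<close> is the constant to which \<open>f\<close> applied to the constants \<open>cs\<close> evaluates.\<close>

record ('b, 'c, 'f) lang =
  Types :: "'b ty set"
  BoolT :: 'b
  RewT :: 'b
  ctyp :: "'c \<Rightarrow> 'b"
  tt_c :: 'c
  ff_c :: 'c
  zero_c :: 'c
  fdom :: "'f \<Rightarrow> 'b list"
  fcod :: "'f \<Rightarrow> 'b"
  eq_f :: "'b \<Rightarrow> 'f"
  plus_f :: 'f
  mix_f :: "real \<Rightarrow> 'f"
  le_f :: 'f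
  val_f :: "'f \<Rightarrow> 'c list \<Rightarrow> 'c"

locale language =
  fixes L :: "('b, 'c, 'f) lang"
  assumes Base_Types: "Base b \<in> Types L"
    and UnitT_Types: "UnitT \<in> Types L"
    and Prod_Types: "Prod \<sigma> \<tau> \<in> Types L \<Longrightarrow> \<sigma> \<in> Types L \<and> \<tau> \<in> Types L"
    and Fun_Types: "Fun \<sigma> \<tau> \<in> Types L \<Longrightarrow> \<sigma> \<in> Types L \<and> \<tau> \<in> Types L"
    and Bool_neq_Rew: "BoolT L \<noteq> RewT L"
    and tt_typ: "ctyp L (tt_c L) = BoolT L"
    and ff_typ: "ctyp L (ff_c L) = BoolT L"
    and zero_typ: "ctyp L (zero_c L) = RewT L"
    and eq_typ: "fdom L (eq_f L b) = [b, b]" "fcod L (eq_f L b) = BoolT L"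
    and plus_typ: "fdom L (plus_f L) = [RewT L, RewT L]" "fcod L (plus_f L) = RewT L"
    and mix_typ: "0 \<le> p \<Longrightarrow> p \<le> 1 \<Longrightarrow> fdom L (mix_f L p) = [RewT L, RewT L]"
      "0 \<le> p \<Longrightarrow> p \<le> 1 \<Longrightarrow> fcod L (mix_f L p) = RewT L"
    and le_typ: "fdom L (le_f L) = [RewT L, RewT L]" "fcod L (le_f L) = BoolT L"
    and val_typ: "map (ctyp L) cs = fdom L f \<Longrightarrow> ctyp L (val_f L f cs) = fcod L f"
    and val_eq: "ctyp L c = b \<Longrightarrow> ctyp L c' = b \<Longrightarrow>
      val_f L (eq_f L b) [c, c'] = (if c = c' then tt_c L else ff_c L)"

text \<open>Simple typing. In a derivation from the empty context, the side conditions on \<open>Pair\<close> and \<open>Lam\<close>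
  suffice to keep all types in \<open>Types L\<close>.\<close>

inductive typing :: "('b, 'c, 'f) lang \<Rightarrow> 'b ty list \<Rightarrow> ('b, 'c, 'f) trm \<Rightarrow> 'b ty \<Rightarrow> bool"
  for L :: "('b, 'c, 'f) lang" where
  Var: "i < length \<Gamma> \<Longrightarrow> typing L \<Gamma> (Var i) (\<Gamma> ! i)"
| Const: "typing L \<Gamma> (Const c) (Base (ctyp L c))"
| FApp: "list_all2 (\<lambda>M b. typing L \<Gamma> M (Base b)) Ms (fdom L f) \<Longrightarrow>
    typing L \<Gamma> (FApp f Ms) (Base (fcod L f))"
| If: "typing L \<Gamma> N (Base (BoolT L)) \<Longrightarrow> typing L \<Gamma> M\<^sub>1 \<sigma> \<Longrightarrow> typing L \<Gamma> M\<^sub>2 \<sigma> \<Longrightarrow>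
    typing L \<Gamma> (If N M\<^sub>1 M\<^sub>2) \<sigma>"
| Or: "typing L \<Gamma> M \<sigma> \<Longrightarrow> typing L \<Gamma> N \<sigma> \<Longrightarrow> typing L \<Gamma> (Or M N) \<sigma>"
| Act: "typing L \<Gamma> N (Base (RewT L)) \<Longrightarrow> typing L \<Gamma> M \<sigma> \<Longrightarrow> typing L \<Gamma> (Act N M) \<sigma>"
| Mix: "0 \<le> p \<Longrightarrow> p \<le> 1 \<Longrightarrow> typing L \<Gamma> M \<sigma> \<Longrightarrow> typing L \<Gamma> N \<sigma> \<Longrightarrow> typing L \<Gamma> (Mix p M N) \<sigma>"
| Star: "typing L \<Gamma> Star UnitT"
| Pair: "typing L \<Gamma> M \<sigma> \<Longrightarrow> typing L \<Gamma> N \<tau> \<Longrightarrow> Prod \<sigma> \<tau> \<in> Types L \<Longrightarrow>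
    typing L \<Gamma> (Pair M N) (Prod \<sigma> \<tau>)"
| Fst: "typing L \<Gamma> M (Prod \<sigma> \<tau>) \<Longrightarrow> typing L \<Gamma> (Fst M) \<sigma>"
| Snd: "typing L \<Gamma> M (Prod \<sigma> \<tau>) \<Longrightarrow> typing L \<Gamma> (Snd M) \<tau>"
| Lam: "typing L (\<sigma> # \<Gamma>) M \<tau> \<Longrightarrow> Fun \<sigma> \<tau> \<in> Types L \<Longrightarrow> typing L \<Gamma> (Lam \<sigma> M) (Fun \<sigma> \<tau>)"
| App: "typing L \<Gamma> M (Fun \<sigma> \<tau>) \<Longrightarrow> typing L \<Gamma> N \<sigma> \<Longrightarrow> typing L \<Gamma> (App M N) \<tau>"
  monos list_all2_mono

definition ty_of :: "('b, 'c, 'f) lang \<Rightarrow> 'b ty list \<Rightarrow> ('b, 'c, 'f) trm \<Rightarrow> 'b ty" where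
  "ty_of L \<Gamma> M = (THE \<sigma>. typing L \<Gamma> M \<sigma>)"

definition program :: "('b, 'c, 'f) lang \<Rightarrow> ('b, 'c, 'f) trm \<Rightarrow> 'b ty \<Rightarrow> bool" where
  "program L M \<sigma> \<longleftrightarrow> typing L [] M \<sigma>"


section \<open>Ordinary operational semantics\<close>

primrec lift :: "('b, 'c, 'f) trm \<Rightarrow> nat \<Rightarrow> ('b, 'c, 'f) trm" where
  "lift (Var i) k = (if i < k then Var i else Var (Suc i))"
| "lift (Const c) k = Const c"
| "lift (FApp f Ms) k = FApp f (map (\<lambda>M. lift M k) Ms)"
| "lift (If N M\<^sub>1 M\<^sub>2) k = If (lift N k) (lift M\<^sub>1 k) (lift M\<^sub>2 k)"
| "lift (Or M N) k = Or (lift M k) (lift N k)"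
| "lift (Act N M) k = Act (lift N k) (lift M k)"
| "lift (Mix p M N) k = Mix p (lift M k) (lift N k)"
| "lift Star k = Star"
| "lift (Pair M N) k = Pair (lift M k) (lift N k)"
| "lift (Fst M) k = Fst (lift M k)"
| "lift (Snd M) k = Snd (lift M k)"
| "lift (Lam \<sigma> M) k = Lam \<sigma> (lift M (Suc k))"
| "lift (App M N) k = App (lift M k) (lift N k)"

primrec subst :: "('b, 'c, 'f) trm \<Rightarrow> nat \<Rightarrow> ('b, 'c, 'f) trm \<Rightarrow> ('b, 'c, 'f) trm" where
  "subst (Var i) k V = (if i < k then Var i else if i = k then V else Var (i - 1))"
| "subst (Const c) k V = Const c"
| "subst (FApp f Ms) k V = FApp f (map (\<lambda>M. subst M k V) Ms)"
| "subst (If N M\<^sub>1 M\<^sub>2) k V = If (subst N k V) (subst M\<^sub>1 k V) (subst M\<^sub>2 k V)"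
| "subst (Or M N) k V = Or (subst M k V) (subst N k V)"
| "subst (Act N M) k V = Act (subst N k V) (subst M k V)"
| "subst (Mix p M N) k V = Mix p (subst M k V) (subst N k V)"
| "subst Star k V = Star"
| "subst (Pair M N) k V = Pair (subst M k V) (subst N k V)"
| "subst (Fst M) k V = Fst (subst M k V)"
| "subst (Snd M) k V = Snd (subst M k V)"
| "subst (Lam \<sigma> M) k V = Lam \<sigma> (subst M (Suc k) (lift V 0))"
| "subst (App M N) k V = App (subst M k V) (subst N k V)"

inductive is_val :: "('b, 'c, 'f) trm \<Rightarrow> bool" where
  "is_val (Const c)"
| "is_val Star"
| "is_val V \<Longrightarrow> is_val W \<Longrightarrow> is_val (Pair V W)"
| "is_val (Lam \<sigma> M)"

text \<open>Evaluation contexts, as the functions filling their hole.\<close>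

inductive ectx :: "(('b, 'c, 'f) trm \<Rightarrow> ('b, 'c, 'f) trm) \<Rightarrow> bool" where
  "ectx (\<lambda>Q. Q)"
| "ectx C \<Longrightarrow> ectx (\<lambda>Q. FApp f (map Const cs @ C Q # Ms))"
| "ectx C \<Longrightarrow> ectx (\<lambda>Q. If (C Q) M N)"
| "ectx C \<Longrightarrow> ectx (\<lambda>Q. Act (C Q) M)"
| "ectx C \<Longrightarrow> ectx (\<lambda>Q. Pair (C Q) N)"
| "is_val V \<Longrightarrow> ectx C \<Longrightarrow> ectx (\<lambda>Q. Pair V (C Q))"
| "ectx C \<Longrightarrow> ectx (\<lambda>Q. Fst (C Q))"
| "ectx C \<Longrightarrow> ectx (\<lambda>Q. Snd (C Q))"
| "ectx C \<Longrightarrow> ectx (\<lambda>Q. App (C Q) N)"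
| "ectx C \<Longrightarrow> ectx (\<lambda>Q. App (Lam \<sigma> M) (C Q))"

inductive redex :: "('b, 'c, 'f) lang \<Rightarrow> ('b, 'c, 'f) trm \<Rightarrow> ('b, 'c, 'f) trm \<Rightarrow> bool"
  for L :: "('b, 'c, 'f) lang" where
  "redex L (FApp f (map Const cs)) (Const (val_f L f cs))"
| "redex L (If (Const (tt_c L)) M N) M"
| "redex L (If (Const (ff_c L)) M N) N"
| "is_val V \<Longrightarrow> is_val W \<Longrightarrow> redex L (Fst (Pair V W)) V"
| "is_val V \<Longrightarrow> is_val W \<Longrightarrow> redex L (Snd (Pair V W)) W"
| "is_val V \<Longrightarrow> redex L (App (Lam \<sigma> M) V) (subst M 0 V)"

inductive step :: "('b, 'c, 'f) lang \<Rightarrow> ('b, 'c, 'f) trm \<Rightarrow> ('b, 'c, 'f) trm \<Rightarrow> bool"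
  for L :: "('b, 'c, 'f) lang" where
  "ectx C \<Longrightarrow> redex L Q Q' \<Longrightarrow> step L (C Q) (C Q')"

datatype ('b, 'c, 'f) eff =
    EVal "('b, 'c, 'f) trm"
  | EOr "('b, 'c, 'f) eff" "('b, 'c, 'f) eff"
  | EAct 'c "('b, 'c, 'f) eff"
  | EMix real "('b, 'c, 'f) eff" "('b, 'c, 'f) eff"

inductive op_rel :: "('b, 'c, 'f) lang \<Rightarrow> ('b, 'c, 'f) trm \<Rightarrow> ('b, 'c, 'f) eff \<Rightarrow> bool"
  for L :: "('b, 'c, 'f) lang" where
  "is_val V \<Longrightarrow> op_rel L V (EVal V)"
| "step L M M' \<Longrightarrow> op_rel L M' E \<Longrightarrow> op_rel L M E"
| "ectx C \<Longrightarrow> op_rel L (C M\<^sub>1) E\<^sub>1 \<Longrightarrow> op_rel L (C M\<^sub>2) E\<^sub>2 \<Longrightarrow> op_rel L (C (Or M\<^sub>1 M\<^sub>2)) (EOr E\<^sub>1 E\<^sub>2)"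
| "ectx C \<Longrightarrow> op_rel L (C M\<^sub>1) E\<^sub>1 \<Longrightarrow> op_rel L (C M\<^sub>2) E\<^sub>2 \<Longrightarrow>
    op_rel L (C (Mix p M\<^sub>1 M\<^sub>2)) (EMix p E\<^sub>1 E\<^sub>2)"
| "ectx C \<Longrightarrow> op_rel L (C M) E \<Longrightarrow> op_rel L (C (Act (Const c) M)) (EAct c E)"

definition Op :: "('b, 'c, 'f) lang \<Rightarrow> ('b, 'c, 'f) trm \<Rightarrow> ('b, 'c, 'f) eff" where
  "Op L M = (THE E. op_rel L M E)"


section \<open>Barycentric algebras and rewards\<close>

locale barycentric_algebra =
  fixes A :: "'a set" and mix :: "real \<Rightarrow> 'a \<Rightarrow> 'a \<Rightarrow> 'a"
  assumes mix_closed: "0 \<le> p \<Longrightarrow> p \<le> 1 \<Longrightarrow> x \<in> A \<Longrightarrow> y \<in> A \<Longrightarrow> mix p x y \<in> A"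
    and mix_one: "x \<in> A \<Longrightarrow> y \<in> A \<Longrightarrow> mix 1 x y = x"
    and mix_idem: "0 \<le> p \<Longrightarrow> p \<le> 1 \<Longrightarrow> x \<in> A \<Longrightarrow> mix p x x = x"
    and mix_comm: "0 \<le> p \<Longrightarrow> p \<le> 1 \<Longrightarrow> x \<in> A \<Longrightarrow> y \<in> A \<Longrightarrow> mix p x y = mix (1 - p) y x"
    and mix_assoc: "0 \<le> p \<Longrightarrow> p < 1 \<Longrightarrow> 0 \<le> q \<Longrightarrow> q < 1 \<Longrightarrow> x \<in> A \<Longrightarrow> y \<in> A \<Longrightarrow> z \<in> A \<Longrightarrow>
      mix q (mix p x y) z = mix (p * q) x (mix ((1 - p) * q / (1 - p * q)) y z)"

text \<open>\<open>convex_sum mix [(p\<^sub>1, x\<^sub>1), \<dots>, (p\<^sub>n, x\<^sub>n)]\<close> is the convex combination of the \<open>x\<^sub>i\<close> with weights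
  proportional to the \<open>p\<^sub>i > 0\<close>, obtained by splitting off the first summand. \<open>convex_comb\<close> is the
  combination \<open>\<Sum>\<^sub>x \<mu>(x) g(x)\<close>, where the enumeration chosen for the support is immaterial in a
  barycentric algebra.\<close>

fun convex_sum :: "(real \<Rightarrow> 'a \<Rightarrow> 'a \<Rightarrow> 'a) \<Rightarrow> (real \<times> 'a) list \<Rightarrow> 'a" where
  "convex_sum mix [] = undefined"
| "convex_sum mix [(p, x)] = x"
| "convex_sum mix ((p, x) # y # ys) =
    mix (p / (p + sum_list (map fst (y # ys)))) x (convex_sum mix (y # ys))"

definition convex_comb :: "(real \<Rightarrow> 'a \<Rightarrow> 'a \<Rightarrow> 'a) \<Rightarrow> 'x pmf \<Rightarrow> ('x \<Rightarrow> 'a) \<Rightarrow> 'a" where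
  "convex_comb mix \<mu> g =
    convex_sum mix (map (\<lambda>x. (pmf \<mu> x, g x)) (SOME xs. distinct xs \<and> set xs = set_pmf \<mu>))"

record 'u rewards =
  Rcar :: "'u set"
  Rmix :: "real \<Rightarrow> 'u \<Rightarrow> 'u \<Rightarrow> 'u"
  Rplus :: "'u \<Rightarrow> 'u \<Rightarrow> 'u"
  Rzero :: 'u
  Rle :: "'u \<Rightarrow> 'u \<Rightarrow> bool"

locale reward_structure = barycentric_algebra "Rcar R" "Rmix R"
  for R :: "('u, 'z) rewards_scheme" +
  assumes zero_closed: "Rzero R \<in> Rcar R"
    and plus_closed: "r \<in> Rcar R \<Longrightarrow> s \<in> Rcar R \<Longrightarrow> Rplus R r s \<in> Rcar R"
    and plus_assoc: "r \<in> Rcar R \<Longrightarrow> s \<in> Rcar R \<Longrightarrow> t \<in> Rcar R \<Longrightarrow>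
      Rplus R (Rplus R r s) t = Rplus R r (Rplus R s t)"
    and plus_comm: "r \<in> Rcar R \<Longrightarrow> s \<in> Rcar R \<Longrightarrow> Rplus R r s = Rplus R s r"
    and plus_zero: "r \<in> Rcar R \<Longrightarrow> Rplus R (Rzero R) r = r"
    and plus_mix: "0 \<le> p \<Longrightarrow> p \<le> 1 \<Longrightarrow> r \<in> Rcar R \<Longrightarrow> s \<in> Rcar R \<Longrightarrow> s' \<in> Rcar R \<Longrightarrow>
      Rplus R r (Rmix R p s s') = Rmix R p (Rplus R r s) (Rplus R r s')"
    and le_refl: "r \<in> Rcar R \<Longrightarrow> Rle R r r"
    and le_antisym: "r \<in> Rcar R \<Longrightarrow> s \<in> Rcar R \<Longrightarrow> Rle R r s \<Longrightarrow> Rle R s r \<Longrightarrow> r = s"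
    and le_trans: "r \<in> Rcar R \<Longrightarrow> s \<in> Rcar R \<Longrightarrow> t \<in> Rcar R \<Longrightarrow> Rle R r s \<Longrightarrow> Rle R s t \<Longrightarrow> Rle R r t"
    and le_total: "r \<in> Rcar R \<Longrightarrow> s \<in> Rcar R \<Longrightarrow> Rle R r s \<or> Rle R s r"
    and le_plus: "r \<in> Rcar R \<Longrightarrow> s \<in> Rcar R \<Longrightarrow> t \<in> Rcar R \<Longrightarrow>
      Rle R r s \<longleftrightarrow> Rle R (Rplus R r t) (Rplus R s t)"
    and le_mix: "0 < p \<Longrightarrow> p < 1 \<Longrightarrow> r \<in> Rcar R \<Longrightarrow> s \<in> Rcar R \<Longrightarrow> t \<in> Rcar R \<Longrightarrow>
      Rle R r s \<longleftrightarrow> Rle R (Rmix R p r t) (Rmix R p s t)"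

locale barycentric_module = barycentric_algebra A mix
  for R :: "('u, 'z) rewards_scheme" and A :: "'a set" and mix :: "real \<Rightarrow> 'a \<Rightarrow> 'a \<Rightarrow> 'a"
    and act :: "'u \<Rightarrow> 'a \<Rightarrow> 'a" +
  assumes act_closed: "r \<in> Rcar R \<Longrightarrow> x \<in> A \<Longrightarrow> act r x \<in> A"
    and act_zero: "x \<in> A \<Longrightarrow> act (Rzero R) x = x"
    and act_plus: "r \<in> Rcar R \<Longrightarrow> s \<in> Rcar R \<Longrightarrow> x \<in> A \<Longrightarrow> act r (act s x) = act (Rplus R r s) x"
    and act_mix: "0 \<le> p \<Longrightarrow> p \<le> 1 \<Longrightarrow> r \<in> Rcar R \<Longrightarrow> x \<in> A \<Longrightarrow> y \<in> A \<Longrightarrow>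
      act r (mix p x y) = mix p (act r x) (act r y)"


section \<open>Interpretation of the base language\<close>

text \<open>\<open>false_v\<close> and \<open>true_v\<close> are the elements \<open>0\<close> and \<open>1\<close> of \<open>[[Bool]]\<close>. \<open>fun_v I \<sigma> \<tau>\<close> codes the elements
  of the function set \<open>S[[\<sigma>]] \<rightarrow> S(S[[\<tau>]])\<close>, where elements of \<open>S(X) = (X \<rightarrow> R) \<rightarrow> T(X)\<close> are HOL
  functions of type \<open>('u \<Rightarrow> 'u) \<Rightarrow> 'u\<close>.\<close>

record ('b, 'c, 'f, 'u) interp = "'u rewards" +
  base_set :: "'b \<Rightarrow> 'u set"
  const_den :: "'c \<Rightarrow> 'u"
  fun_den :: "'f \<Rightarrow> 'u list \<Rightarrow> 'u"
  false_v :: 'u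
  true_v :: 'u
  unit_v :: 'u
  pair_v :: "'u \<Rightarrow> 'u \<Rightarrow> 'u"
  fun_v :: "'b ty \<Rightarrow> 'b ty \<Rightarrow> ('u \<Rightarrow> ('u \<Rightarrow> 'u) \<Rightarrow> 'u) \<Rightarrow> 'u"

locale base_interpretation = language L + reward_structure I
  for L :: "('b, 'c, 'f) lang" and I :: "('b, 'c, 'f, 'u) interp" +
  assumes base_nonempty: "base_set I b \<noteq> {}"
    and base_Bool: "base_set I (BoolT L) = {false_v I, true_v I}" "false_v I \<noteq> true_v I"
    and base_Rew: "base_set I (RewT L) = Rcar I"
    and const_closed: "const_den I c \<in> base_set I (ctyp L c)"
    and const_inj: "ctyp L c = ctyp L c' \<Longrightarrow> const_den I c = const_den I c' \<Longrightarrow> c = c'"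
    and const_tt: "const_den I (tt_c L) = true_v I"
    and const_ff: "const_den I (ff_c L) = false_v I"
    and const_zero: "const_den I (zero_c L) = Rzero I"
    and const_nonzero: "\<exists>c. ctyp L c = RewT L \<and> const_den I c \<noteq> Rzero I"
    and fun_closed: "list_all2 (\<lambda>x b. x \<in> base_set I b) xs (fdom L f) \<Longrightarrow>
      fun_den I f xs \<in> base_set I (fcod L f)"
    and fun_plus: "r \<in> Rcar I \<Longrightarrow> s \<in> Rcar I \<Longrightarrow> fun_den I (plus_f L) [r, s] = Rplus I r s"
    and fun_mix: "0 \<le> p \<Longrightarrow> p \<le> 1 \<Longrightarrow> r \<in> Rcar I \<Longrightarrow> s \<in> Rcar I \<Longrightarrow>
      fun_den I (mix_f L p) [r, s] = Rmix I p r s"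
    and fun_le: "r \<in> Rcar I \<Longrightarrow> s \<in> Rcar I \<Longrightarrow>
      fun_den I (le_f L) [r, s] = (if Rle I r s then true_v I else false_v I)"
    and fun_val: "map (ctyp L) cs = fdom L f \<Longrightarrow>
      fun_den I f (map (const_den I) cs) = const_den I (val_f L f cs)"


section \<open>Selection operational semantics\<close>

datatype str = SStar | SLeft str | SRight str | SPair str str

primrec Str :: "('b, 'c, 'f) eff \<Rightarrow> str set" where
  "Str (EVal V) = {SStar}"
| "Str (EOr E\<^sub>1 E\<^sub>2) = SLeft ` Str E\<^sub>1 \<union> SRight ` Str E\<^sub>2"
| "Str (EAct c E) = Str E"
| "Str (EMix p E\<^sub>1 E\<^sub>2) = {SPair s\<^sub>1 s\<^sub>2 | s\<^sub>1 s\<^sub>2. s\<^sub>1 \<in> Str E\<^sub>1 \<and> s\<^sub>2 \<in> Str E\<^sub>2}"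

fun str_less :: "str \<Rightarrow> str \<Rightarrow> bool" where
  "str_less (SLeft s) (SLeft t) \<longleftrightarrow> str_less s t"
| "str_less (SLeft s) (SRight t) \<longleftrightarrow> True"
| "str_less (SRight s) (SRight t) \<longleftrightarrow> str_less s t"
| "str_less (SPair s\<^sub>1 s\<^sub>2) (SPair t\<^sub>1 t\<^sub>2) \<longleftrightarrow> str_less s\<^sub>1 t\<^sub>1 \<or> s\<^sub>1 = t\<^sub>1 \<and> str_less s\<^sub>2 t\<^sub>2"
| "str_less _ _ \<longleftrightarrow> False"

text \<open>Elements of \<open>DW(X)\<close> are finitely supported probability mass functions on \<open>R \<times> X\<close>.\<close>

definition dw_act ::
    "('b, 'c, 'f, 'u) interp \<Rightarrow> 'u \<Rightarrow> ('u \<times> 'x) pmf \<Rightarrow> ('u \<times> 'x) pmf" where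
  "dw_act I r \<mu> = map_pmf (\<lambda>(r', x). (Rplus I r r', x)) \<mu>"

definition dw_mix :: "real \<Rightarrow> ('u \<times> 'x) pmf \<Rightarrow> ('u \<times> 'x) pmf \<Rightarrow> ('u \<times> 'x) pmf" where
  "dw_mix p \<mu> \<nu> = bind_pmf (bernoulli_pmf p) (\<lambda>b. if b then \<mu> else \<nu>)"

definition expected_reward :: "('b, 'c, 'f, 'u) interp \<Rightarrow> ('u \<times> 'x) pmf \<Rightarrow> 'u" where
  "expected_reward I \<mu> = convex_comb (Rmix I) \<mu> fst"

fun Out :: "('b, 'c, 'f, 'u) interp \<Rightarrow> str \<Rightarrow> ('b, 'c, 'f) eff \<Rightarrow> ('u \<times> ('b, 'c, 'f) trm) pmf" where
  "Out I SStar (EVal V) = return_pmf (Rzero I, V)"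
| "Out I (SLeft s) (EOr E\<^sub>1 E\<^sub>2) = Out I s E\<^sub>1"
| "Out I (SRight s) (EOr E\<^sub>1 E\<^sub>2) = Out I s E\<^sub>2"
| "Out I s (EAct c E) = dw_act I (const_den I c) (Out I s E)"
| "Out I (SPair s\<^sub>1 s\<^sub>2) (EMix p E\<^sub>1 E\<^sub>2) = dw_mix p (Out I s\<^sub>1 E\<^sub>1) (Out I s\<^sub>2 E\<^sub>2)"

definition Rew :: "('b, 'c, 'f, 'u) interp \<Rightarrow> str \<Rightarrow> ('b, 'c, 'f) eff \<Rightarrow> 'u" where
  "Rew I s E = expected_reward I (Out I s E)"

definition max_str :: "('b, 'c, 'f, 'u) interp \<Rightarrow> ('b, 'c, 'f) eff \<Rightarrow> str set" where
  "max_str I E = {s \<in> Str E. \<forall>t \<in> Str E. Rle I (Rew I t E) (Rew I s E)}"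

definition opt_str :: "('b, 'c, 'f, 'u) interp \<Rightarrow> ('b, 'c, 'f) eff \<Rightarrow> str" where
  "opt_str I E = (THE s. s \<in> max_str I E \<and> (\<forall>t \<in> max_str I E. t = s \<or> str_less s t))"

definition Op_s :: "('b, 'c, 'f) lang \<Rightarrow> ('b, 'c, 'f, 'u) interp \<Rightarrow> ('b, 'c, 'f) trm \<Rightarrow>
    ('u \<times> ('b, 'c, 'f) trm) pmf" where
  "Op_s L I M = Out I (opt_str I (Op L M)) (Op L M)"


section \<open>Auxiliary monad\<close>

text \<open>\<open>ext K X Y f\<close> is the Kleisli extension \<open>T X \<rightarrow> T Y\<close> of \<open>f : X \<rightarrow> T Y\<close>; \<open>Tact K X\<close> and \<open>Tmix K X\<close> are
  the operations on \<open>T X\<close>.\<close>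

record 'u aux_monad =
  Obj :: "'u set set"
  T :: "'u set \<Rightarrow> 'u set"
  unit :: "'u set \<Rightarrow> 'u \<Rightarrow> 'u"
  ext :: "'u set \<Rightarrow> 'u set \<Rightarrow> ('u \<Rightarrow> 'u) \<Rightarrow> 'u \<Rightarrow> 'u"
  Tact :: "'u set \<Rightarrow> 'u \<Rightarrow> 'u \<Rightarrow> 'u"
  Tmix :: "'u set \<Rightarrow> real \<Rightarrow> 'u \<Rightarrow> 'u \<Rightarrow> 'u"
  alg :: "'u \<Rightarrow> 'u"

definition Tmap :: "'u aux_monad \<Rightarrow> 'u set \<Rightarrow> 'u set \<Rightarrow> ('u \<Rightarrow> 'u) \<Rightarrow> 'u \<Rightarrow> 'u" where
  "Tmap K X Y h = ext K X Y (\<lambda>x. unit K Y (h x))"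

definition Tmult :: "'u aux_monad \<Rightarrow> 'u set \<Rightarrow> 'u \<Rightarrow> 'u" where
  "Tmult K X = ext K (T K X) X (\<lambda>u. u)"

locale set_monad =
  fixes K :: "'u aux_monad"
  assumes T_Obj: "X \<in> Obj K \<Longrightarrow> T K X \<in> Obj K"
    and unit_closed: "X \<in> Obj K \<Longrightarrow> x \<in> X \<Longrightarrow> unit K X x \<in> T K X"
    and ext_closed: "X \<in> Obj K \<Longrightarrow> Y \<in> Obj K \<Longrightarrow> f \<in> X \<rightarrow> T K Y \<Longrightarrow> u \<in> T K X \<Longrightarrow>
      ext K X Y f u \<in> T K Y"
    and ext_cong: "X \<in> Obj K \<Longrightarrow> Y \<in> Obj K \<Longrightarrow> f \<in> X \<rightarrow> T K Y \<Longrightarrow> u \<in> T K X \<Longrightarrow>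
      (\<And>x. x \<in> X \<Longrightarrow> f x = g x) \<Longrightarrow> ext K X Y f u = ext K X Y g u"
    and ext_unit: "X \<in> Obj K \<Longrightarrow> u \<in> T K X \<Longrightarrow> ext K X X (unit K X) u = u"
    and unit_ext: "X \<in> Obj K \<Longrightarrow> Y \<in> Obj K \<Longrightarrow> f \<in> X \<rightarrow> T K Y \<Longrightarrow> x \<in> X \<Longrightarrow>
      ext K X Y f (unit K X x) = f x"
    and ext_ext: "X \<in> Obj K \<Longrightarrow> Y \<in> Obj K \<Longrightarrow> Z \<in> Obj K \<Longrightarrow> f \<in> X \<rightarrow> T K Y \<Longrightarrow> g \<in> Y \<rightarrow> T K Z \<Longrightarrow>
      u \<in> T K X \<Longrightarrow> ext K Y Z g (ext K X Y f u) = ext K X Z (\<lambda>x. ext K Y Z g (f x)) u"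

locale auxiliary_monad = set_monad K + reward_structure R
  for K :: "'u aux_monad" and R :: "('u, 'z) rewards_scheme" +
  assumes R_Obj: "Rcar R \<in> Obj K"
    and ext_act: "X \<in> Obj K \<Longrightarrow> Y \<in> Obj K \<Longrightarrow> f \<in> X \<rightarrow> T K Y \<Longrightarrow> r \<in> Rcar R \<Longrightarrow> u \<in> T K X \<Longrightarrow>
      ext K X Y f (Tact K X r u) = Tact K Y r (ext K X Y f u)"
    and ext_mix: "X \<in> Obj K \<Longrightarrow> Y \<in> Obj K \<Longrightarrow> f \<in> X \<rightarrow> T K Y \<Longrightarrow> 0 \<le> p \<Longrightarrow> p \<le> 1 \<Longrightarrow>
      u \<in> T K X \<Longrightarrow> v \<in> T K X \<Longrightarrow>
      ext K X Y f (Tmix K X p u v) = Tmix K Y p (ext K X Y f u) (ext K X Y f v)"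
    and alg_closed: "u \<in> T K (Rcar R) \<Longrightarrow> alg K u \<in> Rcar R"
    and alg_unit: "r \<in> Rcar R \<Longrightarrow> alg K (unit K (Rcar R) r) = r"
    and alg_mult: "w \<in> T K (T K (Rcar R)) \<Longrightarrow>
      alg K (Tmult K (Rcar R) w) = alg K (Tmap K (T K (Rcar R)) (Rcar R) (alg K) w)"
    and A1: "X \<in> Obj K \<Longrightarrow> barycentric_module R (T K X) (Tmix K X) (Tact K X)"
    and A2_act: "r \<in> Rcar R \<Longrightarrow> u \<in> T K (Rcar R) \<Longrightarrow>
      alg K (Tact K (Rcar R) r u) = Rplus R r (alg K u)"
    and A2_mix: "0 \<le> p \<Longrightarrow> p \<le> 1 \<Longrightarrow> u \<in> T K (Rcar R) \<Longrightarrow> v \<in> T K (Rcar R) \<Longrightarrow>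
      alg K (Tmix K (Rcar R) p u v) = Rmix R p (alg K u) (alg K v)"


section \<open>Denotational semantics\<close>

text \<open>All function sets are sets of extensional functions, so that equality in HOL is equality of
  elements of the function sets.\<close>

definition S_set :: "('b, 'c, 'f, 'u) interp \<Rightarrow> 'u aux_monad \<Rightarrow> 'u set \<Rightarrow> (('u \<Rightarrow> 'u) \<Rightarrow> 'u) set" where
  "S_set I K X = (X \<rightarrow>\<^sub>E Rcar I) \<rightarrow>\<^sub>E T K X"

definition S_rew :: "('b, 'c, 'f, 'u) interp \<Rightarrow> 'u aux_monad \<Rightarrow> 'u set \<Rightarrow>
    (('u \<Rightarrow> 'u) \<Rightarrow> 'u) \<Rightarrow> ('u \<Rightarrow> 'u) \<Rightarrow> 'u" where
  "S_rew I K X F \<gamma> = alg K (Tmap K X (Rcar I) \<gamma> (F \<gamma>))"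

definition S_unit :: "('b, 'c, 'f, 'u) interp \<Rightarrow> 'u aux_monad \<Rightarrow> 'u set \<Rightarrow>
    'u \<Rightarrow> ('u \<Rightarrow> 'u) \<Rightarrow> 'u" where
  "S_unit I K X x = (\<lambda>\<gamma> \<in> X \<rightarrow>\<^sub>E Rcar I. unit K X x)"

definition S_ext :: "('b, 'c, 'f, 'u) interp \<Rightarrow> 'u aux_monad \<Rightarrow> 'u set \<Rightarrow> 'u set \<Rightarrow>
    ('u \<Rightarrow> ('u \<Rightarrow> 'u) \<Rightarrow> 'u) \<Rightarrow> (('u \<Rightarrow> 'u) \<Rightarrow> 'u) \<Rightarrow> ('u \<Rightarrow> 'u) \<Rightarrow> 'u" where
  "S_ext I K X Y f F =
    (\<lambda>\<gamma> \<in> Y \<rightarrow>\<^sub>E Rcar I. ext K X Y (\<lambda>x. f x \<gamma>) (F (\<lambda>x \<in> X. S_rew I K Y (f x) \<gamma>)))"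

definition S_or :: "('b, 'c, 'f, 'u) interp \<Rightarrow> 'u aux_monad \<Rightarrow> 'u set \<Rightarrow>
    (('u \<Rightarrow> 'u) \<Rightarrow> 'u) \<Rightarrow> (('u \<Rightarrow> 'u) \<Rightarrow> 'u) \<Rightarrow> ('u \<Rightarrow> 'u) \<Rightarrow> 'u" where
  "S_or I K X G\<^sub>0 G\<^sub>1 =
    (\<lambda>\<gamma> \<in> X \<rightarrow>\<^sub>E Rcar I. if Rle I (S_rew I K X G\<^sub>1 \<gamma>) (S_rew I K X G\<^sub>0 \<gamma>) then G\<^sub>0 \<gamma> else G\<^sub>1 \<gamma>)"

definition S_act :: "('b, 'c, 'f, 'u) interp \<Rightarrow> 'u aux_monad \<Rightarrow> 'u set \<Rightarrow>
    'u \<Rightarrow> (('u \<Rightarrow> 'u) \<Rightarrow> 'u) \<Rightarrow> ('u \<Rightarrow> 'u) \<Rightarrow> 'u" where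
  "S_act I K X r G = (\<lambda>\<gamma> \<in> X \<rightarrow>\<^sub>E Rcar I. Tact K X r (G \<gamma>))"

definition S_mix :: "('b, 'c, 'f, 'u) interp \<Rightarrow> 'u aux_monad \<Rightarrow> 'u set \<Rightarrow>
    real \<Rightarrow> (('u \<Rightarrow> 'u) \<Rightarrow> 'u) \<Rightarrow> (('u \<Rightarrow> 'u) \<Rightarrow> 'u) \<Rightarrow> ('u \<Rightarrow> 'u) \<Rightarrow> 'u" where
  "S_mix I K X p F G = (\<lambda>\<gamma> \<in> X \<rightarrow>\<^sub>E Rcar I. Tmix K X p (F \<gamma>) (G \<gamma>))"

primrec ty_den :: "('b, 'c, 'f, 'u) interp \<Rightarrow> 'u aux_monad \<Rightarrow> 'b ty \<Rightarrow> 'u set" where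
  "ty_den I K (Base b) = base_set I b"
| "ty_den I K UnitT = {unit_v I}"
| "ty_den I K (Prod \<sigma> \<tau>) = {pair_v I x y | x y. x \<in> ty_den I K \<sigma> \<and> y \<in> ty_den I K \<tau>}"
| "ty_den I K (Fun \<sigma> \<tau>) = fun_v I \<sigma> \<tau> ` (ty_den I K \<sigma> \<rightarrow>\<^sub>E S_set I K (ty_den I K \<tau>))"

definition fst_v :: "('b, 'c, 'f, 'u) interp \<Rightarrow> 'u \<Rightarrow> 'u" where
  "fst_v I v = (THE x. \<exists>y. v = pair_v I x y)"

definition snd_v :: "('b, 'c, 'f, 'u) interp \<Rightarrow> 'u \<Rightarrow> 'u" where
  "snd_v I v = (THE y. \<exists>x. v = pair_v I x y)"

definition app_v :: "('b, 'c, 'f, 'u) interp \<Rightarrow> 'u aux_monad \<Rightarrow> 'b ty \<Rightarrow> 'b ty \<Rightarrow>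
    'u \<Rightarrow> 'u \<Rightarrow> ('u \<Rightarrow> 'u) \<Rightarrow> 'u" where
  "app_v I K \<sigma> \<tau> = the_inv_into (ty_den I K \<sigma> \<rightarrow>\<^sub>E S_set I K (ty_den I K \<tau>)) (fun_v I \<sigma> \<tau>)"

locale selection_model = base_interpretation L I + auxiliary_monad K I
  for L :: "('b, 'c, 'f) lang" and I :: "('b, 'c, 'f, 'u) interp" and K :: "'u aux_monad" +
  assumes ty_den_Obj: "\<sigma> \<in> Types L \<Longrightarrow> ty_den I K \<sigma> \<in> Obj K"
    and pair_v_inj: "pair_v I x y = pair_v I x' y' \<Longrightarrow> x = x' \<and> y = y'"
    and fun_v_inj: "Fun \<sigma> \<tau> \<in> Types L \<Longrightarrow>
      inj_on (fun_v I \<sigma> \<tau>) (ty_den I K \<sigma> \<rightarrow>\<^sub>E S_set I K (ty_den I K \<tau>))"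

text \<open>\<open>S_seq I K Y k [(X\<^sub>1, F\<^sub>1), \<dots>, (X\<^sub>m, F\<^sub>m)]\<close> runs \<open>F\<^sub>1 \<in> S(X\<^sub>1), \<dots>, F\<^sub>m \<in> S(X\<^sub>m)\<close> from left to right
  and continues with \<open>k\<close>, which maps the list of their results to \<open>S(Y)\<close>.\<close>

fun S_seq :: "('b, 'c, 'f, 'u) interp \<Rightarrow> 'u aux_monad \<Rightarrow> 'u set \<Rightarrow>
    ('u list \<Rightarrow> ('u \<Rightarrow> 'u) \<Rightarrow> 'u) \<Rightarrow> ('u set \<times> (('u \<Rightarrow> 'u) \<Rightarrow> 'u)) list \<Rightarrow> ('u \<Rightarrow> 'u) \<Rightarrow> 'u" where
  "S_seq I K Y k [] = k []"
| "S_seq I K Y k ((X, F) # Fs) = S_ext I K X Y (\<lambda>x. S_seq I K Y (\<lambda>xs. k (x # xs)) Fs) F"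

text \<open>\<open>sem L I K M \<Gamma> \<rho>\<close> is the denotation of \<open>\<Gamma> \<turnstile> M\<close> at the environment \<open>\<rho>\<close>, a list of elements of the
  denotations of the types in \<open>\<Gamma>\<close>.\<close>

primrec sem :: "('b, 'c, 'f) lang \<Rightarrow> ('b, 'c, 'f, 'u) interp \<Rightarrow> 'u aux_monad \<Rightarrow>
    ('b, 'c, 'f) trm \<Rightarrow> 'b ty list \<Rightarrow> 'u list \<Rightarrow> ('u \<Rightarrow> 'u) \<Rightarrow> 'u" where
  "sem L I K (Var i) \<Gamma> \<rho> = S_unit I K (ty_den I K (\<Gamma> ! i)) (\<rho> ! i)"
| "sem L I K (Const c) \<Gamma> \<rho> = S_unit I K (base_set I (ctyp L c)) (const_den I c)"
| "sem L I K (FApp f Ms) \<Gamma> \<rho> =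
    S_seq I K (base_set I (fcod L f))
      (\<lambda>xs. S_unit I K (base_set I (fcod L f)) (fun_den I f xs))
      (zip (map (base_set I) (fdom L f)) (map (\<lambda>M. sem L I K M \<Gamma> \<rho>) Ms))"
| "sem L I K (If N M\<^sub>1 M\<^sub>2) \<Gamma> \<rho> =
    S_ext I K (base_set I (BoolT L)) (ty_den I K (ty_of L \<Gamma> M\<^sub>1))
      (\<lambda>x. if x = true_v I then sem L I K M\<^sub>1 \<Gamma> \<rho> else sem L I K M\<^sub>2 \<Gamma> \<rho>)
      (sem L I K N \<Gamma> \<rho>)"
| "sem L I K (Or M N) \<Gamma> \<rho> =
    S_or I K (ty_den I K (ty_of L \<Gamma> M)) (sem L I K M \<Gamma> \<rho>) (sem L I K N \<Gamma> \<rho>)"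
| "sem L I K (Act N M) \<Gamma> \<rho> =
    S_ext I K (Rcar I) (ty_den I K (ty_of L \<Gamma> M))
      (\<lambda>r. S_act I K (ty_den I K (ty_of L \<Gamma> M)) r (sem L I K M \<Gamma> \<rho>))
      (sem L I K N \<Gamma> \<rho>)"
| "sem L I K (Mix p M N) \<Gamma> \<rho> =
    S_mix I K (ty_den I K (ty_of L \<Gamma> M)) p (sem L I K M \<Gamma> \<rho>) (sem L I K N \<Gamma> \<rho>)"
| "sem L I K Star \<Gamma> \<rho> = S_unit I K {unit_v I} (unit_v I)"
| "sem L I K (Pair M N) \<Gamma> \<rho> =
    (let \<sigma> = ty_of L \<Gamma> M; \<tau> = ty_of L \<Gamma> N; Y = ty_den I K (Prod \<sigma> \<tau>) in
      S_ext I K (ty_den I K \<sigma>) Y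
        (\<lambda>x. S_ext I K (ty_den I K \<tau>) Y
          (\<lambda>y. S_unit I K Y (pair_v I x y))
          (sem L I K N \<Gamma> \<rho>))
        (sem L I K M \<Gamma> \<rho>))"
| "sem L I K (Fst M) \<Gamma> \<rho> =
    S_ext I K (ty_den I K (ty_of L \<Gamma> M)) (ty_den I K (ty_of L \<Gamma> (Fst M)))
      (\<lambda>v. S_unit I K (ty_den I K (ty_of L \<Gamma> (Fst M))) (fst_v I v))
      (sem L I K M \<Gamma> \<rho>)"
| "sem L I K (Snd M) \<Gamma> \<rho> =
    S_ext I K (ty_den I K (ty_of L \<Gamma> M)) (ty_den I K (ty_of L \<Gamma> (Snd M)))
      (\<lambda>v. S_unit I K (ty_den I K (ty_of L \<Gamma> (Snd M))) (snd_v I v))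
      (sem L I K M \<Gamma> \<rho>)"
| "sem L I K (Lam \<sigma> M) \<Gamma> \<rho> =
    (let \<tau> = ty_of L (\<sigma> # \<Gamma>) M in
      S_unit I K (ty_den I K (Fun \<sigma> \<tau>))
        (fun_v I \<sigma> \<tau> (\<lambda>x \<in> ty_den I K \<sigma>. sem L I K M (\<sigma> # \<Gamma>) (x # \<rho>))))"
| "sem L I K (App M N) \<Gamma> \<rho> =
    (let \<sigma> = ty_of L \<Gamma> N; \<tau> = ty_of L \<Gamma> (App M N) in
      S_ext I K (ty_den I K (Fun \<sigma> \<tau>)) (ty_den I K \<tau>)
        (\<lambda>\<phi>. S_ext I K (ty_den I K \<sigma>) (ty_den I K \<tau>)
          (\<lambda>x. app_v I K \<sigma> \<tau> \<phi> x)
          (sem L I K N \<Gamma> \<rho>))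
        (sem L I K M \<Gamma> \<rho>))"

text \<open>The pure semantics of closed values; the remaining terms are not values.\<close>

fun val_sem :: "('b, 'c, 'f) lang \<Rightarrow> ('b, 'c, 'f, 'u) interp \<Rightarrow> 'u aux_monad \<Rightarrow>
    ('b, 'c, 'f) trm \<Rightarrow> 'u" where
  "val_sem L I K (Const c) = const_den I c"
| "val_sem L I K Star = unit_v I"
| "val_sem L I K (Pair V W) = pair_v I (val_sem L I K V) (val_sem L I K W)"
| "val_sem L I K (Lam \<tau> N) =
    fun_v I \<tau> (ty_of L [\<tau>] N) (\<lambda>x \<in> ty_den I K \<tau>. sem L I K N [\<tau>] [x])"
| "val_sem L I K _ = undefined"

definition dw_den :: "('b, 'c, 'f) lang \<Rightarrow> ('b, 'c, 'f, 'u) interp \<Rightarrow> 'u aux_monad \<Rightarrow> 'b ty \<Rightarrow>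
    ('u \<times> ('b, 'c, 'f) trm) pmf \<Rightarrow> 'u" where
  "dw_den L I K \<sigma> \<mu> =
    convex_comb (Tmix K (ty_den I K \<sigma>)) \<mu>
      (\<lambda>(r, V). Tact K (ty_den I K \<sigma>) r (unit K (ty_den I K \<sigma>) (val_sem L I K V)))"

definition zero_rew :: "('b, 'c, 'f, 'u) interp \<Rightarrow> 'u aux_monad \<Rightarrow> 'b ty \<Rightarrow> 'u \<Rightarrow> 'u" where
  "zero_rew I K \<sigma> = (\<lambda>x \<in> ty_den I K \<sigma>. Rzero I)"

end

theory Submission
  imports Defs "HOL-Algebra.FiniteProduct"
begin

text \<open>Kleisli extension for \<open>S\<close> evaluates its argument at the reward function
  \<open>\<lambda>x. \<^bold>R(f(x)|\<gamma>)\<close>, and \<open>\<^bold>R(f\<^sup>\<dagger>(F)|\<gamma>)\<close> is \<open>\<^bold>R(F|\<lambda>x. \<^bold>R(f(x)|\<gamma>))\<close> because \<open>\<alpha>\<^sub>T\<close> is an algebra. Hence the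
  choice made by \<open>or\<close> is not affected by an evaluation context, all operations of \<open>S\<close> are algebraic,
  and the denotation of \<open>M\<close> can be computed from its effect value \<open>Op(M)\<close>, which exists by a
  reducibility argument. At the zero reward function, each \<open>or\<close> picks the branch with the larger expected
  reward under optimal play, favouring the left one. By cancellation in \<open>R\<close>, this also
  describes the least optimal strategy of \<open>Op(M)\<close>, by induction on effect values.\<close>


section \<open>Convex combinations\<close>

text \<open>The induction on evaluation always concerns whole programs at the zero reward function.
  Inside a context the argument would be judged by another reward function, so contexts are absorbed
  beforehand, by equations between elements of S that hold at every \<gamma>; the branches
  \<open>C M\<^sub>1\<close> and \<open>C M\<^sub>2\<close> of a choice are then again programs of
  the same type. The link to the operational side is (A2): at the zero reward function,
  \<open>alg K\<close> sends the denotation of a finite distribution to its expected reward, so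
  semantic and strategic choices compare the same elements of R. Three obstacles shape the rest.
  Contexts are HOL functions, so functionality of \<open>op_rel\<close> needs a first-order account
  of decomposition. A convex combination is defined by choosing an enumeration, and the laws for
  translating and mixing distributions need independence of that choice. Weights 0 and 1 annihilate
  one component of a mixture, which leaves the strategy there to the order on strategies alone,
  although the semantics still plays optimally in the discarded component.\<close>

text \<open>The cone over a barycentric algebra: formal multiples \<open>p \<cdot> x\<close> with \<open>p > 0\<close> together with a zero.
  It is a commutative monoid, in which a convex combination is a finite sum that does not depend on
  an enumeration of the summands.\<close>

fun cone_add :: "(real \<Rightarrow> 'a \<Rightarrow> 'a \<Rightarrow> 'a) \<Rightarrow> (real \<times> 'a) option \<Rightarrow> (real \<times> 'a) option \<Rightarrow>
    (real \<times> 'a) option" where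
  "cone_add mix None v = v"
| "cone_add mix u None = u"
| "cone_add mix (Some (p, x)) (Some (q, y)) = Some (p + q, mix (p / (p + q)) x y)"

definition cone :: "'a set \<Rightarrow> (real \<Rightarrow> 'a \<Rightarrow> 'a \<Rightarrow> 'a) \<Rightarrow> (real \<times> 'a) option monoid" where
  "cone A mix = \<lparr>carrier = insert None (Some ` ({0<..} \<times> A)), mult = cone_add mix, one = None\<rparr>"

text \<open>Weight zero gives the zero of the cone whatever \<open>x\<close> is, even outside
  \<open>A\<close>. Sums may therefore run over any finite superset of a support.\<close>

definition weighted :: "real \<Rightarrow> 'a \<Rightarrow> (real \<times> 'a) option" where
  "weighted p x = (if 0 < p then Some (p, x) else None)"

lemma cone_add_None_right [simp]: "cone_add mix u None = u"
  by (cases u) auto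

lemma cone_simps [simp]:
  "carrier (cone A mix) = insert None (Some ` ({0<..} \<times> A))"
  "mult (cone A mix) = cone_add mix"
  "one (cone A mix) = None"
  by (auto simp: cone_def)

section \<open>The cone as a commutative monoid, and convex combinations as finite sums in
  it\<close>

context barycentric_algebra
begin

lemma mix_zero: "x \<in> A \<Longrightarrow> y \<in> A \<Longrightarrow> mix 0 x y = y"
  using mix_comm[of 0 x y] by (simp add: mix_one)

lemma cone_add_commute:
  assumes "u \<in> carrier (cone A mix)" "v \<in> carrier (cone A mix)"
  shows "cone_add mix u v = cone_add mix v u"
proof (cases "u = None \<or> v = None")
  case False
  then obtain p x q y where uv: "u = Some (p, x)" "v = Some (q, y)"
    and pos: "0 < p" "0 < q" and mem: "x \<in> A" "y \<in> A"
    using assms by auto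
  have "1 - p / (p + q) = q / (q + p)" using pos by (simp add: field_simps)
  then show ?thesis
    using uv mix_comm[of "p / (p + q)" x y] pos mem by (simp add: add.commute)
qed auto

text \<open>This is the barycentric associativity law after normalising masses: the inner weight is
  \<open>p / (p + q)\<close>, the outer one \<open>(p + q) / (p + q + r)\<close>. Both are below 1,
  as the law demands, because all masses are positive.\<close>

lemma cone_add_assoc:
  assumes "u \<in> carrier (cone A mix)" "v \<in> carrier (cone A mix)" "w \<in> carrier (cone A mix)"
  shows "cone_add mix (cone_add mix u v) w = cone_add mix u (cone_add mix v w)"
proof (cases "u = None \<or> v = None \<or> w = None")
  case False
  then obtain p x q y r z where uvw: "u = Some (p, x)" "v = Some (q, y)" "w = Some (r, z)"
    and pos: "0 < p" "0 < q" "0 < r" and mem: "x \<in> A" "y \<in> A" "z \<in> A"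
    using assms by auto
  have 1: "p / (p + q) * ((p + q) / (p + q + r)) = p / (p + (q + r))"
    using pos by simp
  have "1 - p / (p + q) = q / (p + q)" using pos by (simp add: field_simps)
  then have 2: "(1 - p / (p + q)) * ((p + q) / (p + q + r)) = q / (p + (q + r))"
    "1 - p / (p + (q + r)) = (q + r) / (p + (q + r))"
    using pos by (simp, simp add: field_simps)
  have 3: "(1 - p / (p + q)) * ((p + q) / (p + q + r)) / (1 - p / (p + (q + r))) = q / (q + r)"
    unfolding 2 using pos by simp
  have "mix ((p + q) / (p + q + r)) (mix (p / (p + q)) x y) z
      = mix (p / (p + (q + r))) x (mix (q / (q + r)) y z)"
    using mix_assoc[of "p / (p + q)" "(p + q) / (p + q + r)" x y z] pos mem
    by (simp only: 1 3) simp
  then show ?thesis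
    using uvw by (simp add: add.assoc)
qed auto

lemma cone_comm_monoid: "comm_monoid (cone A mix)"
proof (rule comm_monoidI)
  fix u v assume "u \<in> carrier (cone A mix)" "v \<in> carrier (cone A mix)"
  then show "u \<otimes>\<^bsub>cone A mix\<^esub> v \<in> carrier (cone A mix)"
    by (auto intro!: mix_closed)
next
  show "\<one>\<^bsub>cone A mix\<^esub> \<in> carrier (cone A mix)"
    by simp
qed (auto simp: cone_add_assoc cone_add_commute simp del: cone_simps(1))

sublocale cone: comm_monoid "cone A mix"
  by (rule cone_comm_monoid)

lemma weighted_closed: "x \<in> A \<Longrightarrow> weighted p x \<in> carrier (cone A mix)"
  by (auto simp: weighted_def)

text \<open>Idempotence of \<open>mix\<close> is what allows a mass at a single point to be
  split.\<close>

lemma weighted_add: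
  "0 \<le> p \<Longrightarrow> 0 \<le> q \<Longrightarrow> x \<in> A \<Longrightarrow> weighted (p + q) x = cone_add mix (weighted p x) (weighted q x)"
  by (auto simp: weighted_def mix_idem)

text \<open>\<open>convex_sum\<close> splits off its first summand with weight \<open>p\<close>
  divided by the total mass, which is how \<open>cone_add\<close> weights its second component; the
  first component of the sum records the total mass.\<close>

lemma finprod_cone_list:
  assumes "xs \<noteq> []" "distinct xs" "\<And>x. x \<in> set xs \<Longrightarrow> 0 < w x" "\<And>x. x \<in> set xs \<Longrightarrow> g x \<in> A"
  shows "finprod (cone A mix) (\<lambda>x. weighted (w x) (g x)) (set xs)
    = Some (sum_list (map w xs), convex_sum mix (map (\<lambda>x. (w x, g x)) xs))"
  using assms
proof (induction xs rule: induct_list012)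
  case (2 x)
  then have "finprod (cone A mix) (\<lambda>x. weighted (w x) (g x)) (insert x {}) = weighted (w x) (g x)"
    by (subst cone.finprod_insert) (auto simp: weighted_def)
  with 2 show ?case
    by (simp add: weighted_def)
next
  case (3 x y zs)
  have IH: "finprod (cone A mix) (\<lambda>x. weighted (w x) (g x)) (set (y # zs))
    = Some (sum_list (map w (y # zs)), convex_sum mix (map (\<lambda>x. (w x, g x)) (y # zs)))"
    using 3 by simp
  have "finprod (cone A mix) (\<lambda>x. weighted (w x) (g x)) (set (x # y # zs))
    = cone_add mix (weighted (w x) (g x))
        (finprod (cone A mix) (\<lambda>x. weighted (w x) (g x)) (set (y # zs)))"
    unfolding list.set(2)[of x]
    by (subst cone.finprod_insert) (use 3 in \<open>auto simp: weighted_def\<close>)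
  with IH 3 show ?case
    by (simp add: weighted_def comp_def)
qed auto

text \<open>A finite product in a commutative monoid depends only on the index set, so the
  enumeration chosen in \<open>convex_comb\<close> disappears. The set \<open>S\<close> may exceed
  the support, which lets two distributions be summed over a common set.\<close>

lemma convex_comb_finprod:
  assumes "finite S" "set_pmf \<mu> \<subseteq> S" "\<And>x. x \<in> set_pmf \<mu> \<Longrightarrow> g x \<in> A"
  shows "finprod (cone A mix) (\<lambda>x. weighted (pmf \<mu> x) (g x)) S = Some (1, convex_comb mix \<mu> g)"
proof -
  define xs where "xs = (SOME xs. distinct xs \<and> set xs = set_pmf \<mu>)"
  have fin: "finite (set_pmf \<mu>)" using assms finite_subset by blast
  then have "\<exists>xs. distinct xs \<and> set xs = set_pmf \<mu>"
    using finite_distinct_list by blast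
  then have xs: "distinct xs" "set xs = set_pmf \<mu>"
    unfolding xs_def by (metis (mono_tags, lifting) someI_ex)+
  have "xs \<noteq> []" using xs set_pmf_not_empty[of \<mu>] by auto
  have sum: "sum_list (map (pmf \<mu>) xs) = 1"
    using xs sum_pmf_eq_1[OF fin order.refl] by (metis sum_list_distinct_conv_sum_set)
  have "finprod (cone A mix) (\<lambda>x. weighted (pmf \<mu> x) (g x)) S
    = finprod (cone A mix) (\<lambda>x. weighted (pmf \<mu> x) (g x)) (set_pmf \<mu>)"
  proof (rule cone.finprod_mono_neutral_cong_right)
    show "(\<lambda>x. weighted (pmf \<mu> x) (g x)) \<in> S \<rightarrow> carrier (cone A mix)"
      using assms(3) by (auto simp: weighted_def pmf_positive_iff)
  qed (use assms in \<open>auto simp: weighted_def set_pmf_iff\<close>)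
  also have "\<dots> = Some (1, convex_comb mix \<mu> g)"
    using finprod_cone_list[of xs "pmf \<mu>" g] \<open>xs \<noteq> []\<close> xs assms(3) sum
    by (simp add: convex_comb_def xs_def[symmetric] pmf_positive)
  finally show ?thesis .
qed

lemma convex_comb_closed:
  assumes "finite (set_pmf \<mu>)" "\<And>x. x \<in> set_pmf \<mu> \<Longrightarrow> g x \<in> A"
  shows "convex_comb mix \<mu> g \<in> A"
proof -
  have "finprod (cone A mix) (\<lambda>x. weighted (pmf \<mu> x) (g x)) (set_pmf \<mu>) \<in> carrier (cone A mix)"
    using assms by (intro cone.finprod_closed) (auto simp: weighted_def)
  then show ?thesis
    using convex_comb_finprod[OF assms(1) order.refl, of g] assms(2) by auto
qed

lemma convex_comb_return: "g x \<in> A \<Longrightarrow> convex_comb mix (return_pmf x) g = g x"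
  using convex_comb_finprod[of "{x}" "return_pmf x" g]
    cone.finprod_insert[of "{}" x "\<lambda>y. weighted (pmf (return_pmf x) y) (g y)"]
  by (auto simp: weighted_def)

text \<open>Injectivity on the support prevents masses from merging, so the combination is merely
  reindexed.\<close>

lemma convex_comb_map:
  assumes "finite (set_pmf \<mu>)" "inj_on h (set_pmf \<mu>)" "\<And>x. x \<in> set_pmf \<mu> \<Longrightarrow> g (h x) \<in> A"
  shows "convex_comb mix (map_pmf h \<mu>) g = convex_comb mix \<mu> (\<lambda>x. g (h x))"
proof -
  have "Some (1, convex_comb mix (map_pmf h \<mu>) g)
    = finprod (cone A mix) (\<lambda>y. weighted (pmf (map_pmf h \<mu>) y) (g y)) (h ` set_pmf \<mu>)"
    using assms by (intro convex_comb_finprod[symmetric]) auto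
  also have "\<dots> = finprod (cone A mix) (\<lambda>x. weighted (pmf (map_pmf h \<mu>) (h x)) (g (h x))) (set_pmf \<mu>)"
    using assms by (intro cone.finprod_reindex) (auto simp: weighted_def)
  also have "\<dots> = finprod (cone A mix) (\<lambda>x. weighted (pmf \<mu> x) (g (h x))) (set_pmf \<mu>)"
    using assms by (intro cone.finprod_cong') (auto simp: weighted_def pmf_map_inj)
  also have "\<dots> = Some (1, convex_comb mix \<mu> (\<lambda>x. g (h x)))"
    using assms by (intro convex_comb_finprod) auto
  finally show ?thesis by simp
qed

lemma convex_comb_cong:
  assumes "finite (set_pmf \<mu>)" "\<And>x. x \<in> set_pmf \<mu> \<Longrightarrow> g x \<in> A" "\<And>x. x \<in> set_pmf \<mu> \<Longrightarrow> g x = g' x"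
  shows "convex_comb mix \<mu> g = convex_comb mix \<mu> g'"
proof -
  have "finprod (cone A mix) (\<lambda>x. weighted (pmf \<mu> x) (g x)) (set_pmf \<mu>)
    = finprod (cone A mix) (\<lambda>x. weighted (pmf \<mu> x) (g' x)) (set_pmf \<mu>)"
    using assms by (intro cone.finprod_cong') (auto simp: weighted_def)
  then show ?thesis
    using convex_comb_finprod[OF assms(1) order.refl, of g]
      convex_comb_finprod[OF assms(1) order.refl, of g'] assms by simp
qed

text \<open>A factor \<open>c > 0\<close> cancels in every mixing weight \<open>p / (p + q)\<close>
  and so affects only the total mass; for \<open>c = 0\<close> all summands become the zero of the
  cone.\<close>

lemma finprod_scale:
  assumes "finite S" "0 \<le> c" "\<And>x. x \<in> S \<Longrightarrow> 0 < w x \<Longrightarrow> g x \<in> A"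
  shows "finprod (cone A mix) (\<lambda>x. weighted (c * w x) (g x)) S
    = (if c = 0 then None
       else map_option (apfst ((*) c)) (finprod (cone A mix) (\<lambda>x. weighted (w x) (g x)) S))"
  using assms
proof (induction S rule: finite_induct)
  case (insert a S)
  have mem: "(\<lambda>x. weighted (c' * w x) (g x)) \<in> insert a S \<rightarrow> carrier (cone A mix)" if "0 \<le> c'" for c'
    using insert.prems that by (auto simp: weighted_def zero_less_mult_iff)
  have hom: "cone_add mix (weighted (c * w a) (g a)) (map_option (apfst ((*) c)) v)
      = map_option (apfst ((*) c)) (cone_add mix (weighted (w a) (g a)) v)"
    if "c \<noteq> 0" for v
    using that insert.prems(1)
    by (cases v) (auto simp: weighted_def zero_less_mult_iff distrib_left[symmetric])
  show ?case
    using insert mem[of c] mem[of 1] hom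
    by (auto simp: cone.finprod_insert Pi_def weighted_def)
qed auto

text \<open>Over the union of the supports, \<open>weighted_add\<close> splits each mass into its
  two contributions, and each of the resulting sums is a scaled convex combination. For
  \<open>p = 0\<close> or \<open>p = 1\<close> one of them is the zero of the cone, and
  \<open>mix_zero\<close> and \<open>mix_one\<close> take over.\<close>

lemma convex_comb_dw_mix:
  assumes p: "0 \<le> p" "p \<le> 1" and fin: "finite (set_pmf \<mu>)" "finite (set_pmf \<nu>)"
    and g: "\<And>x. x \<in> set_pmf \<mu> \<union> set_pmf \<nu> \<Longrightarrow> g x \<in> A"
  shows "convex_comb mix (dw_mix p \<mu> \<nu>) g = mix p (convex_comb mix \<mu> g) (convex_comb mix \<nu> g)"
proof -
  let ?S = "set_pmf \<mu> \<union> set_pmf \<nu>"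
  let ?G = "cone A mix"
  have sub: "set_pmf (dw_mix p \<mu> \<nu>) \<subseteq> ?S"
    unfolding dw_mix_def by (auto split: if_splits)
  have pmf: "pmf (dw_mix p \<mu> \<nu>) x = p * pmf \<mu> x + (1 - p) * pmf \<nu> x" for x
    unfolding dw_mix_def pmf_bind using p by simp
  have mem: "convex_comb mix \<mu> g \<in> A" "convex_comb mix \<nu> g \<in> A"
    using fin g by (auto intro: convex_comb_closed)
  have "Some (1, convex_comb mix (dw_mix p \<mu> \<nu>) g)
    = finprod ?G (\<lambda>x. weighted (pmf (dw_mix p \<mu> \<nu>) x) (g x)) ?S"
    using fin sub g by (intro convex_comb_finprod[symmetric]) auto
  also have "\<dots> = finprod ?G
      (\<lambda>x. weighted (p * pmf \<mu> x) (g x) \<otimes>\<^bsub>?G\<^esub> weighted ((1 - p) * pmf \<nu> x) (g x)) ?S"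
    unfolding pmf using p g by (intro cone.finprod_cong')
      (auto simp: weighted_add[symmetric] simp del: cone_simps(1) intro!: weighted_closed)
  also have "\<dots> = finprod ?G (\<lambda>x. weighted (p * pmf \<mu> x) (g x)) ?S \<otimes>\<^bsub>?G\<^esub>
      finprod ?G (\<lambda>x. weighted ((1 - p) * pmf \<nu> x) (g x)) ?S"
    using g by (intro cone.finprod_multf) (auto simp: weighted_def)
  also have "finprod ?G (\<lambda>x. weighted (p * pmf \<mu> x) (g x)) ?S
      = (if p = 0 then None else Some (p, convex_comb mix \<mu> g))"
    using p fin g by (subst finprod_scale) (auto simp: convex_comb_finprod)
  also have "finprod ?G (\<lambda>x. weighted ((1 - p) * pmf \<nu> x) (g x)) ?S
      = (if p = 1 then None else Some (1 - p, convex_comb mix \<nu> g))"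
    using p fin g by (subst finprod_scale) (auto simp: convex_comb_finprod)
  finally show ?thesis
    using mem by (auto simp: mix_zero mix_one split: if_splits)
qed

end

text \<open>An affine map induces a homomorphism of cones that keeps the masses and applies
  \<open>h\<close> to the points, and homomorphisms commute with finite sums.\<close>

lemma convex_comb_hom:
  assumes "barycentric_algebra A mix" "barycentric_algebra B mix'"
    and h: "\<And>x. x \<in> A \<Longrightarrow> h x \<in> B"
    and hom: "\<And>p x y. 0 \<le> p \<Longrightarrow> p \<le> 1 \<Longrightarrow> x \<in> A \<Longrightarrow> y \<in> A \<Longrightarrow> h (mix p x y) = mix' p (h x) (h y)"
    and fin: "finite (set_pmf \<mu>)" and g: "\<And>x. x \<in> set_pmf \<mu> \<Longrightarrow> g x \<in> A"
  shows "h (convex_comb mix \<mu> g) = convex_comb mix' \<mu> (\<lambda>x. h (g x))"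
proof -
  interpret A: barycentric_algebra A mix by fact
  interpret B: barycentric_algebra B mix' by fact
  \<comment> \<open>Arbitrary weights and subsets of the support are allowed, since partial sums of
    a distribution are not distributions.\<close>
  have "map_option (apsnd h) (finprod (cone A mix) (\<lambda>x. weighted (w x) (g x)) S)
    = finprod (cone B mix') (\<lambda>x. weighted (w x) (h (g x))) S"
    if "finite S" "S \<subseteq> set_pmf \<mu>" for S and w :: "_ \<Rightarrow> real"
    using that
  proof (induction S rule: finite_induct)
    case (insert a S)
    have mem: "finprod (cone A mix) (\<lambda>x. weighted (w x) (g x)) S \<in> carrier (cone A mix)"
      using insert.prems g
      by (intro A.cone.finprod_closed) (auto simp del: cone_simps(1) intro!: A.weighted_closed)
    have add: "map_option (apsnd h) (cone_add mix (weighted (w a) (g a)) v)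
      = cone_add mix' (weighted (w a) (h (g a))) (map_option (apsnd h) v)"
      if "v \<in> carrier (cone A mix)" for v
      using that insert.prems g by (auto simp: weighted_def hom)
    have "finprod (cone A mix) (\<lambda>x. weighted (w x) (g x)) (insert a S)
      = cone_add mix (weighted (w a) (g a)) (finprod (cone A mix) (\<lambda>x. weighted (w x) (g x)) S)"
      by (subst A.cone.finprod_insert)
        (use insert g in \<open>auto simp del: cone_simps(1) intro!: A.weighted_closed\<close>)
    moreover have "finprod (cone B mix') (\<lambda>x. weighted (w x) (h (g x))) (insert a S)
      = cone_add mix' (weighted (w a) (h (g a)))
          (finprod (cone B mix') (\<lambda>x. weighted (w x) (h (g x))) S)"
      by (subst B.cone.finprod_insert)
        (use insert g h in \<open>auto simp del: cone_simps(1) intro!: B.weighted_closed\<close>)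
    ultimately show ?case
      using insert add[OF mem] by simp
  qed auto
  from this[OF fin order.refl, of "pmf \<mu>"] show ?thesis
    using A.convex_comb_finprod[OF fin order.refl, of g]
      B.convex_comb_finprod[OF fin order.refl, of "\<lambda>x. h (g x)"] g h by simp
qed

section \<open>Typing and substitution\<close>

inductive_cases typing_VarE: "typing L \<Gamma> (Var i) \<sigma>"
inductive_cases typing_ConstE: "typing L \<Gamma> (Const c) \<sigma>"
inductive_cases typing_FAppE: "typing L \<Gamma> (FApp f Ms) \<sigma>"
inductive_cases typing_IfE: "typing L \<Gamma> (trm.If N M\<^sub>1 M\<^sub>2) \<sigma>"
inductive_cases typing_OrE: "typing L \<Gamma> (Or M N) \<sigma>"
inductive_cases typing_ActE: "typing L \<Gamma> (Act N M) \<sigma>"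
inductive_cases typing_MixE: "typing L \<Gamma> (Mix p M N) \<sigma>"
inductive_cases typing_StarE: "typing L \<Gamma> Star \<sigma>"
inductive_cases typing_PairE: "typing L \<Gamma> (trm.Pair M N) \<sigma>"
inductive_cases typing_FstE: "typing L \<Gamma> (Fst M) \<sigma>"
inductive_cases typing_SndE: "typing L \<Gamma> (Snd M) \<sigma>"
inductive_cases typing_LamE: "typing L \<Gamma> (Lam \<tau> M) \<sigma>"
inductive_cases typing_AppE: "typing L \<Gamma> (App M N) \<sigma>"

lemmas typing_elims = typing_VarE typing_ConstE typing_FAppE typing_IfE typing_OrE typing_ActE
  typing_MixE typing_StarE typing_PairE typing_FstE typing_SndE typing_LamE typing_AppE

lemma typing_unique: "typing L \<Gamma> M \<sigma> \<Longrightarrow> typing L \<Gamma> M \<tau> \<Longrightarrow> \<sigma> = \<tau>"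
proof (induction arbitrary: \<tau> rule: typing.induct)
  case (Fst \<Gamma> M \<sigma> \<tau> \<tau>')
  then show ?case by (blast elim: typing_FstE)
next
  case (Snd \<Gamma> M \<sigma> \<tau> \<tau>')
  then show ?case by (blast elim: typing_SndE)
next
  case (App \<Gamma> M \<sigma> \<tau> N \<tau>')
  then show ?case by (blast elim: typing_AppE)
qed (blast elim: typing_elims)+

text \<open>The semantics reads the types of subterms from the description \<open>ty_of\<close>;
  uniqueness of typing is what gives it a value.\<close>

lemma ty_of_eq: "typing L \<Gamma> M \<sigma> \<Longrightarrow> ty_of L \<Gamma> M = \<sigma>"
  unfolding ty_of_def using typing_unique by blast

lemma (in language) typing_Types: "typing L \<Gamma> M \<sigma> \<Longrightarrow> set \<Gamma> \<subseteq> Types L \<Longrightarrow> \<sigma> \<in> Types L"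
  by (induction rule: typing.induct)
    (auto simp: Base_Types UnitT_Types subset_eq dest: Prod_Types Fun_Types)

text \<open>Extending the context at its outer end leaves all de Bruijn indices in place, so this
  weakening requires no lifting.\<close>

lemma typing_append: "typing L \<Gamma> M \<sigma> \<Longrightarrow> typing L (\<Gamma> @ \<Delta>) M \<sigma>"
proof (induction rule: typing.induct)
  case (Var i \<Gamma>)
  then have "(\<Gamma> @ \<Delta>) ! i = \<Gamma> ! i" "i < length (\<Gamma> @ \<Delta>)" by (simp_all add: nth_append)
  then show ?case by (metis typing.Var)
next
  case (FApp \<Gamma> Ms f)
  then show ?case by (auto intro!: typing.FApp elim: list_all2_mono)
qed (auto intro: typing.intros)

lemma lift_typed: "typing L \<Gamma> M \<sigma> \<Longrightarrow> length \<Gamma> \<le> k \<Longrightarrow> lift M k = M"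
proof (induction arbitrary: k rule: typing.induct)
  case (FApp \<Gamma> Ms f)
  then show ?case
    by (auto simp: list_all2_conv_all_nth in_set_conv_nth intro!: map_idI)
qed auto

lemma lift_closed: "typing L [] M \<sigma> \<Longrightarrow> lift M k = M"
  by (simp add: lift_typed)

text \<open>Only the outermost variable is replaced, and by a closed term: lifting it under a binder
  changes nothing, and weakening at the outer end covers the variable case.\<close>

lemma typing_subst:
  "typing L (\<Gamma> @ [\<tau>]) M \<sigma> \<Longrightarrow> typing L [] V \<tau> \<Longrightarrow> typing L \<Gamma> (subst M (length \<Gamma>) V) \<sigma>"
proof (induction "\<Gamma> @ [\<tau>]" M \<sigma> arbitrary: \<Gamma> rule: typing.induct)
  case (Var i)
  then show ?case
    using typing_append[of L "[]" V \<tau> \<Gamma>] typing.Var[of i \<Gamma> L] by (auto simp: nth_append)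
next
  case (FApp Ms f)
  then show ?case by (auto intro!: typing.FApp simp: list_all2_map1 elim: list_all2_mono)
next
  case (Lam \<sigma> M \<tau>')
  then show ?case using Lam(2)[of "\<sigma> # \<Gamma>"] by (auto intro: typing.intros simp: lift_closed)
qed (auto intro: typing.intros)

text \<open>\<open>msubst k [V\<^sub>0, V\<^sub>1, \<dots>] M\<close> replaces the variables \<open>k, k + 1, \<dots>\<close> of \<open>M\<close> by the closed terms
  \<open>V\<^sub>0, V\<^sub>1, \<dots>\<close>, the outermost variable first.\<close>

primrec msubst :: "nat \<Rightarrow> ('b, 'c, 'f) trm list \<Rightarrow> ('b, 'c, 'f) trm \<Rightarrow> ('b, 'c, 'f) trm" where
  "msubst k [] M = M"
| "msubst k (V # Vs) M = subst (msubst (Suc k) Vs M) k V"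

lemma msubst_simps [simp]:
  "msubst k Vs (Const c) = Const c"
  "msubst k Vs (FApp f Ms) = FApp f (map (msubst k Vs) Ms)"
  "msubst k Vs (trm.If N M\<^sub>1 M\<^sub>2) = trm.If (msubst k Vs N) (msubst k Vs M\<^sub>1) (msubst k Vs M\<^sub>2)"
  "msubst k Vs (Or M N) = Or (msubst k Vs M) (msubst k Vs N)"
  "msubst k Vs (Act M N) = Act (msubst k Vs M) (msubst k Vs N)"
  "msubst k Vs (Mix p M N) = Mix p (msubst k Vs M) (msubst k Vs N)"
  "msubst k Vs Star = Star"
  "msubst k Vs (trm.Pair M N) = trm.Pair (msubst k Vs M) (msubst k Vs N)"
  "msubst k Vs (Fst M) = Fst (msubst k Vs M)"
  "msubst k Vs (Snd M) = Snd (msubst k Vs M)"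
  "msubst k Vs (App M N) = App (msubst k Vs M) (msubst k Vs N)"
  by (induction Vs arbitrary: k) (simp_all add: comp_def map_idI)

lemma msubst_Lam:
  "list_all2 (typing L []) Vs \<Delta> \<Longrightarrow> msubst k Vs (Lam \<sigma> M) = Lam \<sigma> (msubst (Suc k) Vs M)"
  by (induction Vs \<Delta> arbitrary: k rule: list_all2_induct) (simp_all add: lift_closed)

lemma typing_msubst:
  "list_all2 (typing L []) Vs \<Delta> \<Longrightarrow> typing L (\<Gamma> @ \<Delta>) M \<sigma> \<Longrightarrow> typing L \<Gamma> (msubst (length \<Gamma>) Vs M) \<sigma>"
proof (induction Vs \<Delta> arbitrary: \<Gamma> rule: list_all2_induct)
  case (Cons V Vs \<tau> \<Delta>)
  then show ?case using Cons.IH[of "\<Gamma> @ [\<tau>]"] by (simp add: typing_subst)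
qed simp

lemma subst_typed: "typing L \<Gamma> M \<sigma> \<Longrightarrow> length \<Gamma> \<le> k \<Longrightarrow> subst M k V = M"
proof (induction arbitrary: k V rule: typing.induct)
  case (FApp \<Gamma> Ms f)
  then show ?case
    by (auto simp: list_all2_conv_all_nth in_set_conv_nth intro!: map_idI)
qed auto

lemma msubst_Var:
  "list_all2 (typing L []) Vs \<Delta> \<Longrightarrow> k \<le> i \<Longrightarrow> i < k + length Vs \<Longrightarrow> msubst k Vs (Var i) = Vs ! (i - k)"
proof (induction Vs \<Delta> arbitrary: k rule: list_all2_induct)
  case (Cons V Vs \<tau> \<Delta>)
  \<comment> \<open>The substitutions for the later variables are performed first and act on larger
    indices, so they leave \<open>Var k\<close> alone.\<close>
  have below: "msubst j Vs (Var k) = Var k" if "k < j" for j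
    using that by (induction Vs arbitrary: j) auto
  show ?case
  proof (cases "i = k")
    case True
    then show ?thesis using below[of "Suc k"] by simp
  next
    case False
    then have "typing L [] (Vs ! (i - Suc k)) (\<Delta> ! (i - Suc k))"
      using Cons.hyps Cons.prems by (auto simp: list_all2_conv_all_nth)
    \<comment> \<open>The term inserted for a later variable is closed, so the remaining
      substitution at \<open>k\<close> does not change it.\<close>
    then have "subst (Vs ! (i - Suc k)) k V = Vs ! (i - Suc k)"
      by (simp add: subst_typed)
    with False show ?thesis
      using Cons.IH[of "Suc k"] Cons.prems by (simp add: nth_Cons')
  qed
qed simp

section \<open>Operational semantics\<close>

text \<open>Everything that can sit in the hole when \<open>op_rel\<close> acts: an ordinary redex
  or an effect that is ready. \<open>Or\<close> and \<open>Mix\<close> are ready at once,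
  \<open>Act\<close> only when its reward is a constant.\<close>

inductive head :: "('b, 'c, 'f) lang \<Rightarrow> ('b, 'c, 'f) trm \<Rightarrow> bool" for L where
  head_redex: "redex L Q Q' \<Longrightarrow> head L Q"
| head_Or: "head L (Or M N)"
| head_Mix: "head L (Mix p M N)"
| head_Act: "head L (Act (Const c) M)"

lemma head_not_val: "head L Q \<Longrightarrow> \<not> is_val Q"
  by (auto elim!: head.cases redex.cases elim: is_val.cases)

lemma head_FApp: "head L (FApp f Ms) \<Longrightarrow> \<exists>cs. Ms = map Const cs"
  by (auto elim!: head.cases redex.cases)

lemma head_If: "head L (trm.If N M\<^sub>1 M\<^sub>2) \<Longrightarrow> is_val N"
  by (auto elim!: head.cases redex.cases intro: is_val.intros)

lemma head_Act_val: "head L (Act N M) \<Longrightarrow> is_val N"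
  by (auto elim!: head.cases redex.cases intro: is_val.intros)

lemma head_Pair: "\<not> head L (trm.Pair M N)"
  by (auto elim!: head.cases redex.cases)

lemma head_Fst: "head L (Fst M) \<Longrightarrow> is_val M"
  by (auto elim!: head.cases redex.cases intro: is_val.intros)

lemma head_Snd: "head L (Snd M) \<Longrightarrow> is_val M"
  by (auto elim!: head.cases redex.cases intro: is_val.intros)

lemma head_App: "head L (App M N) \<Longrightarrow> is_val M \<and> is_val N"
  by (auto elim!: head.cases redex.cases intro: is_val.intros)

text \<open>In a head, all arguments in evaluation position are already values.\<close>

lemma not_head:
  assumes "\<not> is_val A"
  shows "\<not> head L (FApp f (map Const cs @ A # Ms))" "\<not> head L (trm.If A M N)"
    "\<not> head L (Act A M)" "\<not> head L (trm.Pair M N)" "\<not> head L (Fst A)" "\<not> head L (Snd A)"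
    "\<not> head L (App A M)" "\<not> head L (App M A)"
proof -
  show "\<not> head L (FApp f (map Const cs @ A # Ms))"
  proof
    assume "head L (FApp f (map Const cs @ A # Ms))"
    then obtain cs' where cs': "map Const cs @ A # Ms = map Const cs'"
      using head_FApp[of L f] by metis
    have "A \<in> set (map Const cs')" unfolding cs'[symmetric] by simp
    then obtain c where "A = Const c" by auto
    with assms show False using is_val.intros(1) by metis
  qed
qed (use assms head_If head_Act_val head_Pair head_Fst head_Snd head_App in \<open>metis+\<close>)

text \<open>Evaluation contexts indexed by the term they decompose, which makes case distinctions first order.\<close>

inductive decomp :: "('b, 'c, 'f) lang \<Rightarrow> ('b, 'c, 'f) trm \<Rightarrow>
    (('b, 'c, 'f) trm \<Rightarrow> ('b, 'c, 'f) trm) \<Rightarrow> ('b, 'c, 'f) trm \<Rightarrow> bool" for L where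
  dec_head: "head L Q \<Longrightarrow> decomp L Q (\<lambda>Q. Q) Q"
| dec_FApp: "decomp L A C Q \<Longrightarrow>
    decomp L (FApp f (map Const cs @ A # Ms)) (\<lambda>Q. FApp f (map Const cs @ C Q # Ms)) Q"
| dec_If: "decomp L A C Q \<Longrightarrow> decomp L (trm.If A M N) (\<lambda>Q. trm.If (C Q) M N) Q"
| dec_Act: "decomp L A C Q \<Longrightarrow> decomp L (Act A M) (\<lambda>Q. Act (C Q) M) Q"
| dec_Pair1: "decomp L A C Q \<Longrightarrow> decomp L (trm.Pair A N) (\<lambda>Q. trm.Pair (C Q) N) Q"
| dec_Pair2: "is_val V \<Longrightarrow> decomp L A C Q \<Longrightarrow> decomp L (trm.Pair V A) (\<lambda>Q. trm.Pair V (C Q)) Q"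
| dec_Fst: "decomp L A C Q \<Longrightarrow> decomp L (Fst A) (\<lambda>Q. Fst (C Q)) Q"
| dec_Snd: "decomp L A C Q \<Longrightarrow> decomp L (Snd A) (\<lambda>Q. Snd (C Q)) Q"
| dec_App1: "decomp L A C Q \<Longrightarrow> decomp L (App A N) (\<lambda>Q. App (C Q) N) Q"
| dec_App2: "decomp L A C Q \<Longrightarrow> decomp L (App (Lam \<sigma> M) A) (\<lambda>Q. App (Lam \<sigma> M) (C Q)) Q"

lemma ectx_decomp: "ectx C \<Longrightarrow> head L Q \<Longrightarrow> decomp L (C Q) C Q"
  by (induction rule: ectx.induct) (auto intro: decomp.intros)

lemma decomp_not_val: "decomp L A C Q \<Longrightarrow> \<not> is_val A"
  by (induction rule: decomp.induct) (auto simp: head_not_val elim: is_val.cases)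

lemma decomp_Lam: "\<not> decomp L (Lam \<sigma> M) C Q"
  using decomp_not_val is_val.intros(4) by blast

text \<open>Locates the hole among the arguments of a function symbol: everything to its left is a
  constant, hence a value, and the term at the hole is not.\<close>

lemma first_non_value:
  assumes "\<not> is_val A" "\<not> is_val A'" "map Const cs @ A # Ms = map Const cs' @ A' # Ms'"
  shows "cs = cs' \<and> A = A' \<and> Ms = Ms'"
  using assms(3)
proof (induction cs arbitrary: cs')
  case Nil
  then show ?case using assms(1) by (cases cs') (auto intro: is_val.intros)
next
  case (Cons c cs)
  then show ?case using assms(2) by (cases cs') (auto intro: is_val.intros)
qed

text \<open>Any two different rules clash because a decomposable term is never a value: this
  separates heads from frames and the left from the right component of pairs and applications. Equal
  rules leave the induction hypothesis for the subterm.\<close>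

lemma decomp_unique: "decomp L A C Q \<Longrightarrow> decomp L A C' Q' \<Longrightarrow> C = C' \<and> Q = Q'"
proof (induction arbitrary: C' Q' rule: decomp.induct)
  case (dec_head Q)
  from dec_head(2) show ?case
    by (cases rule: decomp.cases) (use dec_head(1) in \<open>auto simp: not_head head_Pair dest: decomp_not_val\<close>)
next
  case (dec_FApp A C Q f cs Ms)
  note nv = decomp_not_val[OF dec_FApp(1)]
  from dec_FApp(3) show ?case
  proof (cases rule: decomp.cases)
    case dec_head
    with not_head(1)[OF nv] show ?thesis by blast
  next
    case (dec_FApp A' D cs' Ms')
    then have "cs = cs' \<and> A = A' \<and> Ms = Ms'"
      using nv decomp_not_val by (intro first_non_value) auto
    with dec_FApp dec_FApp.IH[of D Q'] show ?thesis by auto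
  qed
next
  case (dec_If A C Q M N)
  note nv = decomp_not_val[OF dec_If(1)]
  from dec_If(3) show ?case
  proof (cases rule: decomp.cases)
    case dec_head
    with not_head[OF nv] head_Pair show ?thesis by metis
  next
    case (dec_If D)
    then show ?thesis using dec_If.IH[of D Q'] by simp
  qed
next
  case (dec_Act A C Q M)
  note nv = decomp_not_val[OF dec_Act(1)]
  from dec_Act(3) show ?case
  proof (cases rule: decomp.cases)
    case dec_head
    with not_head[OF nv] head_Pair show ?thesis by metis
  next
    case (dec_Act D)
    then show ?thesis using dec_Act.IH[of D Q'] by simp
  qed
next
  case (dec_Pair1 A C Q N)
  note nv = decomp_not_val[OF dec_Pair1(1)]
  from dec_Pair1(3) show ?case
  proof (cases rule: decomp.cases)
    case dec_head
    with not_head[OF nv] head_Pair show ?thesis by metis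
  next
    case (dec_Pair1 D)
    then show ?thesis using dec_Pair1.IH[of D Q'] by simp
  qed (use nv in simp_all)
next
  case (dec_Pair2 V A C Q)
  note nv = decomp_not_val[OF dec_Pair2(2)]
  from dec_Pair2(4) show ?case
  proof (cases rule: decomp.cases)
    case dec_head
    with not_head[OF nv] head_Pair show ?thesis by metis
  next
    case (dec_Pair2 D)
    then show ?thesis using dec_Pair2.IH[of D Q'] by simp
  qed (use dec_Pair2.hyps(1) decomp_not_val in blast)
next
  case (dec_Fst A C Q)
  note nv = decomp_not_val[OF dec_Fst(1)]
  from dec_Fst(3) show ?case
  proof (cases rule: decomp.cases)
    case dec_head
    with not_head[OF nv] head_Pair show ?thesis by metis
  next
    case (dec_Fst D)
    then show ?thesis using dec_Fst.IH[of D Q'] by simp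
  qed
next
  case (dec_Snd A C Q)
  note nv = decomp_not_val[OF dec_Snd(1)]
  from dec_Snd(3) show ?case
  proof (cases rule: decomp.cases)
    case dec_head
    with not_head[OF nv] head_Pair show ?thesis by metis
  next
    case (dec_Snd D)
    then show ?thesis using dec_Snd.IH[of D Q'] by simp
  qed
next
  case (dec_App1 A C Q N)
  note nv = decomp_not_val[OF dec_App1(1)]
  from dec_App1(3) show ?case
  proof (cases rule: decomp.cases)
    case dec_head
    with not_head[OF nv] head_Pair show ?thesis by metis
  next
    case (dec_App1 D)
    then show ?thesis using dec_App1.IH[of D Q'] by simp
  qed (use dec_App1.hyps decomp_Lam in blast)
next
  case (dec_App2 A C Q \<sigma> M)
  note nv = decomp_not_val[OF dec_App2(1)]
  from dec_App2(3) show ?case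
  proof (cases rule: decomp.cases)
    case dec_head
    with not_head[OF nv] head_Pair show ?thesis by metis
  next
    case (dec_App2 D)
    then show ?thesis using dec_App2.IH[of D Q'] by simp
  qed (use decomp_Lam in blast)
qed

lemma ectx_unique:
  "ectx C \<Longrightarrow> ectx C' \<Longrightarrow> head L Q \<Longrightarrow> head L Q' \<Longrightarrow> C Q = C' Q' \<Longrightarrow> C = C' \<and> Q = Q'"
  using decomp_unique[of L "C Q" C Q C' Q'] ectx_decomp[of C L Q] ectx_decomp[of C' L Q'] by simp

lemma step_head:
  "step L M M' \<Longrightarrow> \<exists>C Q Q'. M = C Q \<and> M' = C Q' \<and> ectx C \<and> redex L Q Q' \<and> head L Q"
  by (cases rule: step.cases) (auto intro: head_redex)

text \<open>The two rules for conditionals would overlap if the constants for true and false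
  coincided.\<close>

lemma redex_deterministic:
  assumes "tt_c L \<noteq> ff_c L" "redex L Q Q'" "redex L Q Q''"
  shows "Q' = Q''"
  using assms(2)
proof (cases rule: redex.cases)
  case (1 f cs)
  with assms(3) show ?thesis
    by (auto elim!: redex.cases simp: inj_map_eq_map inj_def)
qed (use assms(1,3) in \<open>auto elim: redex.cases\<close>)

lemma redex_not_choice:
  "\<not> redex L (Or M N) Q" "\<not> redex L (Mix p M N) Q" "\<not> redex L (Act M N) Q"
  by (auto elim: redex.cases)

lemma op_rel_val: "op_rel L V E \<Longrightarrow> is_val V \<Longrightarrow> E = EVal V"
  by (cases rule: op_rel.cases)
    (auto dest!: step_head dest: ectx_decomp decomp_not_val intro: head.intros)

text \<open>Inversion at a known decomposition: by unique decomposition, a non-value rule of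
  \<open>op_rel\<close> can only have used this context and this head.\<close>

lemma op_rel_ectx_cases:
  assumes "op_rel L (C Q) E" "ectx C" "head L Q"
  obtains (step) Q' where "redex L Q Q'" "op_rel L (C Q') E"
  | (Or) M\<^sub>1 M\<^sub>2 E\<^sub>1 E\<^sub>2 where "Q = Or M\<^sub>1 M\<^sub>2" "E = EOr E\<^sub>1 E\<^sub>2" "op_rel L (C M\<^sub>1) E\<^sub>1" "op_rel L (C M\<^sub>2) E\<^sub>2"
  | (Mix) p M\<^sub>1 M\<^sub>2 E\<^sub>1 E\<^sub>2 where "Q = Mix p M\<^sub>1 M\<^sub>2" "E = EMix p E\<^sub>1 E\<^sub>2" "op_rel L (C M\<^sub>1) E\<^sub>1"
      "op_rel L (C M\<^sub>2) E\<^sub>2"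
  | (Act) c M E' where "Q = Act (Const c) M" "E = EAct c E'" "op_rel L (C M) E'"
  using assms(1)
proof (cases rule: op_rel.cases)
  case 1
  then show ?thesis using decomp_not_val[OF ectx_decomp[OF assms(2,3)]] by blast
next
  case (2 M')
  from 2(1) obtain D R R' where "C Q = D R" "M' = D R'" "ectx D" "redex L R R'" "head L R"
    using step_head by metis
  with 2 show ?thesis using ectx_unique[OF assms(2), of D L Q R] assms(3) step by auto
next
  case (3 D M\<^sub>1 E\<^sub>1 M\<^sub>2 E\<^sub>2)
  then show ?thesis using ectx_unique[OF assms(2), of D L Q "Or M\<^sub>1 M\<^sub>2"] assms(3) head_Or[of L M\<^sub>1 M\<^sub>2] Or by auto
next
  case (4 D M\<^sub>1 E\<^sub>1 M\<^sub>2 E\<^sub>2 p)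
  then show ?thesis
    using ectx_unique[OF assms(2), of D L Q "Mix p M\<^sub>1 M\<^sub>2"] assms(3) head_Mix[of L p M\<^sub>1 M\<^sub>2] Mix by auto
next
  case (5 D M E' c)
  then show ?thesis
    using ectx_unique[OF assms(2), of D L Q "Act (Const c) M"] assms(3) head_Act[of L c M] Act by auto
qed

lemma op_rel_unique:
  assumes "tt_c L \<noteq> ff_c L" "op_rel L M E" "op_rel L M E'"
  shows "E = E'"
  using assms(2,3)
proof (induction arbitrary: E' rule: op_rel.induct)
  case (1 V)
  then show ?case using op_rel_val by metis
next
  case (2 M M' E)
  from 2(1) obtain C Q Q' where CQ: "M = C Q" "M' = C Q'" "ectx C" "redex L Q Q'" "head L Q"
    using step_head by metis
  with 2(4) have "op_rel L (C Q) E'" by simp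
  then show ?case
  proof (cases rule: op_rel_ectx_cases[OF _ CQ(3,5), consumes 1, case_names step Or Mix Act])
    case (step Q'')
    with CQ 2(3) show ?thesis using redex_deterministic[OF assms(1)] by metis
  qed (use CQ(4) in \<open>simp_all add: redex_not_choice\<close>)
next
  case (3 C M\<^sub>1 E\<^sub>1 M\<^sub>2 E\<^sub>2)
  from 3(6) show ?case
    by (cases rule: op_rel_ectx_cases[OF _ 3(1) head_Or])
      (auto simp: redex_not_choice intro: "3.IH")
next
  case (4 C M\<^sub>1 E\<^sub>1 M\<^sub>2 E\<^sub>2 p)
  from 4(6) show ?case
    by (cases rule: op_rel_ectx_cases[OF _ 4(1) head_Mix])
      (auto simp: redex_not_choice intro: "4.IH")
next
  case (5 C M E c)
  from 5(4) show ?case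
    by (cases rule: op_rel_ectx_cases[OF _ 5(1) head_Act])
      (auto simp: redex_not_choice intro: "5.IH")
qed


subsection \<open>Termination\<close>

text \<open>\<open>conv L P M\<close>: evaluating \<open>M\<close> terminates along all branches, with values satisfying \<open>P\<close>.\<close>

inductive conv :: "('b, 'c, 'f) lang \<Rightarrow> (('b, 'c, 'f) trm \<Rightarrow> bool) \<Rightarrow> ('b, 'c, 'f) trm \<Rightarrow> bool"
  for L P where
  conv_val: "is_val V \<Longrightarrow> P V \<Longrightarrow> conv L P V"
| conv_step: "step L M M' \<Longrightarrow> conv L P M' \<Longrightarrow> conv L P M"
| conv_Or: "ectx C \<Longrightarrow> conv L P (C M\<^sub>1) \<Longrightarrow> conv L P (C M\<^sub>2) \<Longrightarrow> conv L P (C (Or M\<^sub>1 M\<^sub>2))"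
| conv_Mix: "ectx C \<Longrightarrow> conv L P (C M\<^sub>1) \<Longrightarrow> conv L P (C M\<^sub>2) \<Longrightarrow> conv L P (C (Mix p M\<^sub>1 M\<^sub>2))"
| conv_Act: "ectx C \<Longrightarrow> conv L P (C M) \<Longrightarrow> conv L P (C (Act (Const c) M))"

lemma conv_op_rel: "conv L P M \<Longrightarrow> \<exists>E. op_rel L M E"
  by (induction rule: conv.induct) (auto intro: op_rel.intros)

lemma conv_redex: "redex L Q Q' \<Longrightarrow> conv L P Q' \<Longrightarrow> conv L P Q"
  using conv_step step.intros[OF ectx.intros(1)] by blast

lemma ectx_comp: "ectx C \<Longrightarrow> ectx D \<Longrightarrow> ectx (\<lambda>Q. C (D Q))"
  by (induction rule: ectx.induct) (auto intro: ectx.intros)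

text \<open>Every rule used to evaluate \<open>M\<close> can be replayed under \<open>C\<close>,
  because contexts compose. The question is thereby reduced to the values that reach the
  hole.\<close>

lemma conv_ectx:
  assumes "conv L P M" "ectx C" "\<And>V. is_val V \<Longrightarrow> P V \<Longrightarrow> conv L Q (C V)"
  shows "conv L Q (C M)"
  using assms(1)
proof (induction rule: conv.induct)
  case (conv_val V)
  then show ?case by (rule assms(3))
next
  case (conv_step M M')
  from conv_step(1) obtain D R R' where "M = D R" "M' = D R'" "ectx D" "redex L R R'"
    using step_head by metis
  then have "step L (C M) (C M')"
    using step.intros[OF ectx_comp[OF assms(2)]] by metis
  then show ?case using conv.conv_step conv_step.IH by metis
next
  case (conv_Or D M\<^sub>1 M\<^sub>2)
  then show ?case using conv.conv_Or[OF ectx_comp[OF assms(2), of D]] by metis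
next
  case (conv_Mix D M\<^sub>1 M\<^sub>2 p)
  then show ?case using conv.conv_Mix[OF ectx_comp[OF assms(2), of D]] by metis
next
  case (conv_Act D M c)
  then show ?case using conv.conv_Act[OF ectx_comp[OF assms(2), of D]] by metis
qed

text \<open>A Tait-style logical relation on closed values. Typing is recorded at product and
  function types since it does not follow from the components: membership in \<open>Types L\<close>
  is an extra condition there, and a body must be typed as an open term.\<close>

primrec reducible :: "('b, 'c, 'f) lang \<Rightarrow> 'b ty \<Rightarrow> ('b, 'c, 'f) trm \<Rightarrow> bool" where
  "reducible L (Base b) = (\<lambda>V. \<exists>c. V = Const c \<and> ctyp L c = b)"
| "reducible L UnitT = (\<lambda>V. V = Star)"
| "reducible L (Prod \<sigma> \<tau>) = (\<lambda>V. typing L [] V (Prod \<sigma> \<tau>) \<and>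
    (\<exists>V\<^sub>1 V\<^sub>2. V = trm.Pair V\<^sub>1 V\<^sub>2 \<and> reducible L \<sigma> V\<^sub>1 \<and> reducible L \<tau> V\<^sub>2))"
| "reducible L (Fun \<sigma> \<tau>) = (\<lambda>V. typing L [] V (Fun \<sigma> \<tau>) \<and>
    (\<exists>M. V = Lam \<sigma> M \<and> (\<forall>W. reducible L \<sigma> W \<longrightarrow> conv L (reducible L \<tau>) (subst M 0 W))))"

lemma reducible_typing: "reducible L \<sigma> V \<Longrightarrow> typing L [] V \<sigma>"
  by (cases \<sigma>) (auto intro: typing.intros)

lemma reducible_val: "reducible L \<sigma> V \<Longrightarrow> is_val V"
  by (induction \<sigma> arbitrary: V) (auto intro: is_val.intros)

lemma conv_reducible: "reducible L \<sigma> V \<Longrightarrow> conv L (reducible L \<sigma>) V"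
  by (simp add: conv_val reducible_val)

text \<open>The single frames. Rule 6 is left out because its first premise is
  \<open>is_val V\<close> rather than a context; it is instantiated by hand for pairs.\<close>

lemmas ectx1 = ectx.intros(2-5,7-10)[OF ectx.intros(1)]

text \<open>The list \<open>cs\<close> holds the arguments evaluated so far. A reducible value of
  base type is a constant, so each result moves from \<open>Ms\<close> to \<open>cs\<close>.\<close>

lemma (in language) conv_FApp:
  assumes "list_all2 (\<lambda>M b. conv L (reducible L (Base b)) M) Ms bs" "map (ctyp L) cs @ bs = fdom L f"
  shows "conv L (reducible L (Base (fcod L f))) (FApp f (map Const cs @ Ms))"
  using assms
proof (induction Ms bs arbitrary: cs rule: list_all2_induct)
  case Nil
  then show ?case
    by (auto intro!: conv_redex[OF redex.intros(1)] conv_val is_val.intros simp: val_typ)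
next
  case (Cons M Ms b bs)
  have "conv L (reducible L (Base (fcod L f))) (FApp f (map Const cs @ V # Ms))"
    if V: "reducible L (Base b) V" for V
  proof -
    obtain c where c: "V = Const c" "ctyp L c = b" using V by auto
    have "conv L (reducible L (Base (fcod L f))) (FApp f (map Const (cs @ [c]) @ Ms))"
      using Cons.prems c by (intro Cons.IH) simp
    then show ?thesis using c by simp
  qed
  then show ?case
    by (rule conv_ectx[OF Cons.hyps(1) ectx1(1)[of f cs Ms]])
qed

text \<open>The interpretation excludes further boolean constants: there are two truth values, and
  denotations of constants of one type are distinct. Hence conditionals do not get stuck.\<close>

lemma (in base_interpretation) Bool_const:
  "ctyp L c = BoolT L \<Longrightarrow> c = tt_c L \<or> c = ff_c L"
  using const_closed[of c] const_inj[of c] const_tt const_ff tt_typ ff_typ base_Bool(1) by auto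

lemma (in base_interpretation) tt_neq_ff: "tt_c L \<noteq> ff_c L"
  using const_tt const_ff base_Bool(2) by auto

text \<open>The fundamental lemma of the logical relation. Open terms, closed by reducible values,
  make the induction pass under abstractions.\<close>

lemma (in base_interpretation) conv_msubst:
  "typing L \<Gamma> M \<sigma> \<Longrightarrow> list_all2 (\<lambda>V. typing L [] V) Vs \<Gamma> \<Longrightarrow>
    list_all2 (\<lambda>V \<tau>. reducible L \<tau> V) Vs \<Gamma> \<Longrightarrow> conv L (reducible L \<sigma>) (msubst 0 Vs M)"
proof (induction arbitrary: Vs rule: typing.induct)
  case (Var i \<Gamma>)
  then show ?case
    using msubst_Var[OF Var(2), of 0 i] by (auto simp: list_all2_conv_all_nth conv_reducible)
next
  case (Const \<Gamma> c)
  then show ?case by (simp add: conv_val is_val.intros)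
next
  case (FApp \<Gamma> Ms f)
  have "list_all2 (\<lambda>M b. conv L (reducible L (Base b)) M) (map (msubst 0 Vs) Ms) (fdom L f)"
    unfolding list_all2_map1 using FApp by (auto elim!: list_all2_mono)
  then show ?case using conv_FApp[of _ _ "[]"] by simp
next
  case (If \<Gamma> N M\<^sub>1 \<sigma> M\<^sub>2)
  show ?case
    unfolding msubst_simps
  proof (rule conv_ectx[OF If.IH(1)[OF If.prems] ectx1(2)])
    fix V assume "reducible L (Base (BoolT L)) V"
    then have "V = Const (tt_c L) \<or> V = Const (ff_c L)" using Bool_const by auto
    then show "conv L (reducible L \<sigma>) (trm.If V (msubst 0 Vs M\<^sub>1) (msubst 0 Vs M\<^sub>2))"
      using If.IH(2,3)[OF If.prems] redex.intros(2,3) conv_redex by metis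
  qed
next
  case (Or \<Gamma> M \<sigma> N)
  then show ?case unfolding msubst_simps by (intro conv_Or[OF ectx.intros(1)])
next
  case (Act \<Gamma> N M \<sigma>)
  show ?case
    unfolding msubst_simps
  proof (rule conv_ectx[OF Act.IH(1)[OF Act.prems] ectx1(3)])
    fix V assume "reducible L (Base (RewT L)) V"
    then obtain c where "V = Const c" by auto
    then show "conv L (reducible L \<sigma>) (Act V (msubst 0 Vs M))"
      using conv_Act[OF ectx.intros(1) Act.IH(2)[OF Act.prems]] by simp
  qed
next
  case (Mix p \<Gamma> M \<sigma> N)
  then show ?case unfolding msubst_simps by (intro conv_Mix[OF ectx.intros(1)])
next
  case (Star \<Gamma>)
  then show ?case by (simp add: conv_val is_val.intros)
next
  case (Pair \<Gamma> M \<sigma> N \<tau>)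
  show ?case
    unfolding msubst_simps
  proof (rule conv_ectx[OF Pair.IH(1)[OF Pair.prems] ectx1(4)])
    fix V assume V: "is_val V" "reducible L \<sigma> V"
    show "conv L (reducible L (Prod \<sigma> \<tau>)) (trm.Pair V (msubst 0 Vs N))"
    proof (rule conv_ectx[OF Pair.IH(2)[OF Pair.prems] ectx.intros(6)[OF V(1) ectx.intros(1)]])
      fix W assume "reducible L \<tau> W"
      with V Pair.hyps show "conv L (reducible L (Prod \<sigma> \<tau>)) (trm.Pair V W)"
        by (intro conv_reducible) (auto intro: typing.intros reducible_typing)
    qed
  qed
next
  case (Fst \<Gamma> M \<sigma> \<tau>)
  show ?case
    unfolding msubst_simps
  proof (rule conv_ectx[OF Fst.IH(1)[OF Fst.prems] ectx1(5)])
    fix V assume "reducible L (Prod \<sigma> \<tau>) V"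
    then obtain V\<^sub>1 V\<^sub>2 where "V = trm.Pair V\<^sub>1 V\<^sub>2" "reducible L \<sigma> V\<^sub>1" "reducible L \<tau> V\<^sub>2"
      by auto
    then show "conv L (reducible L \<sigma>) (Fst V)"
      using conv_redex[OF redex.intros(4)] conv_reducible reducible_val by metis
  qed
next
  case (Snd \<Gamma> M \<sigma> \<tau>)
  show ?case
    unfolding msubst_simps
  proof (rule conv_ectx[OF Snd.IH(1)[OF Snd.prems] ectx1(6)])
    fix V assume "reducible L (Prod \<sigma> \<tau>) V"
    then obtain V\<^sub>1 V\<^sub>2 where "V = trm.Pair V\<^sub>1 V\<^sub>2" "reducible L \<sigma> V\<^sub>1" "reducible L \<tau> V\<^sub>2"
      by auto
    then show "conv L (reducible L \<tau>) (Snd V)"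
      using conv_redex[OF redex.intros(5)] conv_reducible reducible_val by metis
  qed
next
  case (Lam \<sigma> \<Gamma> M \<tau>)
  have lam: "typing L [] (Lam \<sigma> (msubst (Suc 0) Vs M)) (Fun \<sigma> \<tau>)"
    using typing_msubst[OF Lam.prems(1), of "[]" "Lam \<sigma> M"] typing.Lam[OF Lam.hyps(1,2)]
    by (simp add: msubst_Lam[OF Lam.prems(1)])
  \<comment> \<open>The reduct is literally \<open>msubst 0 (W # Vs) M\<close>, because
    \<open>msubst\<close> replaces the outer variables before variable 0.\<close>
  have "conv L (reducible L \<tau>) (subst (msubst (Suc 0) Vs M) 0 W)" if "reducible L \<sigma> W" for W
    using Lam.IH[of "W # Vs"] that Lam.prems by (simp add: reducible_typing)
  then show ?case
    using lam by (auto simp: msubst_Lam[OF Lam.prems(1)] intro!: conv_val is_val.intros)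
next
  case (App \<Gamma> M \<sigma> \<tau> N)
  show ?case
    unfolding msubst_simps
  proof (rule conv_ectx[OF App.IH(1)[OF App.prems] ectx1(7)])
    fix V assume "reducible L (Fun \<sigma> \<tau>) V"
    then obtain M' where V: "V = Lam \<sigma> M'"
      and conv: "\<And>W. reducible L \<sigma> W \<Longrightarrow> conv L (reducible L \<tau>) (subst M' 0 W)" by auto
    have "conv L (reducible L \<tau>) (App (Lam \<sigma> M') (msubst 0 Vs N))"
    proof (rule conv_ectx[OF App.IH(2)[OF App.prems] ectx1(8)])
      fix W assume "is_val W" "reducible L \<sigma> W"
      then show "conv L (reducible L \<tau>) (App (Lam \<sigma> M') W)"
        using conv_redex[OF redex.intros(6)] conv by metis
    qed
    then show "conv L (reducible L \<tau>) (App V (msubst 0 Vs N))" unfolding V .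
  qed
qed

lemma (in base_interpretation) op_rel_Op:
  assumes "typing L [] M \<sigma>"
  shows "op_rel L M (Op L M)"
proof -
  have "conv L (reducible L \<sigma>) M" using conv_msubst[OF assms, of "[]"] by simp
  then obtain E where "op_rel L M E" using conv_op_rel by blast
  then show ?thesis
    unfolding Op_def using op_rel_unique[OF tt_neq_ff] by (metis theI)
qed

section \<open>The selection monad\<close>

context selection_model
begin

section \<open>The functor underlying the auxiliary monad and its algebra on R\<close>

lemma Tmap_closed:
  "X \<in> Obj K \<Longrightarrow> Y \<in> Obj K \<Longrightarrow> h \<in> X \<rightarrow> Y \<Longrightarrow> u \<in> T K X \<Longrightarrow> Tmap K X Y h u \<in> T K Y"
  unfolding Tmap_def by (auto intro!: ext_closed unit_closed)

lemma Tmap_cong: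
  "X \<in> Obj K \<Longrightarrow> Y \<in> Obj K \<Longrightarrow> h \<in> X \<rightarrow> Y \<Longrightarrow> u \<in> T K X \<Longrightarrow> (\<And>x. x \<in> X \<Longrightarrow> h x = h' x) \<Longrightarrow>
    Tmap K X Y h u = Tmap K X Y h' u"
  unfolding Tmap_def by (intro ext_cong) (auto intro!: unit_closed)

lemma Tmap_unit:
  "X \<in> Obj K \<Longrightarrow> Y \<in> Obj K \<Longrightarrow> h \<in> X \<rightarrow> Y \<Longrightarrow> x \<in> X \<Longrightarrow> Tmap K X Y h (unit K X x) = unit K Y (h x)"
  unfolding Tmap_def by (subst unit_ext) (auto intro!: unit_closed)

text \<open>\<open>alg K\<close> being an algebra of the monad, it can be applied before a Kleisli extension.\<close>

lemma alg_Tmap_ext: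
  assumes "X \<in> Obj K" "Y \<in> Obj K" "f \<in> X \<rightarrow> T K Y" "\<gamma> \<in> Y \<rightarrow> Rcar I" "u \<in> T K X"
  shows "alg K (Tmap K Y (Rcar I) \<gamma> (ext K X Y f u))
    = alg K (Tmap K X (Rcar I) (\<lambda>x. alg K (Tmap K Y (Rcar I) \<gamma> (f x))) u)"
proof -
  let ?R = "Rcar I" and ?h = "\<lambda>x. Tmap K Y (Rcar I) \<gamma> (f x)"
  have h: "?h x \<in> T K ?R" if "x \<in> X" for x
    using assms that R_Obj by (auto intro!: Tmap_closed)
  have TR: "T K ?R \<in> Obj K" by (simp add: T_Obj R_Obj)
  \<comment> \<open>An element of \<open>T K (T K (Rcar I))\<close>: the monad multiplication sends
    it to the argument of \<open>alg K\<close> on the left, mapping \<open>alg K\<close> over it to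
    the one on the right, and \<open>alg_mult\<close> identifies the results.\<close>
  define w where "w = Tmap K X (T K ?R) ?h u"
  have w: "w \<in> T K (T K ?R)"
    unfolding w_def using assms h TR by (intro Tmap_closed) auto
  have "Tmap K Y ?R \<gamma> (ext K X Y f u) = ext K X ?R ?h u"
    unfolding Tmap_def using assms R_Obj by (intro ext_ext) (auto intro!: unit_closed)
  also have "\<dots> = Tmult K ?R w"
  proof -
    have "Tmult K ?R w = ext K X ?R (\<lambda>x. ext K (T K ?R) ?R (\<lambda>u. u) (unit K (T K ?R) (?h x))) u"
      unfolding w_def Tmult_def Tmap_def[of K X] using assms h TR R_Obj
      by (intro ext_ext) (auto intro!: unit_closed)
    also have "\<dots> = ext K X ?R ?h u"
      using assms h TR R_Obj by (intro ext_cong) (auto simp: unit_ext intro!: ext_closed unit_closed)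
    finally show ?thesis by simp
  qed
  finally have 1: "alg K (Tmap K Y ?R \<gamma> (ext K X Y f u)) = alg K (Tmap K (T K ?R) ?R (alg K) w)"
    using alg_mult[OF w] by simp
  have "Tmap K (T K ?R) ?R (alg K) w
    = ext K X ?R (\<lambda>x. ext K (T K ?R) ?R (\<lambda>u. unit K ?R (alg K u)) (unit K (T K ?R) (?h x))) u"
    unfolding w_def Tmap_def[of K X] Tmap_def[of K "T K ?R"] using assms h TR R_Obj
    by (intro ext_ext) (auto intro!: unit_closed alg_closed)
  also have "\<dots> = Tmap K X ?R (\<lambda>x. alg K (?h x)) u"
    unfolding Tmap_def[of K X] using assms h TR R_Obj
    by (intro ext_cong) (auto simp: unit_ext alg_closed unit_closed intro!: ext_closed unit_closed alg_closed)
  finally show ?thesis using 1 by simp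
qed

section \<open>Closure of the operations of S, and rewards of units and extensions\<close>

lemma S_set_app: "F \<in> S_set I K X \<Longrightarrow> \<gamma> \<in> X \<rightarrow>\<^sub>E Rcar I \<Longrightarrow> F \<gamma> \<in> T K X"
  using PiE_mem[of F "X \<rightarrow>\<^sub>E Rcar I" "\<lambda>_. T K X" \<gamma>] by (simp add: S_set_def)

lemma S_fun_app:
  "f \<in> X \<rightarrow> S_set I K Y \<Longrightarrow> \<gamma> \<in> Y \<rightarrow>\<^sub>E Rcar I \<Longrightarrow> (\<lambda>x. f x \<gamma>) \<in> X \<rightarrow> T K Y"
  using S_set_app by blast

lemma S_rew_closed:
  assumes "X \<in> Obj K" "F \<in> S_set I K X" "\<gamma> \<in> X \<rightarrow>\<^sub>E Rcar I"
  shows "S_rew I K X F \<gamma> \<in> Rcar I"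
  unfolding S_rew_def using assms R_Obj S_set_app[OF assms(2,3)]
  by (intro alg_closed Tmap_closed) auto

lemma rew_fun_closed:
  "Y \<in> Obj K \<Longrightarrow> f \<in> X \<rightarrow> S_set I K Y \<Longrightarrow> \<gamma> \<in> Y \<rightarrow>\<^sub>E Rcar I \<Longrightarrow>
    (\<lambda>x\<in>X. S_rew I K Y (f x) \<gamma>) \<in> X \<rightarrow>\<^sub>E Rcar I"
  by (auto intro!: S_rew_closed)

lemma S_unit_closed: "X \<in> Obj K \<Longrightarrow> x \<in> X \<Longrightarrow> S_unit I K X x \<in> S_set I K X"
  by (auto simp: S_unit_def S_set_def unit_closed)

lemma S_ext_closed:
  assumes "X \<in> Obj K" "Y \<in> Obj K" "f \<in> X \<rightarrow> S_set I K Y" "F \<in> S_set I K X"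
  shows "S_ext I K X Y f F \<in> S_set I K Y"
  unfolding S_ext_def S_set_def
proof (rule restrict_PiE_iff[THEN iffD2], rule ballI)
  fix \<gamma> assume \<gamma>: "\<gamma> \<in> Y \<rightarrow>\<^sub>E Rcar I"
  show "ext K X Y (\<lambda>x. f x \<gamma>) (F (\<lambda>x\<in>X. S_rew I K Y (f x) \<gamma>)) \<in> T K Y"
    using assms(1,2) S_fun_app[OF assms(3) \<gamma>]
      S_set_app[OF assms(4) rew_fun_closed[OF assms(2,3) \<gamma>]]
    by (rule ext_closed)
qed

lemma S_or_closed:
  "F \<in> S_set I K X \<Longrightarrow> G \<in> S_set I K X \<Longrightarrow> S_or I K X F G \<in> S_set I K X"
  by (auto simp: S_or_def S_set_def)

lemma S_act_closed:
  assumes "X \<in> Obj K" "r \<in> Rcar I" "F \<in> S_set I K X"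
  shows "S_act I K X r F \<in> S_set I K X"
proof -
  interpret M: barycentric_module I "T K X" "Tmix K X" "Tact K X" by (rule A1) fact
  show ?thesis using assms by (auto simp: S_act_def S_set_def intro!: M.act_closed)
qed

lemma S_mix_closed:
  assumes "X \<in> Obj K" "0 \<le> p" "p \<le> 1" "F \<in> S_set I K X" "G \<in> S_set I K X"
  shows "S_mix I K X p F G \<in> S_set I K X"
proof -
  interpret M: barycentric_module I "T K X" "Tmix K X" "Tact K X" by (rule A1) fact
  show ?thesis using assms by (auto simp: S_mix_def S_set_def intro!: M.mix_closed)
qed

lemma S_rew_unit:
  "X \<in> Obj K \<Longrightarrow> x \<in> X \<Longrightarrow> \<gamma> \<in> X \<rightarrow>\<^sub>E Rcar I \<Longrightarrow> S_rew I K X (S_unit I K X x) \<gamma> = \<gamma> x"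
  using Tmap_unit[of X "Rcar I" \<gamma> x] alg_unit[of "\<gamma> x"]
  by (simp add: S_rew_def S_unit_def R_Obj PiE_iff Pi_def)

lemma S_rew_ext:
  assumes "X \<in> Obj K" "Y \<in> Obj K" "f \<in> X \<rightarrow> S_set I K Y" "F \<in> S_set I K X" "\<gamma> \<in> Y \<rightarrow>\<^sub>E Rcar I"
  shows "S_rew I K Y (S_ext I K X Y f F) \<gamma> = S_rew I K X F (\<lambda>x\<in>X. S_rew I K Y (f x) \<gamma>)"
proof -
  define \<gamma>' where "\<gamma>' = (\<lambda>x\<in>X. S_rew I K Y (f x) \<gamma>)"
  have \<gamma>': "\<gamma>' \<in> X \<rightarrow>\<^sub>E Rcar I" unfolding \<gamma>'_def using assms by (intro rew_fun_closed)
  have f: "(\<lambda>x. f x \<gamma>) \<in> X \<rightarrow> T K Y" using assms(3,5) by (rule S_fun_app)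
  have F: "F \<gamma>' \<in> T K X" using assms(4) \<gamma>' by (rule S_set_app)
  have "S_rew I K Y (S_ext I K X Y f F) \<gamma>
    = alg K (Tmap K Y (Rcar I) \<gamma> (ext K X Y (\<lambda>x. f x \<gamma>) (F \<gamma>')))"
    unfolding S_rew_def[of I K Y "S_ext I K X Y f F"] \<gamma>'_def using assms(5) by (simp add: S_ext_def)
  also have "\<dots> = alg K (Tmap K X (Rcar I) (\<lambda>x. S_rew I K Y (f x) \<gamma>) (F \<gamma>'))"
    unfolding S_rew_def using assms(1,2,5) f F by (intro alg_Tmap_ext) auto
  \<comment> \<open>\<open>S_ext\<close> hands over a reward function restricted to
    \<open>X\<close>, whereas \<open>alg_Tmap_ext\<close> yields an unrestricted one; they agree on
    \<open>X\<close>.\<close>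
  also have "Tmap K X (Rcar I) (\<lambda>x. S_rew I K Y (f x) \<gamma>) (F \<gamma>') = Tmap K X (Rcar I) \<gamma>' (F \<gamma>')"
    using assms(3) F R_Obj S_rew_closed[OF assms(2) _ assms(5)]
    by (intro Tmap_cong assms(1)) (auto simp: \<gamma>'_def)
  also have "alg K \<dots> = S_rew I K X F \<gamma>'"
    by (simp add: S_rew_def)
  finally show ?thesis unfolding \<gamma>'_def .
qed

lemma S_set_restrict: "F \<in> S_set I K X \<Longrightarrow> (\<lambda>\<gamma>\<in>X \<rightarrow>\<^sub>E Rcar I. F \<gamma>) = F"
  unfolding S_set_def by (rule PiE_restrict)

section \<open>Monad laws of S\<close>

lemma S_ext_unit_left:
  assumes "X \<in> Obj K" "Y \<in> Obj K" "f \<in> X \<rightarrow> S_set I K Y" "x \<in> X"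
  shows "S_ext I K X Y f (S_unit I K X x) = f x"
proof -
  have "S_ext I K X Y f (S_unit I K X x) = (\<lambda>\<gamma>\<in>Y \<rightarrow>\<^sub>E Rcar I. f x \<gamma>)"
    unfolding S_ext_def
  proof (rule restrict_ext)
    fix \<gamma> assume \<gamma>: "\<gamma> \<in> Y \<rightarrow>\<^sub>E Rcar I"
    have "S_unit I K X x (\<lambda>x\<in>X. S_rew I K Y (f x) \<gamma>) = unit K X x"
      using rew_fun_closed[OF assms(2,3) \<gamma>] by (simp add: S_unit_def)
    then show "ext K X Y (\<lambda>x. f x \<gamma>) (S_unit I K X x (\<lambda>x\<in>X. S_rew I K Y (f x) \<gamma>)) = f x \<gamma>"
      using unit_ext[OF assms(1,2) S_fun_app[OF assms(3) \<gamma>] assms(4)] by simp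
  qed
  also have "\<dots> = f x" using assms by (intro S_set_restrict) auto
  finally show ?thesis .
qed

text \<open>By \<open>S_rew_unit\<close>, the reward function handed to \<open>F\<close> is \<gamma>
  itself.\<close>

lemma S_ext_unit_right:
  assumes "X \<in> Obj K" "F \<in> S_set I K X"
  shows "S_ext I K X X (S_unit I K X) F = F"
proof -
  have "S_ext I K X X (S_unit I K X) F = (\<lambda>\<gamma>\<in>X \<rightarrow>\<^sub>E Rcar I. F \<gamma>)"
    unfolding S_ext_def
  proof (rule restrict_ext)
    fix \<gamma> assume \<gamma>: "\<gamma> \<in> X \<rightarrow>\<^sub>E Rcar I"
    have "(\<lambda>x\<in>X. S_rew I K X (S_unit I K X x) \<gamma>) = (\<lambda>x\<in>X. \<gamma> x)"
      using assms \<gamma> by (intro restrict_ext) (simp add: S_rew_unit)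
    also have "\<dots> = \<gamma>" using \<gamma> by (rule PiE_restrict)
    finally have "ext K X X (\<lambda>x. S_unit I K X x \<gamma>) (F (\<lambda>x\<in>X. S_rew I K X (S_unit I K X x) \<gamma>))
      = ext K X X (unit K X) (F \<gamma>)"
      using \<gamma> by (simp add: S_unit_def)
    then show "ext K X X (\<lambda>x. S_unit I K X x \<gamma>) (F (\<lambda>x\<in>X. S_rew I K X (S_unit I K X x) \<gamma>)) = F \<gamma>"
      using assms \<gamma> by (simp add: ext_unit S_set_app)
  qed
  also have "\<dots> = F" using assms by (intro S_set_restrict)
  finally show ?thesis .
qed

text \<open>By \<open>S_rew_ext\<close> both sides evaluate \<open>F\<close> at the same reward
  function; what remains is associativity of the Kleisli extension of the auxiliary monad.\<close>

lemma S_ext_assoc: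
  assumes "X \<in> Obj K" "Y \<in> Obj K" "Z \<in> Obj K" "f \<in> X \<rightarrow> S_set I K Y" "g \<in> Y \<rightarrow> S_set I K Z"
    "F \<in> S_set I K X"
  shows "S_ext I K Y Z g (S_ext I K X Y f F) = S_ext I K X Z (\<lambda>x. S_ext I K Y Z g (f x)) F"
  unfolding S_ext_def[of I K Y Z g "S_ext I K X Y f F"] S_ext_def[of I K X Z]
proof (rule restrict_ext)
  fix \<gamma> assume \<gamma>: "\<gamma> \<in> Z \<rightarrow>\<^sub>E Rcar I"
  let ?\<gamma>' = "\<lambda>y\<in>Y. S_rew I K Z (g y) \<gamma>"
  let ?\<gamma>'' = "\<lambda>x\<in>X. S_rew I K Y (f x) ?\<gamma>'"
  have \<gamma>': "?\<gamma>' \<in> Y \<rightarrow>\<^sub>E Rcar I" by (rule rew_fun_closed[OF assms(3,5) \<gamma>])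
  have \<gamma>'': "?\<gamma>'' \<in> X \<rightarrow>\<^sub>E Rcar I" by (rule rew_fun_closed[OF assms(2,4) \<gamma>'])
  have "(\<lambda>x\<in>X. S_rew I K Z (S_ext I K Y Z g (f x)) \<gamma>) = ?\<gamma>''"
    using assms \<gamma> by (intro restrict_ext S_rew_ext) auto
  moreover have "(\<lambda>x. S_ext I K Y Z g (f x) \<gamma>) = (\<lambda>x. ext K Y Z (\<lambda>y. g y \<gamma>) (f x ?\<gamma>'))"
    using \<gamma> by (simp add: S_ext_def)
  moreover have "S_ext I K X Y f F ?\<gamma>' = ext K X Y (\<lambda>x. f x ?\<gamma>') (F ?\<gamma>'')"
    using \<gamma>' by (simp add: S_ext_def)
  moreover have "ext K Y Z (\<lambda>y. g y \<gamma>) (ext K X Y (\<lambda>x. f x ?\<gamma>') (F ?\<gamma>''))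
    = ext K X Z (\<lambda>x. ext K Y Z (\<lambda>y. g y \<gamma>) (f x ?\<gamma>')) (F ?\<gamma>'')"
  proof (rule ext_ext)
    show "(\<lambda>x. f x ?\<gamma>') \<in> X \<rightarrow> T K Y" using assms(4) \<gamma>' by (rule S_fun_app)
    show "(\<lambda>y. g y \<gamma>) \<in> Y \<rightarrow> T K Z" using assms(5) \<gamma> by (rule S_fun_app)
    show "F ?\<gamma>'' \<in> T K X" using assms(6) \<gamma>'' by (rule S_set_app)
  qed (use assms in auto)
  ultimately show "ext K Y Z (\<lambda>x. g x \<gamma>) (S_ext I K X Y f F ?\<gamma>')
    = ext K X Z (\<lambda>x. S_ext I K Y Z g (f x) \<gamma>)
        (F (\<lambda>x\<in>X. S_rew I K Z (S_ext I K Y Z g (f x)) \<gamma>))"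
    by simp
qed

section \<open>Algebraicity of choice, reward and probabilistic mixture in S\<close>

lemma S_ext_or:
  assumes "X \<in> Obj K" "Y \<in> Obj K" "f \<in> X \<rightarrow> S_set I K Y" "F \<in> S_set I K X" "G \<in> S_set I K X"
  shows "S_ext I K X Y f (S_or I K X F G) = S_or I K Y (S_ext I K X Y f F) (S_ext I K X Y f G)"
  unfolding S_ext_def[of I K X Y f "S_or I K X F G"] S_or_def[of I K Y]
proof (rule restrict_ext)
  fix \<gamma> assume \<gamma>: "\<gamma> \<in> Y \<rightarrow>\<^sub>E Rcar I"
  have \<gamma>': "(\<lambda>x\<in>X. S_rew I K Y (f x) \<gamma>) \<in> X \<rightarrow>\<^sub>E Rcar I"
    by (rule rew_fun_closed[OF assms(2,3) \<gamma>])
  show "ext K X Y (\<lambda>x. f x \<gamma>) (S_or I K X F G (\<lambda>x\<in>X. S_rew I K Y (f x) \<gamma>))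
    = (if Rle I (S_rew I K Y (S_ext I K X Y f G) \<gamma>) (S_rew I K Y (S_ext I K X Y f F) \<gamma>)
       then S_ext I K X Y f F \<gamma> else S_ext I K X Y f G \<gamma>)"
    using S_rew_ext[OF assms(1-4) \<gamma>] S_rew_ext[OF assms(1-3,5) \<gamma>] \<gamma> \<gamma>'
    by (simp add: S_or_def S_ext_def)
qed

lemma S_ext_act:
  assumes "X \<in> Obj K" "Y \<in> Obj K" "f \<in> X \<rightarrow> S_set I K Y" "r \<in> Rcar I" "F \<in> S_set I K X"
  shows "S_ext I K X Y f (S_act I K X r F) = S_act I K Y r (S_ext I K X Y f F)"
  unfolding S_ext_def[of I K X Y f "S_act I K X r F"] S_act_def[of I K Y]
proof (rule restrict_ext)
  fix \<gamma> assume \<gamma>: "\<gamma> \<in> Y \<rightarrow>\<^sub>E Rcar I"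
  have \<gamma>': "(\<lambda>x\<in>X. S_rew I K Y (f x) \<gamma>) \<in> X \<rightarrow>\<^sub>E Rcar I"
    by (rule rew_fun_closed[OF assms(2,3) \<gamma>])
  have "(\<lambda>x. f x \<gamma>) \<in> X \<rightarrow> T K Y" using assms(3) \<gamma> by (rule S_fun_app)
  then show "ext K X Y (\<lambda>x. f x \<gamma>) (S_act I K X r F (\<lambda>x\<in>X. S_rew I K Y (f x) \<gamma>))
    = Tact K Y r (S_ext I K X Y f F \<gamma>)"
    using assms \<gamma> \<gamma>' S_set_app[OF assms(5) \<gamma>'] by (simp add: S_act_def S_ext_def ext_act)
qed

lemma S_ext_mix:
  assumes "X \<in> Obj K" "Y \<in> Obj K" "f \<in> X \<rightarrow> S_set I K Y" "0 \<le> p" "p \<le> 1"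
    "F \<in> S_set I K X" "G \<in> S_set I K X"
  shows "S_ext I K X Y f (S_mix I K X p F G)
    = S_mix I K Y p (S_ext I K X Y f F) (S_ext I K X Y f G)"
  unfolding S_ext_def[of I K X Y f "S_mix I K X p F G"] S_mix_def[of I K Y]
proof (rule restrict_ext)
  fix \<gamma> assume \<gamma>: "\<gamma> \<in> Y \<rightarrow>\<^sub>E Rcar I"
  have \<gamma>': "(\<lambda>x\<in>X. S_rew I K Y (f x) \<gamma>) \<in> X \<rightarrow>\<^sub>E Rcar I"
    by (rule rew_fun_closed[OF assms(2,3) \<gamma>])
  have "(\<lambda>x. f x \<gamma>) \<in> X \<rightarrow> T K Y" using assms(3) \<gamma> by (rule S_fun_app)
  then show "ext K X Y (\<lambda>x. f x \<gamma>) (S_mix I K X p F G (\<lambda>x\<in>X. S_rew I K Y (f x) \<gamma>))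
    = Tmix K Y p (S_ext I K X Y f F \<gamma>) (S_ext I K X Y f G \<gamma>)"
    using assms \<gamma> \<gamma>' S_set_app[OF assms(6) \<gamma>'] S_set_app[OF assms(7) \<gamma>']
    by (simp add: S_mix_def S_ext_def ext_mix)
qed

end

section \<open>Denotations\<close>

context selection_model
begin

lemma base_Obj: "base_set I b \<in> Obj K"
  using ty_den_Obj[OF Base_Types] by simp

lemma fst_v_pair: "fst_v I (pair_v I x y) = x"
  unfolding fst_v_def using pair_v_inj by blast

lemma snd_v_pair: "snd_v I (pair_v I x y) = y"
  unfolding snd_v_def using pair_v_inj by blast

lemma app_v_fun_v:
  "Fun \<sigma> \<tau> \<in> Types L \<Longrightarrow> g \<in> ty_den I K \<sigma> \<rightarrow>\<^sub>E S_set I K (ty_den I K \<tau>) \<Longrightarrow>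
    app_v I K \<sigma> \<tau> (fun_v I \<sigma> \<tau> g) = g"
  unfolding app_v_def using fun_v_inj by (intro the_inv_into_f_f)

lemma app_v_closed:
  "Fun \<sigma> \<tau> \<in> Types L \<Longrightarrow> \<phi> \<in> ty_den I K (Fun \<sigma> \<tau>) \<Longrightarrow>
    app_v I K \<sigma> \<tau> \<phi> \<in> ty_den I K \<sigma> \<rightarrow> S_set I K (ty_den I K \<tau>)"
  by (auto simp: app_v_fun_v)

lemma S_seq_closed:
  assumes "list_all2 (\<lambda>F b. F \<in> S_set I K (base_set I b)) Fs bs" "Y \<in> Obj K"
    "\<And>xs. list_all2 (\<lambda>x b. x \<in> base_set I b) xs bs \<Longrightarrow> k xs \<in> S_set I K Y"
  shows "S_seq I K Y k (zip (map (base_set I) bs) Fs) \<in> S_set I K Y"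
  using assms(1,3)
proof (induction Fs bs arbitrary: k rule: list_all2_induct)
  case (Cons F Fs b bs)
  then show ?case
    using assms(2) by (auto intro!: S_ext_closed base_Obj)
qed simp

lemma sem_closed:
  "typing L \<Gamma> M \<sigma> \<Longrightarrow> set \<Gamma> \<subseteq> Types L \<Longrightarrow> list_all2 (\<lambda>x \<tau>. x \<in> ty_den I K \<tau>) \<rho> \<Gamma> \<Longrightarrow>
    sem L I K M \<Gamma> \<rho> \<in> S_set I K (ty_den I K \<sigma>)"
proof (induction arbitrary: \<rho> rule: typing.induct)
  case (Var i \<Gamma>)
  then show ?case by (auto intro!: S_unit_closed ty_den_Obj simp: list_all2_conv_all_nth)
next
  case (Const \<Gamma> c)
  then show ?case by (simp add: S_unit_closed base_Obj const_closed)
next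
  case (FApp \<Gamma> Ms f)
  have "list_all2 (\<lambda>F b. F \<in> S_set I K (base_set I b)) (map (\<lambda>M. sem L I K M \<Gamma> \<rho>) Ms) (fdom L f)"
    using FApp by (auto simp: list_all2_map1 elim!: list_all2_mono)
  then show ?case
    by (auto intro!: S_seq_closed S_unit_closed base_Obj fun_closed)
next
  case (If \<Gamma> N M\<^sub>1 \<sigma> M\<^sub>2)
  have "\<sigma> \<in> Types L" using typing_Types[OF If.hyps(2) If.prems(1)] .
  then show ?case
    using If by (auto simp: ty_of_eq[OF If.hyps(2)] intro!: S_ext_closed base_Obj ty_den_Obj)
next
  case (Or \<Gamma> M \<sigma> N)
  then show ?case by (simp add: ty_of_eq[OF Or.hyps(1)] S_or_closed)
next
  case (Act \<Gamma> N M \<sigma>)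
  have "\<sigma> \<in> Types L" using typing_Types[OF Act.hyps(2) Act.prems(1)] .
  then show ?case
    using Act base_Rew
    by (auto simp: ty_of_eq[OF Act.hyps(2)] intro!: S_ext_closed R_Obj ty_den_Obj S_act_closed)
next
  case (Mix p \<Gamma> M \<sigma> N)
  have "\<sigma> \<in> Types L" using typing_Types[OF Mix.hyps(3) Mix.prems(1)] .
  then show ?case using Mix by (simp add: ty_of_eq[OF Mix.hyps(3)] S_mix_closed ty_den_Obj)
next
  case (Star \<Gamma>)
  then show ?case using ty_den_Obj[OF UnitT_Types] by (simp add: S_unit_closed)
next
  case (Pair \<Gamma> M \<sigma> N \<tau>)
  have *: "ty_den I K \<sigma> \<in> Obj K" "ty_den I K \<tau> \<in> Obj K" "ty_den I K (Prod \<sigma> \<tau>) \<in> Obj K"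
    using ty_den_Obj Prod_Types[OF Pair.hyps(3)] Pair.hyps(3) by blast+
  have "pair_v I x y \<in> ty_den I K (Prod \<sigma> \<tau>)" if "x \<in> ty_den I K \<sigma>" "y \<in> ty_den I K \<tau>" for x y
    using that by auto
  with * Pair.IH Pair.prems show ?case
    unfolding sem.simps Let_def ty_of_eq[OF Pair.hyps(1)] ty_of_eq[OF Pair.hyps(2)]
    by (intro S_ext_closed Pi_I S_unit_closed) auto
next
  case (Fst \<Gamma> M \<sigma> \<tau>)
  have P: "Prod \<sigma> \<tau> \<in> Types L" using typing_Types[OF Fst.hyps Fst.prems(1)] .
  then have *: "ty_den I K \<sigma> \<in> Obj K" "ty_den I K (Prod \<sigma> \<tau>) \<in> Obj K"
    using ty_den_Obj Prod_Types by blast+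
  show ?case
    unfolding sem.simps ty_of_eq[OF Fst.hyps] ty_of_eq[OF typing.Fst[OF Fst.hyps]]
    using Fst.IH[OF Fst.prems] * by (intro S_ext_closed Pi_I S_unit_closed) (auto simp: fst_v_pair)
next
  case (Snd \<Gamma> M \<sigma> \<tau>)
  have P: "Prod \<sigma> \<tau> \<in> Types L" using typing_Types[OF Snd.hyps Snd.prems(1)] .
  then have *: "ty_den I K \<tau> \<in> Obj K" "ty_den I K (Prod \<sigma> \<tau>) \<in> Obj K"
    using ty_den_Obj Prod_Types by blast+
  show ?case
    unfolding sem.simps ty_of_eq[OF Snd.hyps] ty_of_eq[OF typing.Snd[OF Snd.hyps]]
    using Snd.IH[OF Snd.prems] * by (intro S_ext_closed Pi_I S_unit_closed) (auto simp: snd_v_pair)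
next
  case (Lam \<sigma> \<Gamma> M \<tau>)
  have "sem L I K M (\<sigma> # \<Gamma>) (x # \<rho>) \<in> S_set I K (ty_den I K \<tau>)" if "x \<in> ty_den I K \<sigma>" for x
    using Lam.IH[of "x # \<rho>"] Lam.prems that Fun_Types[OF Lam.hyps(2)] by simp
  then show ?case
    unfolding sem.simps Let_def ty_of_eq[OF Lam.hyps(1)]
    using Lam.hyps(2) by (intro S_unit_closed ty_den_Obj) auto
next
  case (App \<Gamma> M \<sigma> \<tau> N)
  have F: "Fun \<sigma> \<tau> \<in> Types L" using typing_Types[OF App.hyps(1) App.prems(1)] .
  then have *: "ty_den I K \<sigma> \<in> Obj K" "ty_den I K \<tau> \<in> Obj K" "ty_den I K (Fun \<sigma> \<tau>) \<in> Obj K"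
    using ty_den_Obj Fun_Types by blast+
  show ?case
    unfolding sem.simps Let_def ty_of_eq[OF App.hyps(2)] ty_of_eq[OF typing.App[OF App.hyps(1,2)]]
    using App.IH(1,2)[OF App.prems] * by (intro S_ext_closed Pi_I app_v_closed[OF F, THEN funcset_mem]) auto
qed

lemma sem_program: "typing L [] M \<sigma> \<Longrightarrow> sem L I K M [] [] \<in> S_set I K (ty_den I K \<sigma>)"
  using sem_closed[of "[]" M \<sigma> "[]"] by simp

lemma program_Obj: "typing L [] M \<sigma> \<Longrightarrow> ty_den I K \<sigma> \<in> Obj K"
  using ty_den_Obj typing_Types[of "[]" M \<sigma>] by simp

text \<open>Values perform no effects: a pair is evaluated by two applications of the left unit law,
  and all other values denote units by definition.\<close>

lemma sem_val:
  "is_val V \<Longrightarrow> typing L [] V \<sigma> \<Longrightarrow>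
    sem L I K V [] [] = S_unit I K (ty_den I K \<sigma>) (val_sem L I K V) \<and> val_sem L I K V \<in> ty_den I K \<sigma>"
proof (induction arbitrary: \<sigma> rule: is_val.induct)
  case (1 c)
  then show ?case by (auto elim: typing_ConstE simp: const_closed)
next
  case 2
  then show ?case by (auto elim: typing_StarE)
next
  case (3 V W)
  from 3(5) obtain \<sigma>\<^sub>1 \<sigma>\<^sub>2 where \<sigma>: "\<sigma> = Prod \<sigma>\<^sub>1 \<sigma>\<^sub>2"
    and V: "typing L [] V \<sigma>\<^sub>1" and W: "typing L [] W \<sigma>\<^sub>2" and P: "Prod \<sigma>\<^sub>1 \<sigma>\<^sub>2 \<in> Types L"
    by (auto elim: typing_PairE)
  let ?Y = "ty_den I K (Prod \<sigma>\<^sub>1 \<sigma>\<^sub>2)"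
  have pair: "pair_v I x y \<in> ?Y" if "x \<in> ty_den I K \<sigma>\<^sub>1" "y \<in> ty_den I K \<sigma>\<^sub>2" for x y
    using that by auto
  have Y: "?Y \<in> Obj K" using P by (rule ty_den_Obj)
  have u: "S_unit I K ?Y (pair_v I x y) \<in> S_set I K ?Y"
    if "x \<in> ty_den I K \<sigma>\<^sub>1" "y \<in> ty_den I K \<sigma>\<^sub>2" for x y
    using pair[OF that] Y by (intro S_unit_closed)
  have "S_ext I K (ty_den I K \<sigma>\<^sub>1) ?Y
      (\<lambda>x. S_ext I K (ty_den I K \<sigma>\<^sub>2) ?Y (\<lambda>y. S_unit I K ?Y (pair_v I x y)) (sem L I K W [] []))
      (sem L I K V [] [])
    = S_ext I K (ty_den I K \<sigma>\<^sub>2) ?Y (\<lambda>y. S_unit I K ?Y (pair_v I (val_sem L I K V) y)) (sem L I K W [] [])"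
    unfolding 3(3)[OF V, THEN conjunct1]
    using 3(3)[OF V] sem_program[OF W] program_Obj[OF V] program_Obj[OF W] Y u
    by (intro S_ext_unit_left) (auto intro!: S_ext_closed)
  also have "\<dots> = S_unit I K ?Y (pair_v I (val_sem L I K V) (val_sem L I K W))"
    unfolding 3(4)[OF W, THEN conjunct1]
    using 3(3)[OF V] 3(4)[OF W] program_Obj[OF W] Y u
    by (intro S_ext_unit_left) auto
  finally show ?case
    unfolding \<sigma> sem.simps Let_def ty_of_eq[OF V] ty_of_eq[OF W]
    using pair 3(3)[OF V] 3(4)[OF W] by simp
next
  case (4 \<tau> M)
  from 4 obtain \<tau>' where \<sigma>: "\<sigma> = Fun \<tau> \<tau>'"
    and M: "typing L [\<tau>] M \<tau>'" and F: "Fun \<tau> \<tau>' \<in> Types L"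
    by (auto elim: typing_LamE)
  have "sem L I K M [\<tau>] [x] \<in> S_set I K (ty_den I K \<tau>')" if "x \<in> ty_den I K \<tau>" for x
    using sem_closed[OF M, of "[x]"] that Fun_Types[OF F] by simp
  then show ?case by (auto simp: \<sigma> Let_def ty_of_eq[OF M])
qed

text \<open>Needed to move a closed value under binders, where its denotation is taken in a longer
  environment.\<close>

lemma sem_append:
  "typing L \<Gamma> M \<sigma> \<Longrightarrow> length \<rho> = length \<Gamma> \<Longrightarrow> sem L I K M (\<Gamma> @ \<Delta>) (\<rho> @ \<delta>) = sem L I K M \<Gamma> \<rho>"
proof (induction arbitrary: \<rho> rule: typing.induct)
  case (Var i \<Gamma>)
  then show ?case by (simp add: nth_append)
next
  case (FApp \<Gamma> Ms f)
  have "map (\<lambda>M. sem L I K M (\<Gamma> @ \<Delta>) (\<rho> @ \<delta>)) Ms = map (\<lambda>M. sem L I K M \<Gamma> \<rho>) Ms"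
    using FApp by (auto simp: list_all2_conv_all_nth in_set_conv_nth)
  then show ?case by (simp only: sem.simps)
next
  case (If \<Gamma> N M\<^sub>1 \<sigma> M\<^sub>2)
  note h = If.hyps(2)
  show ?case
    unfolding sem.simps ty_of_eq[OF h] ty_of_eq[OF typing_append[OF h]]
    using If.IH If.prems by (simp cong: if_cong)
next
  case (Or \<Gamma> M \<sigma> N)
  note h = Or.hyps(1)
  show ?case
    unfolding sem.simps ty_of_eq[OF h] ty_of_eq[OF typing_append[OF h]]
    using Or.IH Or.prems by simp
next
  case (Act \<Gamma> N M \<sigma>)
  note h = Act.hyps(2)
  show ?case
    unfolding sem.simps ty_of_eq[OF h] ty_of_eq[OF typing_append[OF h]]
    using Act.IH Act.prems by simp
next
  case (Mix p \<Gamma> M \<sigma> N)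
  note h = Mix.hyps(3)
  show ?case
    unfolding sem.simps ty_of_eq[OF h] ty_of_eq[OF typing_append[OF h]]
    using Mix.IH Mix.prems by simp
next
  case (Pair \<Gamma> M \<sigma> N \<tau>)
  note h = Pair.hyps(1) Pair.hyps(2)
  show ?case
    unfolding sem.simps Let_def h[THEN ty_of_eq] h[THEN typing_append, THEN ty_of_eq]
    using Pair.IH Pair.prems by simp
next
  case (Fst \<Gamma> M \<sigma> \<tau>)
  note h = Fst.hyps typing.Fst[OF Fst.hyps]
  show ?case
    unfolding sem.simps h[THEN ty_of_eq] h[THEN typing_append, THEN ty_of_eq]
    using Fst.IH Fst.prems by simp
next
  case (Snd \<Gamma> M \<sigma> \<tau>)
  note h = Snd.hyps typing.Snd[OF Snd.hyps]
  show ?case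
    unfolding sem.simps h[THEN ty_of_eq] h[THEN typing_append, THEN ty_of_eq]
    using Snd.IH Snd.prems by simp
next
  case (Lam \<sigma> \<Gamma> M \<tau>)
  have "sem L I K M (\<sigma> # \<Gamma> @ \<Delta>) (x # \<rho> @ \<delta>) = sem L I K M (\<sigma> # \<Gamma>) (x # \<rho>)" for x
    using Lam.IH[of "x # \<rho>"] Lam.prems by simp
  moreover have "ty_of L (\<sigma> # \<Gamma> @ \<Delta>) M = \<tau>"
    using typing_append[OF Lam.hyps(1)] by (simp add: ty_of_eq)
  ultimately show ?case by (simp add: Let_def ty_of_eq[OF Lam.hyps(1)])
next
  case (App \<Gamma> M \<sigma> \<tau> N)
  note h = App.hyps(2) typing.App[OF App.hyps(1,2)]
  show ?case
    unfolding sem.simps Let_def h[THEN ty_of_eq] h[THEN typing_append, THEN ty_of_eq]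
    using App.IH App.prems by simp
qed simp_all

text \<open>A variable denotes a unit, so the term put in its place must denote one too; for a value
  this is \<open>sem_val\<close>.\<close>

lemma sem_subst:
  assumes "is_val V" "typing L [] V \<tau>"
  shows "typing L (\<Gamma> @ [\<tau>]) M \<sigma> \<Longrightarrow> length \<rho> = length \<Gamma> \<Longrightarrow>
    sem L I K (subst M (length \<Gamma>) V) \<Gamma> \<rho> = sem L I K M (\<Gamma> @ [\<tau>]) (\<rho> @ [val_sem L I K V])"
proof (induction "\<Gamma> @ [\<tau>]" M \<sigma> arbitrary: \<Gamma> \<rho> rule: typing.induct)
  case (Var i)
  have "sem L I K V \<Gamma> \<rho> = S_unit I K (ty_den I K \<tau>) (val_sem L I K V)"
    using sem_append[OF assms(2), of "[]" \<Gamma> \<rho>] sem_val[OF assms] by simp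
  with Var show ?case by (auto simp: nth_append less_Suc_eq)
next
  case (FApp Ms f)
  have "map (\<lambda>M. sem L I K (subst M (length \<Gamma>) V) \<Gamma> \<rho>) Ms
    = map (\<lambda>M. sem L I K M (\<Gamma> @ [\<tau>]) (\<rho> @ [val_sem L I K V])) Ms"
    using FApp by (auto simp: list_all2_conv_all_nth in_set_conv_nth)
  then show ?case by (simp only: sem.simps subst.simps list.map_comp comp_def)
next
  case (If N M\<^sub>1 \<sigma> M\<^sub>2)
  note h = If.hyps(3)
  show ?case
    unfolding sem.simps subst.simps ty_of_eq[OF h] ty_of_eq[OF typing_subst[OF h assms(2)]]
    using If.hyps(2,4,6) If.prems by (simp cong: if_cong)
next
  case (Or M \<sigma> N)
  note h = Or.hyps(1)
  show ?case
    unfolding sem.simps subst.simps ty_of_eq[OF h] ty_of_eq[OF typing_subst[OF h assms(2)]]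
    using Or.hyps(2,4) Or.prems by simp
next
  case (Act N M \<sigma>)
  note h = Act.hyps(3)
  show ?case
    unfolding sem.simps subst.simps ty_of_eq[OF h] ty_of_eq[OF typing_subst[OF h assms(2)]]
    using Act.hyps(2,4) Act.prems by simp
next
  case (Mix p M \<sigma> N)
  note h = Mix.hyps(3)
  show ?case
    unfolding sem.simps subst.simps ty_of_eq[OF h] ty_of_eq[OF typing_subst[OF h assms(2)]]
    using Mix.hyps(4,6) Mix.prems by simp
next
  case (Pair M \<sigma> N \<tau>')
  note h = Pair.hyps(1) Pair.hyps(3)
  show ?case
    unfolding sem.simps subst.simps Let_def h[THEN ty_of_eq] h[THEN typing_subst, OF assms(2), THEN ty_of_eq]
    using Pair.hyps(2,4) Pair.prems by simp
next
  case (Fst M \<sigma> \<tau>')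
  note h = Fst.hyps(1) typing.Fst[OF Fst.hyps(1)]
  note h' = h[THEN typing_subst, OF assms(2), THEN ty_of_eq, unfolded subst.simps]
  show ?case
    unfolding sem.simps subst.simps h[THEN ty_of_eq] h'
    using Fst.hyps(2) Fst.prems by simp
next
  case (Snd M \<sigma> \<tau>')
  note h = Snd.hyps(1) typing.Snd[OF Snd.hyps(1)]
  note h' = h[THEN typing_subst, OF assms(2), THEN ty_of_eq, unfolded subst.simps]
  show ?case
    unfolding sem.simps subst.simps h[THEN ty_of_eq] h'
    using Snd.hyps(2) Snd.prems by simp
next
  case (Lam \<sigma> M \<tau>')
  have M: "typing L ((\<sigma> # \<Gamma>) @ [\<tau>]) M \<tau>'" using Lam.hyps(1) by simp
  have "sem L I K (subst M (Suc (length \<Gamma>)) V) (\<sigma> # \<Gamma>) (x # \<rho>)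
    = sem L I K M (\<sigma> # \<Gamma> @ [\<tau>]) (x # \<rho> @ [val_sem L I K V])" for x
    using Lam.hyps(2)[of "\<sigma> # \<Gamma>" "x # \<rho>"] Lam.prems by simp
  moreover have "ty_of L (\<sigma> # \<Gamma>) (subst M (Suc (length \<Gamma>)) V) = \<tau>'"
    using typing_subst[OF M assms(2)] by (simp add: ty_of_eq)
  ultimately show ?case
    by (simp add: Let_def ty_of_eq[OF Lam.hyps(1)] lift_closed[OF assms(2)])
next
  case (App M \<sigma> \<tau>' N)
  note h = App.hyps(3) typing.App[OF App.hyps(1,3)]
  note h' = h[THEN typing_subst, OF assms(2), THEN ty_of_eq, unfolded subst.simps]
  show ?case
    unfolding sem.simps subst.simps Let_def h[THEN ty_of_eq] h'
    using App.hyps(2,4) App.prems by simp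
qed simp_all

end

section \<open>Soundness of evaluation\<close>

context selection_model
begin

text \<open>The semantic counterpart of an evaluation context with a hole of type \<open>\<tau>\<close>: filling the hole is
  a Kleisli extension.\<close>

definition S_linear :: "(('b, 'c, 'f) trm \<Rightarrow> ('b, 'c, 'f) trm) \<Rightarrow> 'b ty \<Rightarrow> 'b ty \<Rightarrow> bool" where
  "S_linear C \<tau> \<sigma> \<longleftrightarrow> (\<exists>f \<in> ty_den I K \<tau> \<rightarrow> S_set I K (ty_den I K \<sigma>).
    \<forall>Q. typing L [] Q \<tau> \<longrightarrow> typing L [] (C Q) \<sigma> \<and>
      sem L I K (C Q) [] [] = S_ext I K (ty_den I K \<tau>) (ty_den I K \<sigma>) f (sem L I K Q [] []))"

lemma S_linearI:
  assumes "f \<in> ty_den I K \<tau> \<rightarrow> S_set I K (ty_den I K \<sigma>)"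
    "\<And>Q. typing L [] Q \<tau> \<Longrightarrow> typing L [] (C Q) \<sigma>"
    "\<And>Q. typing L [] Q \<tau> \<Longrightarrow>
      sem L I K (C Q) [] [] = S_ext I K (ty_den I K \<tau>) (ty_den I K \<sigma>) f (sem L I K Q [] [])"
  shows "S_linear C \<tau> \<sigma>"
  unfolding S_linear_def using assms by blast

lemma S_linear_id:
  assumes "\<sigma> \<in> Types L"
  shows "S_linear (\<lambda>Q. Q) \<sigma> \<sigma>"
proof (rule S_linearI)
  show "S_unit I K (ty_den I K \<sigma>) \<in> ty_den I K \<sigma> \<rightarrow> S_set I K (ty_den I K \<sigma>)"
    using ty_den_Obj[OF assms] by (intro Pi_I S_unit_closed)
qed (simp_all add: S_ext_unit_right sem_program ty_den_Obj[OF assms])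

text \<open>Associativity of Kleisli extension composes the two continuations into
  \<open>?h\<close>.\<close>

lemma S_linear_comp:
  assumes "S_linear C \<tau> \<sigma>'" "S_linear D \<sigma>' \<sigma>" "\<tau> \<in> Types L" "\<sigma>' \<in> Types L" "\<sigma> \<in> Types L"
  shows "S_linear (\<lambda>Q. D (C Q)) \<tau> \<sigma>"
proof -
  obtain f where f: "f \<in> ty_den I K \<tau> \<rightarrow> S_set I K (ty_den I K \<sigma>')"
    and C: "\<And>Q. typing L [] Q \<tau> \<Longrightarrow> typing L [] (C Q) \<sigma>'"
      "\<And>Q. typing L [] Q \<tau> \<Longrightarrow> sem L I K (C Q) [] []
        = S_ext I K (ty_den I K \<tau>) (ty_den I K \<sigma>') f (sem L I K Q [] [])"
    using assms(1) unfolding S_linear_def by blast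
  obtain g where g: "g \<in> ty_den I K \<sigma>' \<rightarrow> S_set I K (ty_den I K \<sigma>)"
    and D: "\<And>Q. typing L [] Q \<sigma>' \<Longrightarrow> typing L [] (D Q) \<sigma>"
      "\<And>Q. typing L [] Q \<sigma>' \<Longrightarrow> sem L I K (D Q) [] []
        = S_ext I K (ty_den I K \<sigma>') (ty_den I K \<sigma>) g (sem L I K Q [] [])"
    using assms(2) unfolding S_linear_def by blast
  note obj = assms(3-5)[THEN ty_den_Obj]
  let ?h = "\<lambda>x. S_ext I K (ty_den I K \<sigma>') (ty_den I K \<sigma>) g (f x)"
  show ?thesis
  proof (rule S_linearI[of ?h])
    show "?h \<in> ty_den I K \<tau> \<rightarrow> S_set I K (ty_den I K \<sigma>)"
      by (rule Pi_I) (rule S_ext_closed[OF obj(2,3) g funcset_mem[OF f]])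
    fix Q assume Q: "typing L [] Q \<tau>"
    show "typing L [] (D (C Q)) \<sigma>" using C D Q by blast
    show "sem L I K (D (C Q)) [] [] = S_ext I K (ty_den I K \<tau>) (ty_den I K \<sigma>) ?h (sem L I K Q [] [])"
      unfolding D(2)[OF C(1)[OF Q]] C(2)[OF Q] using obj f g sem_program[OF Q]
      by (rule S_ext_assoc)
  qed
qed

lemma pair_closed:
  "x \<in> ty_den I K \<sigma> \<Longrightarrow> y \<in> ty_den I K \<tau> \<Longrightarrow> pair_v I x y \<in> ty_den I K (Prod \<sigma> \<tau>)"
  by auto

lemma pair_ext_closed:
  assumes "typing L [] N \<tau>" "Prod \<sigma> \<tau> \<in> Types L" "x \<in> ty_den I K \<sigma>"
  shows "S_ext I K (ty_den I K \<tau>) (ty_den I K (Prod \<sigma> \<tau>))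
    (\<lambda>y. S_unit I K (ty_den I K (Prod \<sigma> \<tau>)) (pair_v I x y)) (sem L I K N [] [])
    \<in> S_set I K (ty_den I K (Prod \<sigma> \<tau>))"
  by (intro S_ext_closed Pi_I S_unit_closed pair_closed sem_program program_Obj[OF assms(1)]
    ty_den_Obj assms)

section \<open>Each evaluation frame as a Kleisli extension\<close>

lemma S_linear_If:
  assumes "typing L [] M \<sigma>" "typing L [] N \<sigma>"
  shows "S_linear (\<lambda>Q. trm.If Q M N) (Base (BoolT L)) \<sigma>"
  by (rule S_linearI[of "\<lambda>x. if x = true_v I then sem L I K M [] [] else sem L I K N [] []"])
    (use assms in \<open>auto simp: ty_of_eq sem_program intro: typing.intros\<close>)

lemma S_linear_Act:
  assumes "typing L [] M \<sigma>"
  shows "S_linear (\<lambda>Q. Act Q M) (Base (RewT L)) \<sigma>"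
  by (rule S_linearI[of "\<lambda>r. S_act I K (ty_den I K \<sigma>) r (sem L I K M [] [])"])
    (use assms base_Rew program_Obj[OF assms] in
      \<open>auto simp: ty_of_eq sem_program S_act_closed intro: typing.intros\<close>)

lemma S_linear_Pair1:
  assumes "typing L [] N \<tau>" "Prod \<sigma> \<tau> \<in> Types L"
  shows "S_linear (\<lambda>Q. trm.Pair Q N) \<sigma> (Prod \<sigma> \<tau>)"
  by (rule S_linearI, rule Pi_I, erule pair_ext_closed[OF assms])
    (use assms in \<open>simp_all add: ty_of_eq Let_def typing.intros\<close>)

text \<open>The component already evaluated denotes a unit, which the left unit law removes.\<close>

lemma S_linear_Pair2:
  assumes "is_val V" "typing L [] V \<sigma>" "Prod \<sigma> \<tau> \<in> Types L"
  shows "S_linear (\<lambda>Q. trm.Pair V Q) \<tau> (Prod \<sigma> \<tau>)"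
proof (rule S_linearI)
  let ?Y = "ty_den I K (Prod \<sigma> \<tau>)"
  note V = sem_val[OF assms(1,2)]
  have Y: "?Y \<in> Obj K" using assms(3) by (rule ty_den_Obj)
  show "(\<lambda>y. S_unit I K ?Y (pair_v I (val_sem L I K V) y)) \<in> ty_den I K \<tau> \<rightarrow> S_set I K ?Y"
    using V Y pair_closed by (intro Pi_I S_unit_closed) auto
  fix Q assume Q: "typing L [] Q \<tau>"
  show "typing L [] (trm.Pair V Q) (Prod \<sigma> \<tau>)" using assms Q by (intro typing.intros)
  show "sem L I K (trm.Pair V Q) [] [] = S_ext I K (ty_den I K \<tau>) ?Y
      (\<lambda>y. S_unit I K ?Y (pair_v I (val_sem L I K V) y)) (sem L I K Q [] [])"
    unfolding sem.simps Let_def ty_of_eq[OF assms(2)] ty_of_eq[OF Q] V[THEN conjunct1]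
    using V program_Obj[OF assms(2)] Y pair_ext_closed[OF Q assms(3)]
    by (intro S_ext_unit_left) auto
qed

lemma S_linear_Fst:
  assumes "Prod \<sigma> \<tau> \<in> Types L"
  shows "S_linear Fst (Prod \<sigma> \<tau>) \<sigma>"
proof (rule S_linearI)
  have "ty_den I K \<sigma> \<in> Obj K" using Prod_Types[OF assms] ty_den_Obj by blast
  then show "(\<lambda>v. S_unit I K (ty_den I K \<sigma>) (fst_v I v))
      \<in> ty_den I K (Prod \<sigma> \<tau>) \<rightarrow> S_set I K (ty_den I K \<sigma>)"
    by (auto simp: fst_v_pair intro!: S_unit_closed)
  fix Q assume Q: "typing L [] Q (Prod \<sigma> \<tau>)"
  then show "typing L [] (Fst Q) \<sigma>" by (rule typing.Fst)
  then show "sem L I K (Fst Q) [] [] = S_ext I K (ty_den I K (Prod \<sigma> \<tau>)) (ty_den I K \<sigma>)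
      (\<lambda>v. S_unit I K (ty_den I K \<sigma>) (fst_v I v)) (sem L I K Q [] [])"
    by (simp only: sem.simps ty_of_eq[OF Q] ty_of_eq)
qed

lemma S_linear_Snd:
  assumes "Prod \<sigma> \<tau> \<in> Types L"
  shows "S_linear Snd (Prod \<sigma> \<tau>) \<tau>"
proof (rule S_linearI)
  have "ty_den I K \<tau> \<in> Obj K" using Prod_Types[OF assms] ty_den_Obj by blast
  then show "(\<lambda>v. S_unit I K (ty_den I K \<tau>) (snd_v I v))
      \<in> ty_den I K (Prod \<sigma> \<tau>) \<rightarrow> S_set I K (ty_den I K \<tau>)"
    by (auto simp: snd_v_pair intro!: S_unit_closed)
  fix Q assume Q: "typing L [] Q (Prod \<sigma> \<tau>)"
  then show "typing L [] (Snd Q) \<tau>" by (rule typing.Snd)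
  then show "sem L I K (Snd Q) [] [] = S_ext I K (ty_den I K (Prod \<sigma> \<tau>)) (ty_den I K \<tau>)
      (\<lambda>v. S_unit I K (ty_den I K \<tau>) (snd_v I v)) (sem L I K Q [] [])"
    by (simp only: sem.simps ty_of_eq[OF Q] ty_of_eq)
qed

lemma app_ext_closed:
  assumes "typing L [] N \<sigma>" "Fun \<sigma> \<tau> \<in> Types L" "\<phi> \<in> ty_den I K (Fun \<sigma> \<tau>)"
  shows "S_ext I K (ty_den I K \<sigma>) (ty_den I K \<tau>) (app_v I K \<sigma> \<tau> \<phi>) (sem L I K N [] [])
    \<in> S_set I K (ty_den I K \<tau>)"
  using ty_den_Obj Fun_Types[OF assms(2)]
  by (intro S_ext_closed app_v_closed sem_program assms) auto

lemma S_linear_App1: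
  assumes "typing L [] N \<sigma>" "Fun \<sigma> \<tau> \<in> Types L"
  shows "S_linear (\<lambda>Q. App Q N) (Fun \<sigma> \<tau>) \<tau>"
proof (rule S_linearI)
  show "(\<lambda>\<phi>. S_ext I K (ty_den I K \<sigma>) (ty_den I K \<tau>) (app_v I K \<sigma> \<tau> \<phi>) (sem L I K N [] []))
      \<in> ty_den I K (Fun \<sigma> \<tau>) \<rightarrow> S_set I K (ty_den I K \<tau>)"
    by (intro Pi_I app_ext_closed assms)
  fix Q assume Q: "typing L [] Q (Fun \<sigma> \<tau>)"
  then show *: "typing L [] (App Q N) \<tau>" using assms(1) by (rule typing.App)
  show "sem L I K (App Q N) [] [] = S_ext I K (ty_den I K (Fun \<sigma> \<tau>)) (ty_den I K \<tau>)
      (\<lambda>\<phi>. S_ext I K (ty_den I K \<sigma>) (ty_den I K \<tau>) (app_v I K \<sigma> \<tau> \<phi>) (sem L I K N [] []))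
      (sem L I K Q [] [])"
    by (simp only: sem.simps Let_def ty_of_eq[OF *] ty_of_eq[OF assms(1)])
qed

text \<open>The abstraction denotes a unit, so only the argument remains to be sequenced. This
  serves both the frame around an argument and the \<beta>-redex.\<close>

lemma sem_App_Lam:
  assumes "typing L [] (Lam \<sigma> M) (Fun \<sigma> \<tau>)" "typing L [] N \<sigma>"
  shows "sem L I K (App (Lam \<sigma> M) N) [] [] = S_ext I K (ty_den I K \<sigma>) (ty_den I K \<tau>)
    (app_v I K \<sigma> \<tau> (val_sem L I K (Lam \<sigma> M))) (sem L I K N [] [])"
proof -
  have F: "Fun \<sigma> \<tau> \<in> Types L" using typing_Types[OF assms(1)] by simp
  note V = sem_val[OF is_val.intros(4) assms(1)]
  show ?thesis
    unfolding sem.simps(13) Let_def ty_of_eq[OF assms(2)] ty_of_eq[OF typing.App[OF assms]]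
      V[THEN conjunct1]
    using ty_den_Obj[OF F] ty_den_Obj Fun_Types[OF F] V app_ext_closed[OF assms(2) F]
    by (intro S_ext_unit_left) auto
qed

lemma S_linear_App2:
  assumes "typing L [] (Lam \<sigma> M) (Fun \<sigma> \<tau>)"
  shows "S_linear (App (Lam \<sigma> M)) \<sigma> \<tau>"
proof (rule S_linearI)
  have "Fun \<sigma> \<tau> \<in> Types L" using typing_Types[OF assms] by simp
  then show "app_v I K \<sigma> \<tau> (val_sem L I K (Lam \<sigma> M)) \<in> ty_den I K \<sigma> \<rightarrow> S_set I K (ty_den I K \<tau>)"
    using app_v_closed sem_val[OF is_val.intros(4) assms] by blast
qed (use assms sem_App_Lam[OF assms] in \<open>auto simp del: sem.simps val_sem.simps intro: typing.intros\<close>)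

lemma sem_program_base: "typing L [] M (Base b) \<Longrightarrow> sem L I K M [] [] \<in> S_set I K (base_set I b)"
  using sem_program[of M "Base b"] by simp

text \<open>Leading constants denote units, so the left unit law feeds their denotations directly to
  the continuation. With \<open>Ms\<close> empty this evaluates a fully applied function
  symbol.\<close>

lemma S_seq_const:
  assumes "list_all2 (\<lambda>M b. typing L [] M (Base b)) Ms bs" "Y \<in> Obj K"
    "\<And>xs. list_all2 (\<lambda>x b. x \<in> base_set I b) xs (map (ctyp L) cs @ bs) \<Longrightarrow> k xs \<in> S_set I K Y"
  shows "S_seq I K Y k (zip (map (base_set I) (map (ctyp L) cs @ bs))
      (map (\<lambda>M. sem L I K M [] []) (map Const cs @ Ms)))
    = S_seq I K Y (\<lambda>xs. k (map (const_den I) cs @ xs))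
      (zip (map (base_set I) bs) (map (\<lambda>M. sem L I K M [] []) Ms))"
  using assms(3)
proof (induction cs arbitrary: k)
  case (Cons c cs)
  have "list_all2 (\<lambda>M b. typing L [] M (Base b)) (map Const cs @ Ms) (map (ctyp L) cs @ bs)"
    using assms(1)
    by (auto simp: list_all2_map1 list_all2_map2 list_all2_same typing.Const intro!: list_all2_appendI)
  then have typed: "list_all2 (\<lambda>F b. F \<in> S_set I K (base_set I b))
      (map (\<lambda>M. sem L I K M [] []) (map Const cs @ Ms)) (map (ctyp L) cs @ bs)"
    unfolding list_all2_map1[of _ _ "map Const cs @ Ms"]
    by (rule list_all2_mono) (rule sem_program_base)
  have k: "S_seq I K Y (\<lambda>xs. k (x # xs)) (zip (map (base_set I) (map (ctyp L) cs @ bs))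
      (map (\<lambda>M. sem L I K M [] []) (map Const cs @ Ms))) \<in> S_set I K Y"
    if "x \<in> base_set I (ctyp L c)" for x
    using that Cons.prems by (intro S_seq_closed[OF typed assms(2)]) auto
  have "S_seq I K Y k (zip (map (base_set I) (map (ctyp L) (c # cs) @ bs))
      (map (\<lambda>M. sem L I K M [] []) (map Const (c # cs) @ Ms)))
    = S_ext I K (base_set I (ctyp L c)) Y
        (\<lambda>x. S_seq I K Y (\<lambda>xs. k (x # xs)) (zip (map (base_set I) (map (ctyp L) cs @ bs))
          (map (\<lambda>M. sem L I K M [] []) (map Const cs @ Ms))))
        (S_unit I K (base_set I (ctyp L c)) (const_den I c))"
    by simp
  also have "\<dots> = S_seq I K Y (\<lambda>xs. k (const_den I c # xs)) (zip (map (base_set I) (map (ctyp L) cs @ bs))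
      (map (\<lambda>M. sem L I K M [] []) (map Const cs @ Ms)))"
    using k assms(2) const_closed by (intro S_ext_unit_left Pi_I base_Obj)
  also have "\<dots> = S_seq I K Y (\<lambda>xs. k (map (const_den I) (c # cs) @ xs))
      (zip (map (base_set I) bs) (map (\<lambda>M. sem L I K M [] []) Ms))"
    using Cons.IH[of "\<lambda>xs. k (const_den I c # xs)"] Cons.prems const_closed by simp
  finally show ?case .
qed simp

lemma typing_consts: "list_all2 (\<lambda>M b. typing L [] M (Base b)) (map Const cs) bs \<Longrightarrow> bs = map (ctyp L) cs"
  by (induction cs arbitrary: bs) (auto simp: list_all2_Cons1 elim: typing_ConstE)

lemma S_linear_FApp:
  assumes "list_all2 (\<lambda>M b. typing L [] M (Base b)) Ms bs" "fdom L f = map (ctyp L) cs @ b # bs"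
  shows "S_linear (\<lambda>Q. FApp f (map Const cs @ Q # Ms)) (Base b) (Base (fcod L f))"
proof (rule S_linearI)
  let ?Y = "base_set I (fcod L f)" and ?Fs = "map (\<lambda>M. sem L I K M [] []) Ms"
  let ?k = "\<lambda>xs. S_unit I K ?Y (fun_den I f xs)"
  \<comment> \<open>The continuation of the hole: the constants on the left are already delivered,
    \<open>x\<close> comes from the hole, and the arguments on the right are still to be
    run.\<close>
  let ?g = "\<lambda>x. S_seq I K ?Y (\<lambda>xs. ?k (map (const_den I) cs @ x # xs)) (zip (map (base_set I) bs) ?Fs)"
  have k: "?k xs \<in> S_set I K ?Y" if "list_all2 (\<lambda>x b. x \<in> base_set I b) xs (fdom L f)" for xs
    using that by (intro S_unit_closed base_Obj fun_closed)
  have Fs: "list_all2 (\<lambda>F b. F \<in> S_set I K (base_set I b)) ?Fs bs"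
    unfolding list_all2_map1 using assms(1) by (rule list_all2_mono) (rule sem_program_base)
  have cs: "list_all2 (\<lambda>x b. x \<in> base_set I b) (map (const_den I) cs) (map (ctyp L) cs)"
    by (simp add: list_all2_map1 list_all2_map2 list_all2_same const_closed)
  show "?g \<in> ty_den I K (Base b) \<rightarrow> S_set I K (ty_den I K (Base (fcod L f)))"
    unfolding ty_den.simps using cs assms(2)
    by (intro Pi_I S_seq_closed[OF Fs] base_Obj k) (auto intro!: list_all2_appendI)
  fix Q assume Q: "typing L [] Q (Base b)"
  have "list_all2 (\<lambda>M b. typing L [] M (Base b)) (map Const cs) (map (ctyp L) cs)"
    by (simp add: list_all2_map1 list_all2_map2 list_all2_same typing.Const)
  then show "typing L [] (FApp f (map Const cs @ Q # Ms)) (Base (fcod L f))"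
    using Q assms by (auto intro!: typing.FApp list_all2_appendI)
  have "sem L I K (FApp f (map Const cs @ Q # Ms)) [] []
    = S_seq I K ?Y ?k (zip (map (base_set I) (map (ctyp L) cs @ b # bs))
        (map (\<lambda>M. sem L I K M [] []) (map Const cs @ Q # Ms)))"
    by (simp only: sem.simps assms(2))
  also have "\<dots> = S_seq I K ?Y (\<lambda>xs. ?k (map (const_den I) cs @ xs))
      (zip (map (base_set I) (b # bs)) (map (\<lambda>M. sem L I K M [] []) (Q # Ms)))"
    using assms Q k by (intro S_seq_const base_Obj) auto
  also have "\<dots> = S_ext I K (base_set I b) ?Y ?g (sem L I K Q [] [])"
    by simp
  finally show "sem L I K (FApp f (map Const cs @ Q # Ms)) [] []
    = S_ext I K (ty_den I K (Base b)) (ty_den I K (Base (fcod L f))) ?g (sem L I K Q [] [])"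
    by simp
qed

text \<open>The inductive step shared by all frames: \<open>D\<close> is one frame around the
  context \<open>C\<close>.\<close>

lemma S_linear_frame:
  assumes "\<exists>\<tau>. typing L [] Q \<tau> \<and> S_linear C \<tau> \<sigma>'" "S_linear D \<sigma>' \<sigma>"
    "typing L [] (C Q) \<sigma>'" "typing L [] (D (C Q)) \<sigma>"
  shows "\<exists>\<tau>. typing L [] Q \<tau> \<and> S_linear (\<lambda>Q. D (C Q)) \<tau> \<sigma>"
proof -
  obtain \<tau> where Q: "typing L [] Q \<tau>" and C: "S_linear C \<tau> \<sigma>'" using assms(1) by blast
  have "S_linear (\<lambda>Q. D (C Q)) \<tau> \<sigma>"
    by (rule S_linear_comp[OF C assms(2)]) (use typing_Types[of "[]"] Q assms(3,4) in auto)
  with Q show ?thesis by blast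
qed

text \<open>Inverting the typing derivation reveals the type of the hole. The resulting continuation
  works for every closed term of that type, so the hole may later be refilled by a reduct or by a
  branch.\<close>

lemma ectx_linear:
  "ectx C \<Longrightarrow> typing L [] (C Q) \<sigma> \<Longrightarrow> \<exists>\<tau>. typing L [] Q \<tau> \<and> S_linear C \<tau> \<sigma>"
proof (induction arbitrary: \<sigma> rule: ectx.induct)
  case 1
  then show ?case using S_linear_id typing_Types[OF 1] by auto
next
  case (2 C f cs Ms)
  from 2(3) have \<sigma>: "\<sigma> = Base (fcod L f)"
    and all: "list_all2 (\<lambda>M b. typing L [] M (Base b)) (map Const cs @ C Q # Ms) (fdom L f)"
    by (auto elim: typing_FAppE)
  from all obtain bs' b bs where f: "fdom L f = bs' @ b # bs"
    and bs': "list_all2 (\<lambda>M b. typing L [] M (Base b)) (map Const cs) bs'"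
    and CQ: "typing L [] (C Q) (Base b)" and Ms: "list_all2 (\<lambda>M b. typing L [] M (Base b)) Ms bs"
    unfolding list_all2_append1 list_all2_Cons1 by blast
  have "fdom L f = map (ctyp L) cs @ b # bs" using f typing_consts[OF bs'] by simp
  from S_linear_frame[OF "2.IH"[OF CQ] S_linear_FApp[OF Ms this, folded \<sigma>] CQ 2(3)] show ?case .
next
  case (3 C M N)
  from 3(3) have CQ: "typing L [] (C Q) (Base (BoolT L))"
    and M: "typing L [] M \<sigma>" and N: "typing L [] N \<sigma>"
    by (auto elim: typing_IfE)
  from S_linear_frame[OF "3.IH"[OF CQ] S_linear_If[OF M N] CQ 3(3)] show ?case .
next
  case (4 C M)
  from 4(3) have CQ: "typing L [] (C Q) (Base (RewT L))" and M: "typing L [] M \<sigma>"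
    by (auto elim: typing_ActE)
  from S_linear_frame[OF "4.IH"[OF CQ] S_linear_Act[OF M] CQ 4(3)] show ?case .
next
  case (5 C N)
  from 5(3) obtain \<sigma>\<^sub>1 \<sigma>\<^sub>2 where \<sigma>: "\<sigma> = Prod \<sigma>\<^sub>1 \<sigma>\<^sub>2" and CQ: "typing L [] (C Q) \<sigma>\<^sub>1"
    and N: "typing L [] N \<sigma>\<^sub>2" and P: "Prod \<sigma>\<^sub>1 \<sigma>\<^sub>2 \<in> Types L"
    by (auto elim: typing_PairE)
  from S_linear_frame[OF "5.IH"[OF CQ] S_linear_Pair1[OF N P, folded \<sigma>] CQ 5(3)] show ?case .
next
  case (6 V C)
  from 6(4) obtain \<sigma>\<^sub>1 \<sigma>\<^sub>2 where \<sigma>: "\<sigma> = Prod \<sigma>\<^sub>1 \<sigma>\<^sub>2" and V: "typing L [] V \<sigma>\<^sub>1"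
    and CQ: "typing L [] (C Q) \<sigma>\<^sub>2" and P: "Prod \<sigma>\<^sub>1 \<sigma>\<^sub>2 \<in> Types L"
    by (auto elim: typing_PairE)
  from S_linear_frame[OF "6.IH"[OF CQ] S_linear_Pair2[OF 6(1) V P, folded \<sigma>] CQ 6(4)] show ?case .
next
  case (7 C)
  from 7(3) obtain \<tau> where CQ: "typing L [] (C Q) (Prod \<sigma> \<tau>)"
    by (auto elim: typing_FstE)
  then have "Prod \<sigma> \<tau> \<in> Types L" using typing_Types[OF CQ] by simp
  from S_linear_frame[OF "7.IH"[OF CQ] S_linear_Fst[OF this] CQ 7(3)] show ?case .
next
  case (8 C)
  from 8(3) obtain \<tau> where CQ: "typing L [] (C Q) (Prod \<tau> \<sigma>)"
    by (auto elim: typing_SndE)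
  then have "Prod \<tau> \<sigma> \<in> Types L" using typing_Types[OF CQ] by simp
  from S_linear_frame[OF "8.IH"[OF CQ] S_linear_Snd[OF this] CQ 8(3)] show ?case .
next
  case (9 C N)
  from 9(3) obtain \<tau> where CQ: "typing L [] (C Q) (Fun \<tau> \<sigma>)" and N: "typing L [] N \<tau>"
    by (auto elim: typing_AppE)
  then have "Fun \<tau> \<sigma> \<in> Types L" using typing_Types[OF CQ] by simp
  from S_linear_frame[OF "9.IH"[OF CQ] S_linear_App1[OF N this] CQ 9(3)] show ?case .
next
  case (10 C \<tau> M)
  from 10(3) have lam: "typing L [] (Lam \<tau> M) (Fun \<tau> \<sigma>)" and CQ: "typing L [] (C Q) \<tau>"
    by (auto elim!: typing_AppE typing_LamE intro: typing.Lam)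
  from S_linear_frame[OF "10.IH"[OF CQ] S_linear_App2[OF lam] CQ 10(3)] show ?case .
qed

text \<open>Function symbols use \<open>fun_val\<close>; conditionals and projections follow from
  the left unit law; a \<beta>-step also decodes \<open>fun_v\<close> and applies
  \<open>sem_subst\<close>.\<close>

lemma sem_redex:
  assumes "redex L Q Q'" "typing L [] Q \<sigma>"
  shows "typing L [] Q' \<sigma> \<and> sem L I K Q' [] [] = sem L I K Q [] []"
  using assms(1)
proof (cases rule: redex.cases)
  case (1 f cs)
  with assms(2) have \<sigma>: "\<sigma> = Base (fcod L f)"
    and "list_all2 (\<lambda>M b. typing L [] M (Base b)) (map Const cs) (fdom L f)"
    by (auto elim: typing_FAppE)
  then have f: "fdom L f = map (ctyp L) cs" using typing_consts by blast
  let ?Y = "base_set I (fcod L f)"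
  have k: "S_unit I K ?Y (fun_den I f xs) \<in> S_set I K ?Y"
    if "list_all2 (\<lambda>x b. x \<in> base_set I b) xs (fdom L f)" for xs
    using that by (intro S_unit_closed base_Obj fun_closed)
  have "sem L I K Q [] [] = S_unit I K ?Y (fun_den I f (map (const_den I) cs))"
    using S_seq_const[of "[]" "[]" ?Y cs "\<lambda>xs. S_unit I K ?Y (fun_den I f xs)"] base_Obj k
    by (simp add: 1 f)
  then show ?thesis
    using typing.Const[of L "[]" "val_f L f cs"] by (simp add: 1 \<sigma> f fun_val val_typ)
next
  case (2 N)
  with assms(2) have M: "typing L [] Q' \<sigma>" "typing L [] N \<sigma>" by (auto elim: typing_IfE)
  have "sem L I K Q [] [] = S_ext I K (base_set I (BoolT L)) (ty_den I K \<sigma>)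
      (\<lambda>x. if x = true_v I then sem L I K Q' [] [] else sem L I K N [] [])
      (S_unit I K (base_set I (BoolT L)) (true_v I))"
    using 2 by (simp add: ty_of_eq[OF M(1)] tt_typ const_tt)
  also have "\<dots> = (if true_v I = true_v I then sem L I K Q' [] [] else sem L I K N [] [])"
    by (rule S_ext_unit_left[OF base_Obj program_Obj[OF M(1)]])
      (use M base_Bool in \<open>auto intro!: sem_program\<close>)
  finally show ?thesis using M by simp
next
  case (3 N)
  with assms(2) have M: "typing L [] N \<sigma>" "typing L [] Q' \<sigma>" by (auto elim: typing_IfE)
  have "sem L I K Q [] [] = S_ext I K (base_set I (BoolT L)) (ty_den I K \<sigma>)
      (\<lambda>x. if x = true_v I then sem L I K N [] [] else sem L I K Q' [] [])
      (S_unit I K (base_set I (BoolT L)) (false_v I))"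
    using 3 by (simp add: ty_of_eq[OF M(1)] ff_typ const_ff)
  also have "\<dots> = (if false_v I = true_v I then sem L I K N [] [] else sem L I K Q' [] [])"
    by (rule S_ext_unit_left[OF base_Obj program_Obj[OF M(1)]])
      (use M base_Bool in \<open>auto intro!: sem_program\<close>)
  finally show ?thesis using M base_Bool(2) by simp
next
  case (4 W)
  with assms(2) obtain \<tau> where P: "typing L [] (trm.Pair Q' W) (Prod \<sigma> \<tau>)"
    by (auto elim: typing_FstE)
  then have V: "typing L [] Q' \<sigma>" and "Prod \<sigma> \<tau> \<in> Types L"
    by (auto elim: typing_PairE)
  then have "ty_den I K \<sigma> \<in> Obj K" using ty_den_Obj Prod_Types by blast
  moreover note PV = sem_val[OF is_val.intros(3)[OF 4(2,3)] P]
  moreover have "S_ext I K (ty_den I K (Prod \<sigma> \<tau>)) (ty_den I K \<sigma>)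
      (\<lambda>v. S_unit I K (ty_den I K \<sigma>) (fst_v I v))
      (S_unit I K (ty_den I K (Prod \<sigma> \<tau>)) (val_sem L I K (trm.Pair Q' W)))
    = S_unit I K (ty_den I K \<sigma>) (fst_v I (val_sem L I K (trm.Pair Q' W)))"
    using calculation program_Obj[OF P]
    by (intro S_ext_unit_left) (auto simp: fst_v_pair intro!: S_unit_closed)
  ultimately have "sem L I K Q [] [] = S_unit I K (ty_den I K \<sigma>) (val_sem L I K Q')"
    unfolding 4(1) sem.simps(10) ty_of_eq[OF P] ty_of_eq[OF typing.Fst[OF P]] by (simp add: fst_v_pair)
  with sem_val[OF 4(2) V] V show ?thesis by simp
next
  case (5 V)
  with assms(2) obtain \<tau> where P: "typing L [] (trm.Pair V Q') (Prod \<tau> \<sigma>)"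
    by (auto elim: typing_SndE)
  then have W: "typing L [] Q' \<sigma>" and "Prod \<tau> \<sigma> \<in> Types L"
    by (auto elim: typing_PairE)
  then have "ty_den I K \<sigma> \<in> Obj K" using ty_den_Obj Prod_Types by blast
  moreover note PV = sem_val[OF is_val.intros(3)[OF 5(2,3)] P]
  moreover have "S_ext I K (ty_den I K (Prod \<tau> \<sigma>)) (ty_den I K \<sigma>)
      (\<lambda>v. S_unit I K (ty_den I K \<sigma>) (snd_v I v))
      (S_unit I K (ty_den I K (Prod \<tau> \<sigma>)) (val_sem L I K (trm.Pair V Q')))
    = S_unit I K (ty_den I K \<sigma>) (snd_v I (val_sem L I K (trm.Pair V Q')))"
    using calculation program_Obj[OF P]
    by (intro S_ext_unit_left) (auto simp: snd_v_pair intro!: S_unit_closed)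
  ultimately have "sem L I K Q [] [] = S_unit I K (ty_den I K \<sigma>) (val_sem L I K Q')"
    unfolding 5(1) sem.simps(11) ty_of_eq[OF P] ty_of_eq[OF typing.Snd[OF P]] by (simp add: snd_v_pair)
  with sem_val[OF 5(3) W] W show ?thesis by simp
next
  case (6 V \<tau> M)
  with assms(2) have lam: "typing L [] (Lam \<tau> M) (Fun \<tau> \<sigma>)" and V: "typing L [] V \<tau>"
    by (auto elim!: typing_AppE typing_LamE intro: typing.Lam)
  then have M: "typing L ([] @ [\<tau>]) M \<sigma>" and F: "Fun \<tau> \<sigma> \<in> Types L"
    by (auto elim: typing_LamE)
  note VV = sem_val[OF 6(3) V] and LV = sem_val[OF is_val.intros(4) lam]
  let ?g = "\<lambda>x\<in>ty_den I K \<tau>. sem L I K M [\<tau>] [x]"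
  have lam_val: "val_sem L I K (Lam \<tau> M) = fun_v I \<tau> \<sigma> ?g"
    using ty_of_eq[OF M] by simp
  have g: "?g \<in> ty_den I K \<tau> \<rightarrow>\<^sub>E S_set I K (ty_den I K \<sigma>)"
    using sem_closed[OF M] Fun_Types[OF F] by auto
  have "sem L I K Q [] [] = app_v I K \<tau> \<sigma> (val_sem L I K (Lam \<tau> M)) (val_sem L I K V)"
    unfolding 6(1) sem_App_Lam[OF lam V] VV[THEN conjunct1]
    using VV LV ty_den_Obj Fun_Types[OF F] app_v_closed[OF F] by (intro S_ext_unit_left) auto
  also have "\<dots> = sem L I K M [\<tau>] [val_sem L I K V]"
    unfolding lam_val app_v_fun_v[OF F g] using VV by simp
  also have "\<dots> = sem L I K Q' [] []"
    using sem_subst[OF 6(3) V M, of "[]"] by (simp add: 6(2))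
  finally show ?thesis using typing_subst[OF M V] by (simp add: 6(2))
qed

section \<open>Steps and effects inside evaluation contexts\<close>

lemma sem_step:
  assumes "step L M M'" "typing L [] M \<sigma>"
  shows "typing L [] M' \<sigma> \<and> sem L I K M' [] [] = sem L I K M [] []"
proof -
  obtain C Q Q' where "M = C Q" "M' = C Q'" "ectx C" "redex L Q Q'" using step_head[OF assms(1)] by blast
  then show ?thesis
    using ectx_linear[of C Q \<sigma>] sem_redex[of Q Q'] assms(2) unfolding S_linear_def by metis
qed

text \<open>The choice and its two branches share the type of the hole, so a single continuation
  \<open>f\<close> serves all three and \<open>S_ext_or\<close> distributes it.\<close>

lemma sem_ectx_Or:
  assumes "ectx C" "typing L [] (C (Or M N)) \<sigma>"
  shows "typing L [] (C M) \<sigma>" "typing L [] (C N) \<sigma>"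
    "sem L I K (C (Or M N)) [] [] = S_or I K (ty_den I K \<sigma>) (sem L I K (C M) [] []) (sem L I K (C N) [] [])"
proof -
  obtain \<tau> where Q: "typing L [] (Or M N) \<tau>" and "S_linear C \<tau> \<sigma>"
    using ectx_linear[OF assms] by blast
  then obtain f where f: "f \<in> ty_den I K \<tau> \<rightarrow> S_set I K (ty_den I K \<sigma>)"
    and C: "\<And>Q. typing L [] Q \<tau> \<Longrightarrow> typing L [] (C Q) \<sigma>"
      "\<And>Q. typing L [] Q \<tau> \<Longrightarrow> sem L I K (C Q) [] []
        = S_ext I K (ty_den I K \<tau>) (ty_den I K \<sigma>) f (sem L I K Q [] [])"
    unfolding S_linear_def by blast
  from Q have M: "typing L [] M \<tau>" and N: "typing L [] N \<tau>" by (auto elim: typing_OrE)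
  show "typing L [] (C M) \<sigma>" "typing L [] (C N) \<sigma>" using C(1) M N by blast+
  show "sem L I K (C (Or M N)) [] []
    = S_or I K (ty_den I K \<sigma>) (sem L I K (C M) [] []) (sem L I K (C N) [] [])"
    using S_ext_or[OF program_Obj[OF Q] program_Obj[OF assms(2)] f sem_program[OF M] sem_program[OF N]]
    by (simp add: C(2)[OF Q] C(2)[OF M] C(2)[OF N] ty_of_eq[OF M])
qed

lemma sem_ectx_Mix:
  assumes "ectx C" "typing L [] (C (Mix p M N)) \<sigma>"
  shows "0 \<le> p" "p \<le> 1" "typing L [] (C M) \<sigma>" "typing L [] (C N) \<sigma>"
    "sem L I K (C (Mix p M N)) [] [] = S_mix I K (ty_den I K \<sigma>) p (sem L I K (C M) [] []) (sem L I K (C N) [] [])"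
proof -
  obtain \<tau> where Q: "typing L [] (Mix p M N) \<tau>" and "S_linear C \<tau> \<sigma>"
    using ectx_linear[OF assms] by blast
  then obtain f where f: "f \<in> ty_den I K \<tau> \<rightarrow> S_set I K (ty_den I K \<sigma>)"
    and C: "\<And>Q. typing L [] Q \<tau> \<Longrightarrow> typing L [] (C Q) \<sigma>"
      "\<And>Q. typing L [] Q \<tau> \<Longrightarrow> sem L I K (C Q) [] []
        = S_ext I K (ty_den I K \<tau>) (ty_den I K \<sigma>) f (sem L I K Q [] [])"
    unfolding S_linear_def by blast
  from Q have p: "0 \<le> p" "p \<le> 1" and M: "typing L [] M \<tau>" and N: "typing L [] N \<tau>"
    by (auto elim: typing_MixE)
  show "0 \<le> p" "p \<le> 1" by (fact p)+
  show "typing L [] (C M) \<sigma>" "typing L [] (C N) \<sigma>" using C(1) M N by blast+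
  show "sem L I K (C (Mix p M N)) [] []
    = S_mix I K (ty_den I K \<sigma>) p (sem L I K (C M) [] []) (sem L I K (C N) [] [])"
    using S_ext_mix[OF program_Obj[OF Q] program_Obj[OF assms(2)] f p sem_program[OF M] sem_program[OF N]]
    by (simp add: C(2)[OF Q] C(2)[OF M] C(2)[OF N] ty_of_eq[OF M])
qed

lemma sem_ectx_Act:
  assumes "ectx C" "typing L [] (C (Act (Const c) M)) \<sigma>"
  shows "const_den I c \<in> Rcar I" "typing L [] (C M) \<sigma>"
    "sem L I K (C (Act (Const c) M)) [] [] = S_act I K (ty_den I K \<sigma>) (const_den I c) (sem L I K (C M) [] [])"
proof -
  obtain \<tau> where Q: "typing L [] (Act (Const c) M) \<tau>" and "S_linear C \<tau> \<sigma>"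
    using ectx_linear[OF assms] by blast
  then obtain f where f: "f \<in> ty_den I K \<tau> \<rightarrow> S_set I K (ty_den I K \<sigma>)"
    and C: "\<And>Q. typing L [] Q \<tau> \<Longrightarrow> typing L [] (C Q) \<sigma>"
      "\<And>Q. typing L [] Q \<tau> \<Longrightarrow> sem L I K (C Q) [] []
        = S_ext I K (ty_den I K \<tau>) (ty_den I K \<sigma>) f (sem L I K Q [] [])"
    unfolding S_linear_def by blast
  from Q have c: "ctyp L c = RewT L" and M: "typing L [] M \<tau>"
    by (auto elim!: typing_ActE typing_ConstE)
  show cR: "const_den I c \<in> Rcar I" using const_closed[of c] c base_Rew by simp
  show "typing L [] (C M) \<sigma>" using C(1) M by blast
  \<comment> \<open>The reward is a constant and hence a unit, so the sequencing built into
    \<open>Act\<close> collapses to the operation \<open>S_act\<close>.\<close>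
  have "sem L I K (Act (Const c) M) [] [] = S_ext I K (Rcar I) (ty_den I K \<tau>)
      (\<lambda>r. S_act I K (ty_den I K \<tau>) r (sem L I K M [] [])) (S_unit I K (Rcar I) (const_den I c))"
    using c base_Rew by (simp add: ty_of_eq[OF M])
  also have "\<dots> = S_act I K (ty_den I K \<tau>) (const_den I c) (sem L I K M [] [])"
    using cR by (intro S_ext_unit_left Pi_I S_act_closed R_Obj program_Obj[OF M] sem_program[OF M])
  finally show "sem L I K (C (Act (Const c) M)) [] []
    = S_act I K (ty_den I K \<sigma>) (const_den I c) (sem L I K (C M) [] [])"
    using S_ext_act[OF program_Obj[OF Q] program_Obj[OF assms(2)] f cR sem_program[OF M]]
    by (simp add: C(2)[OF Q] C(2)[OF M])
qed

end

section \<open>Optimal strategies\<close>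

text \<open>Gives uniqueness of least strategies, on which the description in \<open>opt_str\<close>
  rests.\<close>

lemma str_less_asym: "str_less s t \<Longrightarrow> \<not> str_less t s"
  by (induction s t rule: str_less.induct) auto

context reward_structure
begin

text \<open>Cancellation is inherited from the order: \<open>le_plus\<close> reflects both
  inequalities, and antisymmetry concludes.\<close>

lemma plus_cancel:
  assumes "r \<in> Rcar R" "s \<in> Rcar R" "t \<in> Rcar R" "Rplus R t r = Rplus R t s"
  shows "r = s"
proof (rule le_antisym)
  have "Rplus R r t = Rplus R s t" using assms by (metis plus_comm)
  then show "Rle R r s" "Rle R s r"
    using le_plus[OF assms(1-3)] le_plus[OF assms(2,1,3)] le_refl plus_closed assms(1-3) by metis+
qed (use assms in auto)

lemma le_plus_left:
  assumes "r \<in> Rcar R" "s \<in> Rcar R" "t \<in> Rcar R"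
  shows "Rle R (Rplus R t r) (Rplus R t s) \<longleftrightarrow> Rle R r s"
  using le_plus[OF assms] plus_comm assms by metis

lemma le_mix_right:
  assumes "0 < p" "p < 1" "r \<in> Rcar R" "s \<in> Rcar R" "t \<in> Rcar R"
  shows "Rle R (Rmix R p t r) (Rmix R p t s) \<longleftrightarrow> Rle R r s"
  using le_mix[of "1 - p" r s t] mix_comm[of p t r] mix_comm[of p t s] assms by simp

lemma le_mix_mono:
  assumes "0 < p" "p < 1" "r \<in> Rcar R" "s \<in> Rcar R" "r' \<in> Rcar R" "s' \<in> Rcar R"
    "Rle R r r'" "Rle R s s'"
  shows "Rle R (Rmix R p r s) (Rmix R p r' s')"
proof (rule le_trans)
  show "Rle R (Rmix R p r s) (Rmix R p r' s)" using le_mix assms by blast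
  show "Rle R (Rmix R p r' s) (Rmix R p r' s')" using le_mix_right assms by blast
qed (use assms in \<open>auto intro: mix_closed\<close>)

end

section \<open>Outcomes of strategies and their expected rewards\<close>

context selection_model
begin

text \<open>The invariant of effect values that arise from programs of type \<sigma>. Of a reward
  constant it retains that its denotation lies in R.\<close>

primrec wf_eff :: "'b ty \<Rightarrow> ('b, 'c, 'f) eff \<Rightarrow> bool" where
  "wf_eff \<sigma> (EVal V) \<longleftrightarrow> is_val V \<and> typing L [] V \<sigma>"
| "wf_eff \<sigma> (EOr E\<^sub>1 E\<^sub>2) \<longleftrightarrow> wf_eff \<sigma> E\<^sub>1 \<and> wf_eff \<sigma> E\<^sub>2"
| "wf_eff \<sigma> (EAct c E) \<longleftrightarrow> const_den I c \<in> Rcar I \<and> wf_eff \<sigma> E"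
| "wf_eff \<sigma> (EMix p E\<^sub>1 E\<^sub>2) \<longleftrightarrow> 0 \<le> p \<and> p \<le> 1 \<and> wf_eff \<sigma> E\<^sub>1 \<and> wf_eff \<sigma> E\<^sub>2"

text \<open>Values are constrained through their denotations, which is all that
  \<open>dw_den\<close> sees of them.\<close>

definition wf_dw :: "'b ty \<Rightarrow> ('u \<times> ('b, 'c, 'f) trm) pmf \<Rightarrow> bool" where
  "wf_dw \<sigma> \<mu> \<longleftrightarrow> finite (set_pmf \<mu>) \<and> set_pmf \<mu> \<subseteq> Rcar I \<times> {V. val_sem L I K V \<in> ty_den I K \<sigma>}"

lemma wf_dw_return: "val_sem L I K V \<in> ty_den I K \<sigma> \<Longrightarrow> wf_dw \<sigma> (return_pmf (Rzero I, V))"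
  by (simp add: wf_dw_def zero_closed)

lemma wf_dw_act: "r \<in> Rcar I \<Longrightarrow> wf_dw \<sigma> \<mu> \<Longrightarrow> wf_dw \<sigma> (dw_act I r \<mu>)"
  by (auto simp: wf_dw_def dw_act_def plus_closed)

lemma wf_dw_mix:
  assumes "wf_dw \<sigma> \<mu>" "wf_dw \<sigma> \<nu>"
  shows "wf_dw \<sigma> (dw_mix p \<mu> \<nu>)"
proof -
  have "set_pmf (dw_mix p \<mu> \<nu>) \<subseteq> set_pmf \<mu> \<union> set_pmf \<nu>"
    unfolding dw_mix_def by (auto split: if_splits)
  with assms show ?thesis unfolding wf_dw_def by (meson finite_UnI finite_subset le_sup_iff order_trans)
qed

lemma wf_Out: "wf_eff \<sigma> E \<Longrightarrow> s \<in> Str E \<Longrightarrow> wf_dw \<sigma> (Out I s E)"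
proof (induction E arbitrary: s)
  case (EVal V)
  then show ?case using sem_val by (auto intro: wf_dw_return)
next
  case (EMix p E\<^sub>1 E\<^sub>2)
  then show ?case by (auto intro!: wf_dw_mix EMix.IH)
qed (auto intro: wf_dw_act)

lemma wf_dw_fst: "wf_dw \<sigma> \<mu> \<Longrightarrow> x \<in> set_pmf \<mu> \<Longrightarrow> fst x \<in> Rcar I"
  by (auto simp: wf_dw_def)

text \<open>By cancellation in R, adding \<open>r\<close> never merges two outcomes, so the action
  merely reindexes the support.\<close>

lemma dw_act_inj:
  assumes "r \<in> Rcar I" "wf_dw \<sigma> \<mu>"
  shows "inj_on (\<lambda>(r', x). (Rplus I r r', x)) (set_pmf \<mu>)"
  using wf_dw_fst[OF assms(2)] plus_cancel[OF _ _ assms(1)]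
  by (auto simp: inj_on_def)

lemma expected_reward_closed: "wf_dw \<sigma> \<mu> \<Longrightarrow> expected_reward I \<mu> \<in> Rcar I"
  unfolding expected_reward_def by (rule convex_comb_closed) (auto simp: wf_dw_def)

text \<open>After reindexing, translation by \<open>r\<close> leaves the convex combination because
  \<open>plus_mix\<close> makes it affine.\<close>

lemma expected_reward_act:
  assumes "r \<in> Rcar I" "wf_dw \<sigma> \<mu>"
  shows "expected_reward I (dw_act I r \<mu>) = Rplus I r (expected_reward I \<mu>)"
proof -
  have fin: "finite (set_pmf \<mu>)" using assms(2) by (simp add: wf_dw_def)
  have "expected_reward I (dw_act I r \<mu>)
    = convex_comb (Rmix I) \<mu> (\<lambda>x. fst ((\<lambda>(r', x). (Rplus I r r', x)) x))"
    unfolding expected_reward_def dw_act_def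
    by (rule convex_comb_map[OF fin dw_act_inj[OF assms]])
      (simp add: case_prod_beta plus_closed assms(1) wf_dw_fst[OF assms(2)])
  also have "\<dots> = convex_comb (Rmix I) \<mu> (\<lambda>x. Rplus I r (fst x))"
    by (simp add: case_prod_beta)
  also have "\<dots> = Rplus I r (expected_reward I \<mu>)"
    unfolding expected_reward_def
    by (rule convex_comb_hom[symmetric, OF barycentric_algebra_axioms barycentric_algebra_axioms])
      (simp_all add: assms(1) fin wf_dw_fst[OF assms(2)] plus_closed plus_mix)
  finally show ?thesis .
qed

lemma expected_reward_mix:
  assumes "0 \<le> p" "p \<le> 1" "wf_dw \<sigma> \<mu>" "wf_dw \<sigma> \<nu>"
  shows "expected_reward I (dw_mix p \<mu> \<nu>) = Rmix I p (expected_reward I \<mu>) (expected_reward I \<nu>)"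
  unfolding expected_reward_def using assms
  by (intro convex_comb_dw_mix) (auto simp: wf_dw_def)

lemma Rew_closed: "wf_eff \<sigma> E \<Longrightarrow> s \<in> Str E \<Longrightarrow> Rew I s E \<in> Rcar I"
  unfolding Rew_def using expected_reward_closed wf_Out by blast

lemma Rew_EOr [simp]:
  "Rew I (SLeft s) (EOr E\<^sub>1 E\<^sub>2) = Rew I s E\<^sub>1" "Rew I (SRight s) (EOr E\<^sub>1 E\<^sub>2) = Rew I s E\<^sub>2"
  by (simp_all add: Rew_def)

lemma Rew_EAct:
  "wf_eff \<sigma> (EAct c E) \<Longrightarrow> s \<in> Str E \<Longrightarrow> Rew I s (EAct c E) = Rplus I (const_den I c) (Rew I s E)"
  by (simp add: Rew_def expected_reward_act[OF _ wf_Out[of \<sigma>]])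

lemma Rew_EMix:
  "wf_eff \<sigma> (EMix p E\<^sub>1 E\<^sub>2) \<Longrightarrow> s\<^sub>1 \<in> Str E\<^sub>1 \<Longrightarrow> s\<^sub>2 \<in> Str E\<^sub>2 \<Longrightarrow>
    Rew I (SPair s\<^sub>1 s\<^sub>2) (EMix p E\<^sub>1 E\<^sub>2) = Rmix I p (Rew I s\<^sub>1 E\<^sub>1) (Rew I s\<^sub>2 E\<^sub>2)"
  by (simp add: Rew_def expected_reward_mix[OF _ _ wf_Out[of \<sigma>] wf_Out[of \<sigma>]])

end

primrec first_str :: "('b, 'c, 'f) eff \<Rightarrow> str" where
  "first_str (EVal V) = SStar"
| "first_str (EOr E\<^sub>1 E\<^sub>2) = SLeft (first_str E\<^sub>1)"
| "first_str (EAct c E) = first_str E"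
| "first_str (EMix p E\<^sub>1 E\<^sub>2) = SPair (first_str E\<^sub>1) (first_str E\<^sub>2)"

text \<open>In \<open>EMix p E\<^sub>1 E\<^sub>2\<close> with \<open>p \<in> {0, 1}\<close> one of the two components does not contribute to the reward,
  so the optimal strategy takes the least strategy there.\<close>

primrec best_str :: "('b, 'c, 'f, 'u) interp \<Rightarrow> ('b, 'c, 'f) eff \<Rightarrow> str" where
  "best_str I (EVal V) = SStar"
| "best_str I (EOr E\<^sub>1 E\<^sub>2) =
    (if Rle I (Rew I (best_str I E\<^sub>2) E\<^sub>2) (Rew I (best_str I E\<^sub>1) E\<^sub>1)
     then SLeft (best_str I E\<^sub>1) else SRight (best_str I E\<^sub>2))"
| "best_str I (EAct c E) = best_str I E"
| "best_str I (EMix p E\<^sub>1 E\<^sub>2) =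
    SPair (if p = 0 then first_str E\<^sub>1 else best_str I E\<^sub>1) (if p = 1 then first_str E\<^sub>2 else best_str I E\<^sub>2)"

definition least_in :: "str \<Rightarrow> str set \<Rightarrow> bool" where
  "least_in s S \<longleftrightarrow> s \<in> S \<and> (\<forall>t \<in> S. t = s \<or> str_less s t)"

lemma least_in_SPair:
  "least_in s\<^sub>1 S\<^sub>1 \<Longrightarrow> least_in s\<^sub>2 S\<^sub>2 \<Longrightarrow>
    least_in (SPair s\<^sub>1 s\<^sub>2) {SPair t\<^sub>1 t\<^sub>2 | t\<^sub>1 t\<^sub>2. t\<^sub>1 \<in> S\<^sub>1 \<and> t\<^sub>2 \<in> S\<^sub>2}"
  by (auto simp: least_in_def)

lemma Ball_SPair:
  "(\<forall>t \<in> {SPair s\<^sub>1 s\<^sub>2 | s\<^sub>1 s\<^sub>2. s\<^sub>1 \<in> S\<^sub>1 \<and> s\<^sub>2 \<in> S\<^sub>2}. P t) \<longleftrightarrow> (\<forall>s\<^sub>1 \<in> S\<^sub>1. \<forall>s\<^sub>2 \<in> S\<^sub>2. P (SPair s\<^sub>1 s\<^sub>2))"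
  by blast

lemma first_str_least: "least_in (first_str E) (Str E)"
proof (induction E)
  case (EMix p E\<^sub>1 E\<^sub>2)
  then show ?case by (simp add: least_in_SPair)
qed (auto simp: least_in_def)

lemma least_in_unique: "least_in s S \<Longrightarrow> least_in t S \<Longrightarrow> t = s"
  unfolding least_in_def using str_less_asym by metis

lemma opt_str_eq: "least_in s (max_str I E) \<Longrightarrow> opt_str I E = s"
  unfolding opt_str_def least_in_def[symmetric] by (blast intro: the_equality least_in_unique)

section \<open>Maximising strategies of compound effect values\<close>

context selection_model
begin

text \<open>Adding a fixed reward preserves and reflects the order on R.\<close>

lemma max_str_EAct:
  assumes "wf_eff \<sigma> (EAct c E)"
  shows "max_str I (EAct c E) = max_str I E"
  using assms unfolding max_str_def
  by (auto simp: Rew_EAct[OF assms] le_plus_left Rew_closed[of \<sigma>])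

text \<open>For \<open>0 < p < 1\<close> a mixture preserves and reflects the order in each
  component, so maximality is componentwise. At the end points one component is discarded, and all
  its strategies do equally well.\<close>

lemma max_str_EMix:
  assumes "wf_eff \<sigma> (EMix p E\<^sub>1 E\<^sub>2)"
  shows "max_str I (EMix p E\<^sub>1 E\<^sub>2) = {SPair s\<^sub>1 s\<^sub>2 | s\<^sub>1 s\<^sub>2.
    s\<^sub>1 \<in> (if p = 0 then Str E\<^sub>1 else max_str I E\<^sub>1) \<and> s\<^sub>2 \<in> (if p = 1 then Str E\<^sub>2 else max_str I E\<^sub>2)}"
proof -
  \<comment> \<open>At \<open>p = 0\<close> or \<open>p = 1\<close>, some strategy of the discarded
    component is needed to instantiate the quantifier over pairs.\<close>
  have ne: "first_str E\<^sub>1 \<in> Str E\<^sub>1" "first_str E\<^sub>2 \<in> Str E\<^sub>2"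
    using first_str_least unfolding least_in_def by blast+
  have R: "Rew I s E\<^sub>1 \<in> Rcar I" if "s \<in> Str E\<^sub>1" for s using Rew_closed[of \<sigma> E\<^sub>1 s] assms that by simp
  have R': "Rew I s E\<^sub>2 \<in> Rcar I" if "s \<in> Str E\<^sub>2" for s using Rew_closed[of \<sigma> E\<^sub>2 s] assms that by simp
  have max: "max_str I (EMix p E\<^sub>1 E\<^sub>2) = {SPair s\<^sub>1 s\<^sub>2 | s\<^sub>1 s\<^sub>2. s\<^sub>1 \<in> Str E\<^sub>1 \<and> s\<^sub>2 \<in> Str E\<^sub>2 \<and>
    (\<forall>t\<^sub>1 \<in> Str E\<^sub>1. \<forall>t\<^sub>2 \<in> Str E\<^sub>2.
      Rle I (Rmix I p (Rew I t\<^sub>1 E\<^sub>1) (Rew I t\<^sub>2 E\<^sub>2)) (Rmix I p (Rew I s\<^sub>1 E\<^sub>1) (Rew I s\<^sub>2 E\<^sub>2)))}"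
    unfolding max_str_def Str.simps Ball_SPair by (auto simp: Rew_EMix[OF assms])
  consider "p = 0" | "p = 1" | "0 < p" "p < 1" using assms by fastforce
  then show ?thesis
  proof cases
    case 1
    then show ?thesis unfolding max using ne by (auto simp: mix_zero R R' max_str_def)
  next
    case 2
    then show ?thesis unfolding max using ne by (auto simp: mix_one R R' max_str_def)
  next
    case 3
    have "(\<forall>t\<^sub>1 \<in> Str E\<^sub>1. \<forall>t\<^sub>2 \<in> Str E\<^sub>2.
        Rle I (Rmix I p (Rew I t\<^sub>1 E\<^sub>1) (Rew I t\<^sub>2 E\<^sub>2)) (Rmix I p (Rew I s\<^sub>1 E\<^sub>1) (Rew I s\<^sub>2 E\<^sub>2)))
      \<longleftrightarrow> s\<^sub>1 \<in> max_str I E\<^sub>1 \<and> s\<^sub>2 \<in> max_str I E\<^sub>2" (is "?l \<longleftrightarrow> ?r")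
      if s: "s\<^sub>1 \<in> Str E\<^sub>1" "s\<^sub>2 \<in> Str E\<^sub>2" for s\<^sub>1 s\<^sub>2
    proof
      assume l: ?l
      \<comment> \<open>Varying one component while the other stays fixed lets \<open>le_mix\<close>
        cancel the fixed one.\<close>
      have "Rle I (Rew I t E\<^sub>1) (Rew I s\<^sub>1 E\<^sub>1)" if "t \<in> Str E\<^sub>1" for t
        using l[rule_format, OF that s(2)] le_mix[OF 3] R R' s that by blast
      moreover have "Rle I (Rew I t E\<^sub>2) (Rew I s\<^sub>2 E\<^sub>2)" if "t \<in> Str E\<^sub>2" for t
        using l[rule_format, OF s(1) that] le_mix_right[OF 3] R R' s that by blast
      ultimately show ?r using s by (simp add: max_str_def)
    next
      assume ?r
      then show ?l using s 3 R R' by (auto simp: max_str_def intro!: le_mix_mono)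
    qed
    then show ?thesis unfolding max using 3 by (auto simp: max_str_def)
  qed
qed

text \<open>All left strategies precede all right ones, so a tie must go to the left, just as the
  test in \<open>S_or\<close> decides it.\<close>

lemma least_in_EOr:
  assumes "wf_eff \<sigma> E\<^sub>1" "wf_eff \<sigma> E\<^sub>2" "least_in s\<^sub>1 (max_str I E\<^sub>1)" "least_in s\<^sub>2 (max_str I E\<^sub>2)"
  shows "least_in (if Rle I (Rew I s\<^sub>2 E\<^sub>2) (Rew I s\<^sub>1 E\<^sub>1) then SLeft s\<^sub>1 else SRight s\<^sub>2)
    (max_str I (EOr E\<^sub>1 E\<^sub>2))"
proof -
  have s: "s\<^sub>1 \<in> Str E\<^sub>1" "s\<^sub>2 \<in> Str E\<^sub>2"
    and max1: "\<And>t. t \<in> Str E\<^sub>1 \<Longrightarrow> Rle I (Rew I t E\<^sub>1) (Rew I s\<^sub>1 E\<^sub>1)"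
    and max2: "\<And>t. t \<in> Str E\<^sub>2 \<Longrightarrow> Rle I (Rew I t E\<^sub>2) (Rew I s\<^sub>2 E\<^sub>2)"
    and least1: "\<And>t. t \<in> max_str I E\<^sub>1 \<Longrightarrow> t = s\<^sub>1 \<or> str_less s\<^sub>1 t"
    and least2: "\<And>t. t \<in> max_str I E\<^sub>2 \<Longrightarrow> t = s\<^sub>2 \<or> str_less s\<^sub>2 t"
    using assms(3,4) by (auto simp: least_in_def max_str_def)
  note R = Rew_closed[OF assms(1)] Rew_closed[OF assms(2)]
  show ?thesis
  proof (cases "Rle I (Rew I s\<^sub>2 E\<^sub>2) (Rew I s\<^sub>1 E\<^sub>1)")
    case True
    have "Rle I (Rew I t E\<^sub>2) (Rew I s\<^sub>1 E\<^sub>1)" if "t \<in> Str E\<^sub>2" for t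
      using le_trans[OF R(2)[OF that] R(2)[OF s(2)] R(1)[OF s(1)] max2[OF that] True] .
    then have "SLeft s\<^sub>1 \<in> max_str I (EOr E\<^sub>1 E\<^sub>2)"
      using s max1 by (auto simp: max_str_def)
    moreover have "t = SLeft s\<^sub>1 \<or> str_less (SLeft s\<^sub>1) t"
      if t: "t \<in> max_str I (EOr E\<^sub>1 E\<^sub>2)" for t
    proof -
      consider t' where "t = SLeft t'" "t' \<in> max_str I E\<^sub>1" | t' where "t = SRight t'"
        using t by (auto simp: max_str_def ball_Un)
      then show ?thesis using least1 by cases auto
    qed
    ultimately show ?thesis using True by (simp add: least_in_def)
  next
    case False
    then have lt: "Rle I (Rew I s\<^sub>1 E\<^sub>1) (Rew I s\<^sub>2 E\<^sub>2)" using le_total R s by blast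
    have "Rle I (Rew I t E\<^sub>1) (Rew I s\<^sub>2 E\<^sub>2)" if "t \<in> Str E\<^sub>1" for t
      using le_trans[OF R(1)[OF that] R(1)[OF s(1)] R(2)[OF s(2)] max1[OF that] lt] .
    then have "SRight s\<^sub>2 \<in> max_str I (EOr E\<^sub>1 E\<^sub>2)"
      using s max2 by (auto simp: max_str_def)
    moreover have "t = SRight s\<^sub>2 \<or> str_less (SRight s\<^sub>2) t"
      if t: "t \<in> max_str I (EOr E\<^sub>1 E\<^sub>2)" for t
    proof -
      \<comment> \<open>The first case covers a maximiser on the left. Its reward would be at least
        that of \<open>s\<^sub>2\<close>, hence so would that of \<open>s\<^sub>1\<close>, against
        the case assumption.\<close>
      consider t' where "t' \<in> Str E\<^sub>1" "Rle I (Rew I s\<^sub>2 E\<^sub>2) (Rew I t' E\<^sub>1)"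
        | t' where "t = SRight t'" "t' \<in> max_str I E\<^sub>2"
        using t s by (auto simp: max_str_def ball_Un)
      then show ?thesis
      proof cases
        case (1 t')
        with le_trans[OF R(2)[OF s(2)] R(1)[OF 1(1)] R(1)[OF s(1)] 1(2) max1[OF 1(1)]] False
        show ?thesis by blast
      qed (use least2 in auto)
    qed
    ultimately show ?thesis using False by (simp add: least_in_def)
  qed
qed

lemma best_str_least: "wf_eff \<sigma> E \<Longrightarrow> least_in (best_str I E) (max_str I E)"
proof (induction E)
  case (EVal V)
  have "Rew I SStar (EVal V) \<in> Rcar I" using Rew_closed[OF EVal] by simp
  then show ?case by (simp add: least_in_def max_str_def le_refl)
next
  case (EOr E\<^sub>1 E\<^sub>2)
  then show ?case using least_in_EOr[of \<sigma> E\<^sub>1 E\<^sub>2] by simp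
next
  case (EAct c E)
  then show ?case using max_str_EAct[OF EAct.prems] by simp
next
  case (EMix p E\<^sub>1 E\<^sub>2)
  then show ?case
    unfolding max_str_EMix[OF EMix.prems] best_str.simps
    by (intro least_in_SPair) (auto simp: first_str_least)
qed

lemma best_str_Str: "wf_eff \<sigma> E \<Longrightarrow> best_str I E \<in> Str E"
  using best_str_least[of \<sigma> E] by (simp add: least_in_def max_str_def)

section \<open>Adequacy\<close>

lemma dw_summand_closed:
  assumes "\<sigma> \<in> Types L" "wf_dw \<sigma> \<mu>" "x \<in> set_pmf \<mu>"
  shows "(\<lambda>(r, V). Tact K (ty_den I K \<sigma>) r (unit K (ty_den I K \<sigma>) (val_sem L I K V))) x
    \<in> T K (ty_den I K \<sigma>)"
proof -
  interpret M: barycentric_module I "T K (ty_den I K \<sigma>)" "Tmix K (ty_den I K \<sigma>)" "Tact K (ty_den I K \<sigma>)"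
    by (rule A1) (rule ty_den_Obj[OF assms(1)])
  obtain r V where x: "x = (r, V)" by (cases x)
  then have "r \<in> Rcar I" "val_sem L I K V \<in> ty_den I K \<sigma>" using assms(2,3) by (auto simp: wf_dw_def)
  then show ?thesis using x ty_den_Obj[OF assms(1)] by (auto intro!: M.act_closed unit_closed)
qed

lemma dw_den_return:
  assumes "\<sigma> \<in> Types L" "val_sem L I K V \<in> ty_den I K \<sigma>"
  shows "dw_den L I K \<sigma> (return_pmf (Rzero I, V)) = unit K (ty_den I K \<sigma>) (val_sem L I K V)"
proof -
  interpret M: barycentric_module I "T K (ty_den I K \<sigma>)" "Tmix K (ty_den I K \<sigma>)" "Tact K (ty_den I K \<sigma>)"
    by (rule A1) (rule ty_den_Obj[OF assms(1)])
  show ?thesis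
    unfolding dw_den_def
    using unit_closed[OF ty_den_Obj[OF assms(1)] assms(2)]
    by (subst M.convex_comb_return) (simp_all add: M.act_closed M.act_zero zero_closed)
qed

text \<open>\<open>act_plus\<close> extracts the translation by \<open>r\<close> from each summand,
  and \<open>act_mix\<close> extracts it from the convex combination.\<close>

lemma dw_den_act:
  assumes "\<sigma> \<in> Types L" "r \<in> Rcar I" "wf_dw \<sigma> \<mu>"
  shows "dw_den L I K \<sigma> (dw_act I r \<mu>) = Tact K (ty_den I K \<sigma>) r (dw_den L I K \<sigma> \<mu>)"
proof -
  interpret M: barycentric_module I "T K (ty_den I K \<sigma>)" "Tmix K (ty_den I K \<sigma>)" "Tact K (ty_den I K \<sigma>)"
    by (rule A1) (rule ty_den_Obj[OF assms(1)])
  let ?g = "\<lambda>(r, V). Tact K (ty_den I K \<sigma>) r (unit K (ty_den I K \<sigma>) (val_sem L I K V))"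
  let ?h = "\<lambda>(r', x). (Rplus I r r', x)"
  have fin: "finite (set_pmf \<mu>)" using assms(3) by (simp add: wf_dw_def)
  have g: "?g (?h x) \<in> T K (ty_den I K \<sigma>)" if "x \<in> set_pmf \<mu>" for x
    using dw_summand_closed[OF assms(1) wf_dw_act[OF assms(2,3)], of "?h x"] that
    by (auto simp: dw_act_def)
  have eq: "?g (?h x) = Tact K (ty_den I K \<sigma>) r (?g x)" if "x \<in> set_pmf \<mu>" for x
  proof -
    obtain r' V where x: "x = (r', V)" by (cases x)
    then have "r' \<in> Rcar I" "val_sem L I K V \<in> ty_den I K \<sigma>" using assms(3) that by (auto simp: wf_dw_def)
    then show ?thesis
      using x M.act_plus[OF assms(2)] unit_closed[OF ty_den_Obj[OF assms(1)]] by auto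
  qed
  have "dw_den L I K \<sigma> (dw_act I r \<mu>) = convex_comb (Tmix K (ty_den I K \<sigma>)) \<mu> (\<lambda>x. ?g (?h x))"
    unfolding dw_den_def dw_act_def by (rule M.convex_comb_map[OF fin dw_act_inj[OF assms(2,3)], of ?g]) (rule g)
  also have "\<dots> = convex_comb (Tmix K (ty_den I K \<sigma>)) \<mu> (\<lambda>x. Tact K (ty_den I K \<sigma>) r (?g x))"
    by (rule M.convex_comb_cong[OF fin]) (fact g, fact eq)
  also have "\<dots> = Tact K (ty_den I K \<sigma>) r (dw_den L I K \<sigma> \<mu>)"
    unfolding dw_den_def
    by (rule convex_comb_hom[symmetric, OF M.barycentric_algebra_axioms M.barycentric_algebra_axioms])
      (use assms(2) fin M.act_closed M.act_mix dw_summand_closed[OF assms(1,3)] in auto)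
  finally show ?thesis .
qed

lemma dw_den_mix:
  assumes "\<sigma> \<in> Types L" "0 \<le> p" "p \<le> 1" "wf_dw \<sigma> \<mu>" "wf_dw \<sigma> \<nu>"
  shows "dw_den L I K \<sigma> (dw_mix p \<mu> \<nu>)
    = Tmix K (ty_den I K \<sigma>) p (dw_den L I K \<sigma> \<mu>) (dw_den L I K \<sigma> \<nu>)"
proof -
  interpret M: barycentric_module I "T K (ty_den I K \<sigma>)" "Tmix K (ty_den I K \<sigma>)" "Tact K (ty_den I K \<sigma>)"
    by (rule A1) (rule ty_den_Obj[OF assms(1)])
  show ?thesis
    unfolding dw_den_def
    by (rule M.convex_comb_dw_mix)
      (use assms dw_summand_closed[OF assms(1,4)] dw_summand_closed[OF assms(1,5)] in \<open>auto simp: wf_dw_def\<close>)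
qed

lemma zero_rew_closed: "zero_rew I K \<sigma> \<in> ty_den I K \<sigma> \<rightarrow>\<^sub>E Rcar I"
  by (auto simp: zero_rew_def zero_closed)

text \<open>By (A2), mapping to the zero reward and applying \<open>alg K\<close> is an affine map
  that sends the summand of outcome \<open>(r, V)\<close> to \<open>r\<close> plus zero. Applied to
  the whole combination it yields the expectation.\<close>

lemma alg_dw_den:
  assumes "\<sigma> \<in> Types L" "wf_dw \<sigma> \<mu>"
  shows "alg K (Tmap K (ty_den I K \<sigma>) (Rcar I) (zero_rew I K \<sigma>) (dw_den L I K \<sigma> \<mu>))
    = expected_reward I \<mu>"
proof -
  let ?X = "ty_den I K \<sigma>"
  interpret M: barycentric_module I "T K ?X" "Tmix K ?X" "Tact K ?X"
    by (rule A1) (rule ty_den_Obj[OF assms(1)])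
  let ?g = "\<lambda>(r, V). Tact K ?X r (unit K ?X (val_sem L I K V))"
  let ?h = "\<lambda>u. alg K (Tmap K ?X (Rcar I) (zero_rew I K \<sigma>) u)"
  have X: "?X \<in> Obj K" using assms(1) by (rule ty_den_Obj)
  have z: "zero_rew I K \<sigma> \<in> ?X \<rightarrow> Rcar I" using zero_rew_closed by auto
  then have z': "(\<lambda>x. unit K (Rcar I) (zero_rew I K \<sigma> x)) \<in> ?X \<rightarrow> T K (Rcar I)"
    using R_Obj by (auto intro!: unit_closed)
  have fin: "finite (set_pmf \<mu>)" using assms(2) by (simp add: wf_dw_def)
  have h: "?h u \<in> Rcar I" if "u \<in> T K ?X" for u
    using that by (intro alg_closed Tmap_closed X R_Obj z)
  have hom: "?h (Tmix K ?X p u v) = Rmix I p (?h u) (?h v)"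
    if "0 \<le> p" "p \<le> 1" "u \<in> T K ?X" "v \<in> T K ?X" for p u v
    unfolding Tmap_def using that ext_mix[OF X R_Obj z'] A2_mix ext_closed[OF X R_Obj z'] by simp
  have eq: "?h (?g x) = fst x" if "x \<in> set_pmf \<mu>" for x
  proof -
    obtain r V where x: "x = (r, V)" by (cases x)
    with that assms(2) have r: "r \<in> Rcar I" and V: "val_sem L I K V \<in> ?X" by (auto simp: wf_dw_def)
    have u: "unit K ?X (val_sem L I K V) \<in> T K ?X" using X V by (rule unit_closed)
    have "?h (?g x) = Rplus I r (?h (unit K ?X (val_sem L I K V)))"
      unfolding Tmap_def x using ext_act[OF X R_Obj z' r u] A2_act[OF r] ext_closed[OF X R_Obj z' u] by simp
    also have "?h (unit K ?X (val_sem L I K V)) = Rzero I"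
      using Tmap_unit[OF X R_Obj z V] V by (simp add: zero_rew_def alg_unit zero_closed)
    finally show ?thesis using x plus_comm[OF r zero_closed] plus_zero[OF r] by simp
  qed
  have "?h (dw_den L I K \<sigma> \<mu>) = convex_comb (Rmix I) \<mu> (\<lambda>x. ?h (?g x))"
    unfolding dw_den_def
    by (rule convex_comb_hom[OF M.barycentric_algebra_axioms barycentric_algebra_axioms])
      (use h hom fin dw_summand_closed[OF assms] in auto)
  also have "\<dots> = convex_comb (Rmix I) \<mu> fst"
    by (rule convex_comb_cong[OF fin]) (use eq wf_dw_fst[OF assms(2)] in auto)
  finally show ?thesis by (simp add: expected_reward_def)
qed

text \<open>Well-formedness of \<open>E\<close> is proved along with the equation because
  \<open>alg_dw_den\<close> needs well-formed outcomes of the best strategies.\<close>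

lemma op_rel_adequate:
  assumes "op_rel L M E" "typing L [] M \<sigma>"
  shows "wf_eff \<sigma> E \<and> sem L I K M [] [] (zero_rew I K \<sigma>) = dw_den L I K \<sigma> (Out I (best_str I E) E)"
  using assms
proof (induction rule: op_rel.induct)
  case (1 V)
  have "\<sigma> \<in> Types L" using typing_Types[OF 1(2)] by simp
  then show ?case
    using sem_val[OF 1] 1 zero_rew_closed by (simp add: S_unit_def dw_den_return)
next
  case (2 M M' E)
  then show ?case using sem_step[OF 2(1,4)] by simp
next
  case (3 C M\<^sub>1 E\<^sub>1 M\<^sub>2 E\<^sub>2)
  have \<sigma>: "\<sigma> \<in> Types L" using typing_Types[OF 3(6)] by simp
  note or = sem_ectx_Or[OF 3(1,6)]
  note IH = 3(4)[OF or(1)] 3(5)[OF or(2)]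
  \<comment> \<open>By \<open>alg_dw_den\<close> the rewards compared by \<open>S_or\<close> are the
    expected rewards of the best plays, so \<open>S_or\<close> and \<open>best_str\<close> perform
    the same test.\<close>
  have rew: "S_rew I K (ty_den I K \<sigma>) (sem L I K (C M\<^sub>1) [] []) (zero_rew I K \<sigma>) = Rew I (best_str I E\<^sub>1) E\<^sub>1"
    "S_rew I K (ty_den I K \<sigma>) (sem L I K (C M\<^sub>2) [] []) (zero_rew I K \<sigma>) = Rew I (best_str I E\<^sub>2) E\<^sub>2"
    using IH \<sigma> by (simp_all add: S_rew_def Rew_def alg_dw_den wf_Out best_str_Str[of \<sigma>])
  show ?case
    using IH zero_rew_closed by (simp add: or(3) S_or_def rew)
next
  case (4 C M\<^sub>1 E\<^sub>1 M\<^sub>2 E\<^sub>2 p)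
  have \<sigma>: "\<sigma> \<in> Types L" using typing_Types[OF 4(6)] by simp
  note mix = sem_ectx_Mix[OF 4(1,6)]
  note IH = 4(4)[OF mix(3)] 4(5)[OF mix(4)]
  interpret M: barycentric_module I "T K (ty_den I K \<sigma>)" "Tmix K (ty_den I K \<sigma>)" "Tact K (ty_den I K \<sigma>)"
    by (rule A1) (rule ty_den_Obj[OF \<sigma>])
  have wf: "wf_dw \<sigma> (Out I s E\<^sub>1)" if "s \<in> Str E\<^sub>1" for s using wf_Out IH(1) that by blast
  have wf': "wf_dw \<sigma> (Out I s E\<^sub>2)" if "s \<in> Str E\<^sub>2" for s using wf_Out IH(2) that by blast
  have den: "dw_den L I K \<sigma> \<mu> \<in> T K (ty_den I K \<sigma>)" if "wf_dw \<sigma> \<mu>" for \<mu>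
    unfolding dw_den_def using that dw_summand_closed[OF \<sigma> that]
    by (intro M.convex_comb_closed) (auto simp: wf_dw_def)
  have Str: "first_str E\<^sub>1 \<in> Str E\<^sub>1" "first_str E\<^sub>2 \<in> Str E\<^sub>2"
    "best_str I E\<^sub>1 \<in> Str E\<^sub>1" "best_str I E\<^sub>2 \<in> Str E\<^sub>2"
    using first_str_least best_str_Str IH by (auto simp: least_in_def)
  have "sem L I K (C (Mix p M\<^sub>1 M\<^sub>2)) [] [] (zero_rew I K \<sigma>)
    = Tmix K (ty_den I K \<sigma>) p (dw_den L I K \<sigma> (Out I (best_str I E\<^sub>1) E\<^sub>1))
        (dw_den L I K \<sigma> (Out I (best_str I E\<^sub>2) E\<^sub>2))"
    using IH zero_rew_closed by (simp add: mix(5) S_mix_def)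
  \<comment> \<open>The semantics plays best in both components, while \<open>best_str\<close> takes
    the first strategy in a component of weight zero. The two agree since \<open>Tmix\<close> at 0
    or 1 discards that component.\<close>
  also have "\<dots> = dw_den L I K \<sigma> (Out I (best_str I (EMix p E\<^sub>1 E\<^sub>2)) (EMix p E\<^sub>1 E\<^sub>2))"
    using Str mix(1,2)
    by (auto simp: dw_den_mix[OF \<sigma>] wf wf' M.mix_zero M.mix_one den)
  finally show ?case using IH mix(1,2) by simp
next
  case (5 C M E c)
  have \<sigma>: "\<sigma> \<in> Types L" using typing_Types[OF 5(4)] by simp
  note act = sem_ectx_Act[OF 5(1,4)]
  note IH = 5(3)[OF act(2)]
  have "wf_dw \<sigma> (Out I (best_str I E) E)" using IH wf_Out best_str_Str by blast
  then show ?case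
    using IH act(1) zero_rew_closed by (simp add: act(3) S_act_def dw_den_act[OF \<sigma>])
qed

end

theorem theorem5p10:
  fixes L :: "('b, 'c, 'f) lang"
    and I :: "('b, 'c, 'f, 'u) interp"
    and K :: "'u aux_monad"
    and M :: "('b, 'c, 'f) trm"
    and \<sigma> :: "'b ty"
  assumes "selection_model L I K"
    and "program L M \<sigma>"
  shows "sem L I K M [] [] (zero_rew I K \<sigma>) = dw_den L I K \<sigma> (Op_s L I M)"
proof -
  interpret selection_model L I K by fact
  have M: "typing L [] M \<sigma>" using assms(2) by (simp add: program_def)
  note adequate = op_rel_adequate[OF op_rel_Op[OF M] M]
  \<comment> \<open>The recursive choices of \<open>best_str\<close>, which mirror the semantics,
    coincide with the global maximisation in \<open>opt_str\<close>.\<close>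
  then have "opt_str I (Op L M) = best_str I (Op L M)"
    using best_str_least opt_str_eq by blast
  with adequate show ?thesis by (simp add: Op_s_def)
qed

end
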